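(* Let $p\in(2,5)$, $\mu>0$, and let $u\in E$ be a radial solution of $$-\Delta u+\Big(u^2\star\frac{1}{4\pi|x|}\Big)u=\mu|u|^{p-1}u\quad\text{in }\mathbb{R}^3 .$$ Then there exist $C_1,C_2>0$ and $R>0$ such that, writing $u(x)=u(r)$ with $r=|x|$, $$u(r)\le C_1r^{-3/4}e^{-C_2\sqrt r}\quad\text{for all }r>R.$$
   Context: $E=\{u\in D^{1,2}(\mathbb{R}^3):\int_{\mathbb{R}^3}\int_{\mathbb{R}^3}\frac{u^2(x)u^2(y)}{|x-y|}\,dx\,dy<+\infty\}$ (real-valued functions). For $u\in E$ set $\phi_u=\frac{1}{4\pi|x|}\star u^2$. A solution $u\in E$ is a weak solution: $\int\nabla u\cdot\nabla\psi+\int\phi_u u\psi=\mu\int|u|^{p-1}u\psi$ for all $\psi\in C_0^\infty(\mathbb{R}^3)$. *)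

theory Defs
  imports "HOL-Analysis.Analysis"
begin

definition partial_deriv :: "3 \<Rightarrow> (real^3 \<Rightarrow> real) \<Rightarrow> real^3 \<Rightarrow> real" where
  "partial_deriv i f x = frechet_derivative f (at x) (axis i 1)"

definition grad :: "(real^3 \<Rightarrow> real) \<Rightarrow> real^3 \<Rightarrow> real^3" where
  "grad f x = (\<chi> i. partial_deriv i f x)"

(* Functions of class C^k on the whole space. *)
primrec Ck :: "nat \<Rightarrow> (real^3 \<Rightarrow> real) \<Rightarrow> bool" where
  "Ck 0 f \<longleftrightarrow> continuous_on UNIV f"
| "Ck (Suc k) f \<longleftrightarrow> (\<forall>x. f differentiable (at x)) \<and> (\<forall>i. Ck k (partial_deriv i f))"

definition test_functions :: "(real^3 \<Rightarrow> real) set" where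
  "test_functions = {\<psi>. (\<forall>k. Ck k \<psi>) \<and> compact (closure {x. \<psi> x \<noteq> 0})}"

definition locally_integrable :: "(real^3 \<Rightarrow> 'b::{banach, second_countable_topology}) \<Rightarrow> bool" where
  "locally_integrable f \<longleftrightarrow> (\<forall>K. compact K \<longrightarrow> set_integrable lborel K f)"

definition has_weak_gradient :: "(real^3 \<Rightarrow> real) \<Rightarrow> (real^3 \<Rightarrow> real^3) \<Rightarrow> bool" where
  "has_weak_gradient u g \<longleftrightarrow>
     locally_integrable u \<and> locally_integrable g \<and>
     (\<forall>\<psi>\<in>test_functions. \<forall>i.
        (\<integral>x. u x * partial_deriv i \<psi> x \<partial>lborel) = - (\<integral>x. g x $ i * \<psi> x \<partial>lborel))"

(* Elements of D^{1,2} and E are Borel representatives of classes modulo equality almost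
   everywhere.  The completion of the test functions under the L^2 norm of the gradient is
   realised as the space of L^6 functions with weak gradient in L^2, where 6 is the critical
   Sobolev exponent in dimension 3. *)
definition D12 :: "(real^3 \<Rightarrow> real) set" where
  "D12 = {u \<in> borel_measurable lborel.
            integrable lborel (\<lambda>x. \<bar>u x\<bar> ^ 6) \<and>
            (\<exists>g. has_weak_gradient u g \<and> integrable lborel (\<lambda>x. (norm (g x))\<^sup>2))}"

definition E_space :: "(real^3 \<Rightarrow> real) set" where
  "E_space = {u \<in> D12.
     (\<integral>\<^sup>+x. \<integral>\<^sup>+y. ennreal ((u x)\<^sup>2 * (u y)\<^sup>2 / norm (x - y)) \<partial>lborel \<partial>lborel) < \<infinity>}"

(* The convolution of u^2 with 1 / (4 pi |x|).  For u in E_space the integrand is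
   integrable, so the default value 0 of the Bochner integral is not used. *)
definition coulomb_potential :: "(real^3 \<Rightarrow> real) \<Rightarrow> real^3 \<Rightarrow> real" where
  "coulomb_potential u x = (\<integral>y. (u y)\<^sup>2 / (4 * pi * norm (x - y)) \<partial>lborel)"

(* The weak gradient g is unique up to a null set, so quantifying it existentially
   or universally makes no difference. *)
definition weak_solution :: "real \<Rightarrow> real \<Rightarrow> (real^3 \<Rightarrow> real) \<Rightarrow> bool" where
  "weak_solution p \<mu> u \<longleftrightarrow>
     (\<exists>g. has_weak_gradient u g \<and>
        (\<forall>\<psi>\<in>test_functions.
           (\<integral>x. g x \<bullet> grad \<psi> x \<partial>lborel) + (\<integral>x. coulomb_potential u x * u x * \<psi> x \<partial>lborel)
           = \<mu> * (\<integral>x. \<bar>u x\<bar> powr (p - 1) * u x * \<psi> x \<partial>lborel)))"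

definition radial_ae :: "(real^3 \<Rightarrow> real) \<Rightarrow> bool" where
  "radial_ae u \<longleftrightarrow> (\<exists>v :: real \<Rightarrow> real. AE x in lborel. u x = v (norm x))"

(* The function written u(r): the continuous radial representative of u away from the origin.
   Being continuous, it is determined by u at every r > 0. *)
definition continuous_radial_profile :: "(real^3 \<Rightarrow> real) \<Rightarrow> (real \<Rightarrow> real) \<Rightarrow> bool" where
  "continuous_radial_profile u v \<longleftrightarrow>
     continuous_on {0<..} v \<and> (AE x in lborel. u x = v (norm x))"

end

theory Submission
  imports Defs
begin

text \<open>
Put \<open>w(r) = r u(r)\<close>. For a bump function \<open>\<zeta>\<close> on the half-line, \<open>\<zeta>(|x|) / |x|\<close> is a test function
with Laplacian \<open>\<zeta>''(|x|) / |x|\<close>, so in polar coordinates the equation says that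
\<open>w'' = (\<Phi> - V) w\<close> on \<open>(0, \<infinity>)\<close> in the sense of distributions, where \<open>\<Phi>\<close> is the profile of the Coulomb
potential and \<open>V = \<mu> |w / r|^(p - 1)\<close>. The potential is finite and continuous, and the lemma of
Du Bois-Reymond then makes \<open>w\<close> twice differentiable after a change on a null set
(\<open>radial_classical_solution\<close>). The profile in the theorem is \<open>w / r\<close>.

The finite Coulomb energy enters twice. Two points of a ball of radius \<open>R\<close> have distance at most \<open>2 R\<close>, so
the square of the mass \<open>\<integral> u^2\<close> of this ball is at most \<open>2 R\<close> times the energy, and the mass is
\<open>O(sqrt R)\<close> (\<open>mass_bound\<close>). It also makes the potential finite, and the mass in one fixed ball
already gives \<open>\<Phi>(r) \<ge> c / r\<close> for large \<open>r\<close> if \<open>u\<close> is not zero almost everywhere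
(\<open>newton_lower_bound\<close>).

The decay estimate concerns \<open>W = w^2\<close>, which satisfies \<open>W'' \<ge> 2 (\<Phi> - V) W\<close> whatever the sign of \<open>w\<close>. The
crucial step is that \<open>V \<le> c / (2 r)\<close> for large \<open>r\<close> (\<open>potential_dominates\<close>). If this fails at \<open>r\<close>, a
doubling argument finds \<open>s\<close> in \<open>[r/2, 3r/2]\<close> with \<open>|u(s)| \<ge> |u(r)|\<close> such that, with
\<open>\<lambda> = |u(s)|^((p - 1)/2)\<close>, the function \<open>|u|\<close> is at most a constant times \<open>|u(s)|\<close> within distance of
order \<open>1 / \<lambda>\<close> of \<open>s\<close>. There \<open>W'' \<ge> - C \<lambda>^2 W(s)\<close>, so \<open>W(s)\<close> is controlled by a mean value of \<open>W\<close>, and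
this interval carries a mass of at least a constant times \<open>r^2 \<lambda>^(4/(p - 1) - 1)\<close>. Since \<open>p < 5\<close>, the
exponent of \<open>\<lambda>\<close> is positive, so \<open>\<lambda>^2 \<ge> c / (2 \<mu> r)\<close> gives a mass of at least a constant times
\<open>r^(5/2 - 2/(p - 1))\<close>. Since \<open>p > 2\<close>, this exponent is larger than \<open>1/2\<close>, which contradicts the
bound on the mass when \<open>r\<close> is large.

Hence \<open>W'' \<ge> (c / r) W\<close> for large \<open>r\<close>. So \<open>W\<close> is convex, and the bound on the mass forces
\<open>W \<rightarrow> 0\<close>. The function \<open>sqrt r exp (- 2 sqrt (c r))\<close> satisfies the opposite differential inequality and
dominates \<open>W\<close> up to a factor by the maximum principle (\<open>exponential_decay\<close>). Taking the square root and
dividing by \<open>r\<close> gives the estimate.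
\<close>

section \<open>Smooth functions of one variable and bump functions\<close>

text \<open>Differentiability of order \<open>k\<close> is a recursive predicate, because closure under sums and products can then be
proved by induction on \<open>k\<close> without writing down any higher derivative.\<close>

primrec diffk :: "nat \<Rightarrow> (real \<Rightarrow> real) \<Rightarrow> bool" where
  "diffk 0 f \<longleftrightarrow> True"
| "diffk (Suc k) f \<longleftrightarrow> (\<exists>f'. (\<forall>x. (f has_real_derivative f' x) (at x)) \<and> diffk k f')"

definition smooth :: "(real \<Rightarrow> real) \<Rightarrow> bool" where
  "smooth f \<longleftrightarrow> (\<forall>k. diffk k f)"

lemma diffk_SucI:
  "(\<And>x. (f has_real_derivative f' x) (at x)) \<Longrightarrow> diffk k f' \<Longrightarrow> diffk (Suc k) f"
  by auto

lemma diffk_SucD: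
  "diffk (Suc k) f \<Longrightarrow> \<exists>f'. (\<forall>x. (f has_real_derivative f' x) (at x)) \<and> diffk k f'"
  by simp

declare diffk.simps(2) [simp del]

lemma diffk_Suc_imp: "diffk (Suc k) f \<Longrightarrow> diffk k f"
proof (induction k arbitrary: f)
  case (Suc k)
  obtain f' where f: "\<And>x. (f has_real_derivative f' x) (at x)" "diffk (Suc k) f'"
    using diffk_SucD[OF Suc.prems] by auto
  show ?case by (rule diffk_SucI[OF f(1) Suc.IH[OF f(2)]])
qed simp

lemma diffk_const: "diffk k (\<lambda>x. c)"
proof (induction k arbitrary: c)
  case (Suc k)
  then show ?case by (intro diffk_SucI[of _ "\<lambda>x. 0"]) auto
qed simp

lemma diffk_add: "diffk k f \<Longrightarrow> diffk k g \<Longrightarrow> diffk k (\<lambda>x. f x + g x)"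
proof (induction k arbitrary: f g)
  case (Suc k)
  obtain f' where f: "\<And>x. (f has_real_derivative f' x) (at x)" "diffk k f'"
    using diffk_SucD[OF Suc.prems(1)] by auto
  obtain g' where g: "\<And>x. (g has_real_derivative g' x) (at x)" "diffk k g'"
    using diffk_SucD[OF Suc.prems(2)] by auto
  show ?case
    by (rule diffk_SucI[OF DERIV_add[OF f(1) g(1)] Suc.IH[OF f(2) g(2)]])
qed simp

lemma diffk_mult: "diffk k f \<Longrightarrow> diffk k g \<Longrightarrow> diffk k (\<lambda>x. f x * g x)"
proof (induction k arbitrary: f g)
  case (Suc k)
  obtain f' where f: "\<And>x. (f has_real_derivative f' x) (at x)" "diffk k f'"
    using diffk_SucD[OF Suc.prems(1)] by auto
  obtain g' where g: "\<And>x. (g has_real_derivative g' x) (at x)" "diffk k g'"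
    using diffk_SucD[OF Suc.prems(2)] by auto
  show ?case
  proof (rule diffk_SucI)
    show "((\<lambda>x. f x * g x) has_real_derivative f' x * g x + g' x * f x) (at x)" for x
      by (rule DERIV_mult[OF f(1) g(1)])
    show "diffk k (\<lambda>x. f' x * g x + g' x * f x)"
      by (rule diffk_add[OF Suc.IH[OF f(2) diffk_Suc_imp[OF Suc.prems(2)]]
            Suc.IH[OF g(2) diffk_Suc_imp[OF Suc.prems(1)]]])
  qed
qed simp

lemma diffk_cmult: "diffk k f \<Longrightarrow> diffk k (\<lambda>x. c * f x)"
  using diffk_mult[OF diffk_const] .

lemma diffk_affine: "diffk k f \<Longrightarrow> diffk k (\<lambda>x. f (c * x + d))"
proof (induction k arbitrary: f)
  case (Suc k)
  obtain f' where f: "\<And>x. (f has_real_derivative f' x) (at x)" "diffk k f'"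
    using diffk_SucD[OF Suc.prems(1)] by auto
  have "((\<lambda>x. c * x + d) has_real_derivative c) (at x)" for x
    by (auto intro!: derivative_eq_intros)
  then have "((\<lambda>x. f (c * x + d)) has_real_derivative c * f' (c * x + d)) (at x)" for x
    unfolding mult.commute[of c "f' _"] by (rule DERIV_chain2[OF f(1)])
  then show ?case
    by (rule diffk_SucI[OF _ diffk_cmult[OF Suc.IH[OF f(2)]]])
qed simp

lemma smooth_const: "smooth (\<lambda>x. c)"
  and smooth_add: "smooth f \<Longrightarrow> smooth g \<Longrightarrow> smooth (\<lambda>x. f x + g x)"
  and smooth_mult: "smooth f \<Longrightarrow> smooth g \<Longrightarrow> smooth (\<lambda>x. f x * g x)"
  and smooth_cmult: "smooth f \<Longrightarrow> smooth (\<lambda>x. c * f x)"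
  and smooth_affine: "smooth f \<Longrightarrow> smooth (\<lambda>x. f (c * x + d))"
  by (auto simp: smooth_def intro: diffk_const diffk_add diffk_mult diffk_cmult diffk_affine)

lemma smooth_diff: "smooth f \<Longrightarrow> smooth g \<Longrightarrow> smooth (\<lambda>x. f x - g x)"
  using smooth_add[OF _ smooth_cmult[of g "-1"], of f] by simp

lemma smooth_antiderivative:
  assumes "\<And>x. (f has_real_derivative f' x) (at x)" "smooth f'"
  shows "smooth f"
  unfolding smooth_def
proof
  fix k show "diffk k f"
  proof (cases k)
    case (Suc n)
    then show ?thesis using diffk_SucI[OF assms(1)] assms(2) by (simp add: smooth_def)
  qed simp
qed

lemma smooth_has_deriv:
  assumes "smooth f"
  shows "(f has_real_derivative deriv f x) (at x)"
proof -
  have "diffk (Suc 0) f" using assms by (simp add: smooth_def)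
  then obtain f' where f': "\<And>x. (f has_real_derivative f' x) (at x)" by (auto dest!: diffk_SucD)
  show ?thesis using f'[of x] unfolding DERIV_imp_deriv[OF f'] .
qed

lemma smooth_deriv:
  assumes "smooth f"
  shows "smooth (deriv f)"
  unfolding smooth_def
proof
  fix k
  have "diffk (Suc k) f" using assms by (simp add: smooth_def)
  then obtain f' where f': "\<And>x. (f has_real_derivative f' x) (at x)" "diffk k f'"
    by (auto dest!: diffk_SucD)
  have "deriv f = f'" using f'(1) by (auto intro!: DERIV_imp_deriv)
  then show "diffk k (deriv f)" using f' by simp
qed

lemma smooth_continuous: "smooth f \<Longrightarrow> continuous_on S f"
  using smooth_has_deriv DERIV_isCont continuous_at_imp_continuous_on by blast

text \<open>The powers of \<open>1 / x\<close> are included because the derivatives of \<open>exp (- 1 / x)\<close> are linear combinations of functions of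
this form (\<open>flat_deriv\<close>). This makes smoothness an induction on the order.\<close>

definition flat :: "nat \<Rightarrow> real \<Rightarrow> real" where
  "flat m x = (if x > 0 then (1 / x) ^ m * exp (- (1 / x)) else 0)"

lemma flat_tendsto_0: "((\<lambda>x. flat m x) \<longlongrightarrow> 0) (at_right 0)"
proof -
  have "((\<lambda>t::real. t ^ m / exp t) \<longlongrightarrow> 0) at_top"
    by (rule tendsto_power_div_exp_0)
  then have "((\<lambda>x::real. inverse x ^ m / exp (inverse x)) \<longlongrightarrow> 0) (at_right 0)"
    by (rule filterlim_compose) (rule filterlim_inverse_at_top_right)
  then show ?thesis
    by (rule Lim_transform_eventually)
       (auto simp: flat_def eventually_at_filter exp_minus field_simps)
qed

lemma flat_deriv:
  "(flat m has_real_derivative (flat (m + 2) x - m * flat (m + 1) x)) (at x)"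
proof -
  consider "x > 0" | "x < 0" | "x = 0" by linarith
  then show ?thesis
  proof cases
    case 1
    have inv: "((\<lambda>x. 1 / x) has_real_derivative - ((1 / x) ^ 2)) (at x)"
      using 1 by (auto intro!: derivative_eq_intros simp: power2_eq_square)
    have exp: "((\<lambda>x. exp (- (1 / x))) has_real_derivative exp (- (1 / x)) * (1 / x) ^ 2) (at x)"
      by (rule derivative_eq_intros inv refl)+ simp
    have "((\<lambda>x. (1 / x) ^ m * exp (- (1 / x))) has_real_derivative
        real m * (- ((1 / x) ^ 2) * (1 / x) ^ (m - Suc 0)) * exp (- (1 / x))
          + exp (- (1 / x)) * (1 / x) ^ 2 * (1 / x) ^ m) (at x)"
      by (rule DERIV_mult[OF DERIV_power[OF inv] exp])
    also have "real m * (- ((1 / x) ^ 2) * (1 / x) ^ (m - Suc 0)) * exp (- (1 / x))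
          + exp (- (1 / x)) * (1 / x) ^ 2 * (1 / x) ^ m = flat (m + 2) x - m * flat (m + 1) x"
      using 1 by (cases m) (auto simp: flat_def power2_eq_square algebra_simps)
    finally have "((\<lambda>x. (1 / x) ^ m * exp (- (1 / x))) has_real_derivative
        (flat (m + 2) x - m * flat (m + 1) x)) (at x)" .
    then show ?thesis
    proof (rule has_field_derivative_transform_within_open[of _ _ _ "{0<..}"])
    qed (use 1 in \<open>auto simp: flat_def\<close>)
  next
    case 2
    have "((\<lambda>x. 0) has_real_derivative (flat (m + 2) x - m * flat (m + 1) x)) (at x)"
      using 2 by (auto simp: flat_def)
    then show ?thesis
    proof (rule has_field_derivative_transform_within_open[of _ _ _ "{..<0}"])
    qed (use 2 in \<open>auto simp: flat_def\<close>)
  next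
    case 3
    have "((\<lambda>h. (flat m (0 + h) - flat m 0) / h) \<longlongrightarrow> 0) (at 0)"
    proof (rule filterlim_split_at)
      have "((\<lambda>h. 0) \<longlongrightarrow> 0) (at_left (0::real))" by simp
      then show "((\<lambda>h. (flat m (0 + h) - flat m 0) / h) \<longlongrightarrow> 0) (at_left 0)"
        by (rule Lim_transform_eventually) (auto simp: flat_def eventually_at_filter)
      show "((\<lambda>h. (flat m (0 + h) - flat m 0) / h) \<longlongrightarrow> 0) (at_right 0)"
        using flat_tendsto_0[of "Suc m"]
        by (rule Lim_transform_eventually) (auto simp: flat_def eventually_at_filter)
    qed
    then show ?thesis using 3 by (simp add: DERIV_def flat_def)
  qed
qed

lemma smooth_flat: "smooth (flat m)"
proof -
  have "diffk k (flat m)" for k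
  proof (induction k arbitrary: m)
    case (Suc k)
    have "diffk k (\<lambda>x. flat (m + 2) x + (- real m) * flat (m + 1) x)"
      by (intro diffk_add diffk_cmult Suc)
    then show ?case
      using flat_deriv[of m] by (intro diffk_SucI[OF flat_deriv]) simp
  qed simp
  then show ?thesis by (simp add: smooth_def)
qed

definition bump_on :: "real \<Rightarrow> real \<Rightarrow> (real \<Rightarrow> real) \<Rightarrow> bool" where
  "bump_on a b f \<longleftrightarrow> smooth f \<and> (\<forall>x. x \<le> a \<or> b \<le> x \<longrightarrow> f x = 0)"

text \<open>The derivative at \<open>x\<close> is already determined by the values to the left of \<open>x\<close>. The end point itself is included, so
derivatives of a function that vanishes outside an open interval vanish at the end points as well.\<close>

lemma deriv_eq_0_of_const_left:
  assumes "(f has_real_derivative d) (at (x::real))" "\<And>y. y \<le> x \<Longrightarrow> f y = c"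
  shows "d = 0"
proof -
  have "(f has_real_derivative d) (at x within {..x})"
    using assms(1) has_field_derivative_at_within by blast
  moreover have "(f has_real_derivative 0) (at x within {..x})"
    by (rule has_field_derivative_transform_within[of "\<lambda>x. c" _ _ _ 1]) (use assms in auto)
  moreover have "at x within {..x} \<noteq> bot"
    by (simp add: at_within_Iic_at_left)
  ultimately show ?thesis
    unfolding has_field_derivative_iff by (blast intro: tendsto_unique)
qed

lemma deriv_eq_0_of_const_right:
  assumes "(f has_real_derivative d) (at (x::real))" "\<And>y. x \<le> y \<Longrightarrow> f y = c"
  shows "d = 0"
proof -
  have "((\<lambda>t. f (- t)) has_real_derivative - d) (at (- x))"
    using DERIV_mirror[of f d "- x"] DERIV_mirror[of "\<lambda>t. f (- t)" "- d" "- x"] assms(1) by simp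
  from deriv_eq_0_of_const_left[OF this, of c] show ?thesis using assms(2) by simp
qed

lemma bump_on_deriv:
  assumes "bump_on a b f"
  shows "bump_on a b (deriv f)"
proof -
  have s: "smooth f" using assms by (simp add: bump_on_def)
  have "deriv f x = 0" if "x \<le> a" for x
    using deriv_eq_0_of_const_left[OF smooth_has_deriv[OF s], of x 0] assms that
    by (auto simp: bump_on_def)
  moreover have "deriv f x = 0" if "b \<le> x" for x
    using deriv_eq_0_of_const_right[OF smooth_has_deriv[OF s], of x 0] assms that
    by (auto simp: bump_on_def)
  ultimately show ?thesis using smooth_deriv[OF s] by (auto simp: bump_on_def)
qed

lemma continuous_antiderivative_vanishing_left:
  fixes f :: "real \<Rightarrow> real"
  assumes "continuous_on UNIV f" "\<And>x. x \<le> a \<Longrightarrow> f x = 0"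
  obtains F where "\<And>x. (F has_real_derivative f x) (at x)" "\<And>x. x \<le> a \<Longrightarrow> F x = 0"
proof -
  have "isCont f x" for x
    using assms(1) by (simp add: continuous_on_eq_continuous_at)
  then have "\<exists>F. \<forall>x::real. -\<infinity> < ereal x \<longrightarrow> ereal x < \<infinity> \<longrightarrow> (F has_vector_derivative f x) (at x)"
    by (intro einterval_antiderivative) auto
  then obtain G where G: "\<And>x. (G has_real_derivative f x) (at x)"
    by (auto simp: has_real_derivative_iff_has_vector_derivative)
  have "G x = G a" if "x \<le> a" for x
  proof (cases "x = a")
    case False
    have "DERIV G y :> 0" if "y < a" for y
      using G[of y] assms(2)[of y] that by simp
    moreover have "continuous_on {x..a} G"
      using G DERIV_isCont continuous_at_imp_continuous_on by blast
    ultimately show ?thesis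
      using DERIV_isconst_end[of x a G] that False by auto
  qed simp
  then have z: "\<And>x. x \<le> a \<Longrightarrow> G x - G a = 0" unfolding right_minus_eq .
  have "((\<lambda>x. G x - G a) has_real_derivative f x) (at x)" for x
    using DERIV_diff[OF G DERIV_const] by simp
  from this z show ?thesis by (rule that)
qed

lemma bump_on_diff: "bump_on a b f \<Longrightarrow> bump_on a b g \<Longrightarrow> bump_on a b (\<lambda>x. f x - g x)"
  by (auto simp: bump_on_def smooth_diff)

lemma bump_on_cmult: "bump_on a b f \<Longrightarrow> bump_on a b (\<lambda>x. c * f x)"
  by (auto simp: bump_on_def smooth_cmult)

lemma bump_on_mono: "bump_on a b f \<Longrightarrow> a' \<le> a \<Longrightarrow> b \<le> b' \<Longrightarrow> bump_on a' b' f"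
  by (auto simp: bump_on_def)

lemma bump_on_smooth: "bump_on a b f \<Longrightarrow> smooth f"
  by (simp add: bump_on_def)

lemma bump_on_continuous: "bump_on a b f \<Longrightarrow> continuous_on S f"
  by (simp add: bump_on_def smooth_continuous)

lemma bump_on_has_deriv: "bump_on a b f \<Longrightarrow> (f has_real_derivative deriv f x) (at x)"
  by (simp add: bump_on_def smooth_has_deriv)

text \<open>The step is the normalised primitive of \<open>exp (- 1 / x) exp (- 1 / (1 - x))\<close>, extended by zero. Its derivative, shifted,
serves as the unit bump below, and its rescalings approximate indicators of intervals.\<close>

lemma smooth_step_exists:
  "\<exists>H. smooth H \<and> (\<forall>x\<le>0. H x = 0) \<and> (\<forall>x\<ge>1. H x = 1) \<and> (\<forall>x. 0 \<le> H x \<and> H x \<le> 1)"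
proof -
  define \<beta> where "\<beta> x = flat 0 x * flat 0 (1 - x)" for x
  have "smooth (\<lambda>x. flat 0 x * flat 0 ((-1) * x + 1))"
    by (intro smooth_mult smooth_affine smooth_flat)
  then have sm: "smooth \<beta>" unfolding \<beta>_def by (simp add: algebra_simps)
  have pos: "\<beta> x > 0" if "0 < x" "x < 1" for x
    using that by (simp add: \<beta>_def flat_def)
  have nonneg: "\<beta> x \<ge> 0" for x by (simp add: \<beta>_def flat_def)
  have z: "\<beta> x = 0" if "x \<le> 0 \<or> 1 \<le> x" for x
    using that by (auto simp: \<beta>_def flat_def)
  obtain G where G: "\<And>x. (G has_real_derivative \<beta> x) (at x)" and G0: "\<And>x. x \<le> 0 \<Longrightarrow> G x = 0"
    using continuous_antiderivative_vanishing_left[OF smooth_continuous[OF sm], of 0] z by blast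
  have cont: "continuous_on S G" for S
    using G DERIV_isCont continuous_at_imp_continuous_on by blast
  have "G 0 < G 1"
    by (rule DERIV_pos_imp_increasing_open) (use G pos cont in auto)
  then have G1: "G 1 > 0" using G0[of 0] by simp
  have Gr: "G x = G 1" if "x \<ge> 1" for x
  proof (cases "x = 1")
    case False
    have "DERIV G y :> 0" if "1 < y" for y using G[of y] z[of y] that by simp
    then show ?thesis
      using DERIV_isconst_end[of 1 x G] that False cont by auto
  qed simp
  have mono: "G x \<le> G y" if "x \<le> y" for x y
    using DERIV_nonneg_imp_nondecreasing[OF that] G nonneg by blast
  have Gnn: "G x \<ge> 0" for x using mono[of 0 x] G0[of 0] G0[of x] by (cases "x \<le> 0") auto
  have Gle: "G x \<le> G 1" for x
  proof (cases "x \<le> 1")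
    case False then show ?thesis using Gr[of x] by linarith
  qed (rule mono)
  have "smooth (\<lambda>x. (1 / G 1) * G x)"
    by (rule smooth_cmult) (rule smooth_antiderivative[OF G sm])
  moreover have "(1 / G 1) * G x = 0" if "x \<le> 0" for x using G0[OF that] by simp
  moreover have "(1 / G 1) * G x = 1" if "x \<ge> 1" for x unfolding Gr[OF that] using G1 by simp
  moreover have "0 \<le> (1 / G 1) * G x \<and> (1 / G 1) * G x \<le> 1" for x using Gnn[of x] Gle[of x] G1 by simp
  ultimately show ?thesis by (intro exI[of _ "\<lambda>x. (1 / G 1) * G x"]) blast
qed

section \<open>The lemma of Du Bois-Reymond on the half-line\<close>

definition locint_pos :: "(real \<Rightarrow> real) \<Rightarrow> bool" where
  "locint_pos q \<longleftrightarrow> (\<forall>a b. 0 < a \<longrightarrow> set_integrable lborel {a..b} q)"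

text \<open>Stated for Euclidean spaces because it is used both on the line and in three dimensions.\<close>

lemma integrable_mult_continuous_compact_support:
  fixes q \<theta> :: "'a::euclidean_space \<Rightarrow> real"
  assumes q: "set_integrable lborel K q" and K: "compact K"
    and \<theta>: "continuous_on UNIV \<theta>" "\<And>x. x \<notin> K \<Longrightarrow> \<theta> x = 0"
  shows "integrable lborel (\<lambda>x. q x * \<theta> x)"
proof -
  have "compact (\<theta> ` K)"
    using K \<theta>(1) continuous_on_subset compact_continuous_image by blast
  then obtain B where B: "\<And>x. x \<in> K \<Longrightarrow> \<bar>\<theta> x\<bar> \<le> B"
    by (metis (no_types) bounded_iff compact_imp_bounded image_eqI real_norm_def)
  have [measurable]: "\<theta> \<in> borel_measurable borel"
    using \<theta>(1) by (rule borel_measurable_continuous_onI)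
  have eq: "(\<lambda>x. q x * \<theta> x) = (\<lambda>x. (indicator K x *\<^sub>R q x) * \<theta> x)"
    using \<theta>(2) by (auto simp: indicator_def fun_eq_iff)
  show ?thesis
    unfolding eq
  proof (rule Bochner_Integration.integrable_bound)
    show "integrable lborel (\<lambda>x. B * (indicator K x *\<^sub>R q x))"
      using q by (simp add: set_integrable_def)
    have [measurable]: "(\<lambda>x. indicator K x *\<^sub>R q x) \<in> borel_measurable lborel"
      using q by (simp add: set_integrable_def borel_measurable_integrable)
    show "(\<lambda>x. (indicator K x *\<^sub>R q x) * \<theta> x) \<in> borel_measurable lborel"
      by measurable
    show "AE x in lborel. norm (indicator K x *\<^sub>R q x * \<theta> x) \<le> norm (B * (indicator K x *\<^sub>R q x))"
    proof (rule AE_I2)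
      fix x
      show "norm (indicator K x *\<^sub>R q x * \<theta> x) \<le> norm (B * (indicator K x *\<^sub>R q x))"
      proof (cases "x \<in> K")
        case True
        then have "\<bar>\<theta> x\<bar> \<le> \<bar>B\<bar>" using B[of x] by simp
        then have "\<bar>q x\<bar> * \<bar>\<theta> x\<bar> \<le> \<bar>q x\<bar> * \<bar>B\<bar>" by (intro mult_left_mono) auto
        then show ?thesis using True by (simp add: abs_mult mult.commute)
      qed simp
    qed
  qed
qed

lemma integrable_locint_bump:
  assumes "locint_pos q" "0 < a" "bump_on a b \<theta>"
  shows "integrable lborel (\<lambda>x. q x * \<theta> x)"
proof (rule integrable_mult_continuous_compact_support)
  show "set_integrable lborel {a..b} q" using assms by (auto simp: locint_pos_def)
qed (use assms in \<open>auto simp: bump_on_def intro: smooth_continuous\<close>)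

lemma locint_pos_continuous:
  assumes "continuous_on {0<..} q"
  shows "locint_pos q"
  unfolding locint_pos_def
proof safe
  fix a b :: real assume "0 < a"
  then show "set_integrable lborel {a..b} q"
    by (intro borel_integrable_atLeastAtMost' continuous_on_subset[OF assms]) auto
qed

lemma locint_pos_diff: "locint_pos f \<Longrightarrow> locint_pos g \<Longrightarrow> locint_pos (\<lambda>x. f x - g x)"
  by (auto simp: locint_pos_def intro: set_integral_diff)

lemma bump_integrable:
  assumes "bump_on a b \<theta>"
  shows "integrable lborel \<theta>"
proof -
  have "integrable lborel (\<lambda>x. 1 * \<theta> x)"
  proof (rule integrable_mult_continuous_compact_support)
    show "set_integrable lborel {a..b} (\<lambda>x. 1::real)"
      by (intro borel_integrable_atLeastAtMost') auto
  qed (use assms in \<open>auto simp: bump_on_def intro: smooth_continuous\<close>)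
  then show ?thesis by simp
qed

lemma integral_deriv_compact:
  fixes F f :: "real \<Rightarrow> real"
  assumes "a \<le> b" "\<And>x. (F has_real_derivative f x) (at x)" "continuous_on UNIV f"
    "\<And>x. x < a \<or> b < x \<Longrightarrow> f x = 0"
  shows "(\<integral>x. f x \<partial>lborel) = F b - F a"
proof -
  have "(\<integral>x. f x * indicator {a..b} x \<partial>lborel) = F b - F a"
    using assms by (intro integral_FTC_Icc_real) (auto simp: continuous_on_eq_continuous_at)
  moreover have "(\<lambda>x. f x * indicator {a..b} x) = f"
  proof
    show "f x * indicator {a..b} x = f x" for x
      using assms(4)[of x] by (cases "x < a \<or> b < x") (auto simp: indicator_def)
  qed
  ultimately show ?thesis by simp
qed

lemma integral_deriv_bump:
  assumes "bump_on a b \<theta>"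
  shows "(\<integral>x. deriv \<theta> x \<partial>lborel) = 0"
proof -
  have "bump_on a (max a b) \<theta>" using bump_on_mono[OF assms] by simp
  then have "(\<integral>x. deriv \<theta> x \<partial>lborel) = \<theta> (max a b) - \<theta> a"
    by (intro integral_deriv_compact)
      (use bump_on_deriv[of a "max a b" \<theta>] in \<open>auto simp: bump_on_def intro: smooth_has_deriv smooth_continuous\<close>)
  then show ?thesis using assms by (auto simp: bump_on_def)
qed

lemma bump_primitive:
  assumes \<theta>: "bump_on a b \<theta>" and ab: "a \<le> b" and "(\<integral>x. \<theta> x \<partial>lborel) = 0"
  obtains \<kappa> where "bump_on a b \<kappa>" "deriv \<kappa> = \<theta>"
proof -
  have zl: "\<And>x. x \<le> a \<Longrightarrow> \<theta> x = 0" and zr: "\<And>x. b \<le> x \<Longrightarrow> \<theta> x = 0"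
    using \<theta> by (auto simp: bump_on_def)
  obtain F where F: "\<And>x. (F has_real_derivative \<theta> x) (at x)" "\<And>x. x \<le> a \<Longrightarrow> F x = 0"
    using continuous_antiderivative_vanishing_left[OF bump_on_continuous[OF \<theta>] zl] by blast
  have "F x = 0" if "b \<le> x" for x
  proof -
    have "(\<integral>x. \<theta> x \<partial>lborel) = F x - F a"
      by (rule integral_deriv_compact)
        (use F(1) bump_on_continuous[OF \<theta>] zl zr that ab in auto)
    then show ?thesis using F(2)[of a] assms(3) by simp
  qed
  then have "bump_on a b F"
    using smooth_antiderivative[OF F(1) bump_on_smooth[OF \<theta>]] F(2) by (auto simp: bump_on_def)
  moreover have "deriv F = \<theta>"
    using F(1) by (auto intro!: DERIV_imp_deriv)
  ultimately show ?thesis by (rule that)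
qed

lemma unit_bump_exists: "\<exists>\<rho>. bump_on 1 2 \<rho> \<and> (\<integral>x. \<rho> x \<partial>lborel) = 1"
proof -
  obtain H where H: "smooth H" "\<And>x. x \<le> 0 \<Longrightarrow> H x = (0::real)" "\<And>x. 1 \<le> x \<Longrightarrow> H x = 1"
    using smooth_step_exists by auto
  define K where "K x = H (1 * x + (- 1))" for x
  have K: "smooth K" unfolding K_def by (rule smooth_affine[OF H(1)])
  have K0: "K x = 0" if "x \<le> 1" for x using that H(2) by (simp add: K_def)
  have K1: "K x = 1" if "x \<ge> 2" for x using that H(3) by (simp add: K_def)
  have "deriv K x = 0" if "x \<le> 1" for x
    by (rule deriv_eq_0_of_const_left[OF smooth_has_deriv[OF K], of x 0]) (use K0 that in auto)
  moreover have "deriv K x = 0" if "2 \<le> x" for x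
    by (rule deriv_eq_0_of_const_right[OF smooth_has_deriv[OF K], of x 1]) (use K1 that in auto)
  ultimately have b: "bump_on 1 2 (deriv K)"
    using smooth_deriv[OF K] by (auto simp: bump_on_def)
  have "(\<integral>x. deriv K x \<partial>lborel) = K 2 - K 1"
    by (rule integral_deriv_compact)
      (use b smooth_has_deriv[OF K] bump_on_continuous[OF b] in \<open>auto simp: bump_on_def\<close>)
  then show ?thesis using b K0[of 1] K1[of 2] by (intro exI[of _ "deriv K"]) simp
qed

text \<open>The positive and the negative part of \<open>q\<close> are densities of finite measures that agree on all rays, which generate the
Borel sets. So the two measures, and then their densities, coincide.\<close>

lemma AE_zero_of_ray_integrals:
  fixes q :: "real \<Rightarrow> real"
  assumes q: "integrable lborel q"
    and zero: "\<And>a. (\<integral>x. q x * indicator {a<..} x \<partial>lborel) = 0"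
  shows "AE x in lborel. q x = 0"
proof -
  have [measurable]: "q \<in> borel_measurable borel" using q by auto
  define P where "P s = density lborel (\<lambda>x. ennreal (max 0 (s * q x)))" for s :: real
  have sq: "integrable lborel (\<lambda>x. max 0 (s * q x) * indicator {a<..} x)" for s a
    by (rule Bochner_Integration.integrable_bound[of _ "\<lambda>x. s * q x"])
       (use q in \<open>auto simp: indicator_def\<close>)
  have em: "emeasure (P s) {a<..} = ennreal (\<integral>x. max 0 (s * q x) * indicator {a<..} x \<partial>lborel)" for s a
  proof -
    have "emeasure (P s) {a<..} = (\<integral>\<^sup>+x. ennreal (max 0 (s * q x) * indicator {a<..} x) \<partial>lborel)"
      unfolding P_def by (subst emeasure_density) (auto simp: ennreal_mult' indicator_def intro!: nn_integral_cong)
    also have "\<dots> = ennreal (\<integral>x. max 0 (s * q x) * indicator {a<..} x \<partial>lborel)"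
      using sq by (intro nn_integral_eq_integral) auto
    finally show ?thesis .
  qed
  have "P 1 = P (-1)"
  proof (rule measure_eqI_lessThan)
    fix a :: real
    have "(\<integral>x. max 0 (1 * q x) * indicator {a<..} x \<partial>lborel) - (\<integral>x. max 0 (-1 * q x) * indicator {a<..} x \<partial>lborel)
       = (\<integral>x. max 0 (1 * q x) * indicator {a<..} x - max 0 (-1 * q x) * indicator {a<..} x \<partial>lborel)"
      by (rule Bochner_Integration.integral_diff[symmetric]; rule sq)
    also have "(\<lambda>x. max 0 (1 * q x) * indicator {a<..} x - max 0 (-1 * q x) * indicator {a<..} x)
       = (\<lambda>x. q x * indicator {a<..} x)"
      by (auto simp: indicator_def max_def)
    finally show "emeasure (P 1) {a<..} = emeasure (P (- 1)) {a<..}"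
      unfolding em using zero[of a] by simp
  qed (auto simp: em, auto simp: P_def)
  then have "AE x in lborel. ennreal (max 0 (1 * q x)) = ennreal (max 0 (-1 * q x))"
    unfolding P_def by (intro sigma_finite_measure.density_unique[OF sigma_finite_lborel]) auto
  then show ?thesis
    by (rule AE_mp) (auto simp: max_def split: if_splits intro!: AE_I2)
qed

text \<open>Differences of rescaled steps converge boundedly to the indicator of an interval, so \<open>q\<close> has integral zero over every
bounded interval away from 0. Countably many such intervals exhaust the half-line.\<close>

lemma fundamental_lemma_variations:
  assumes q: "locint_pos q"
    and zero: "\<And>a b \<theta>. 0 < a \<Longrightarrow> bump_on a b \<theta> \<Longrightarrow> (\<integral>x. q x * \<theta> x \<partial>lborel) = 0"
  shows "AE x in lborel. 0 < x \<longrightarrow> q x = 0"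
proof -
  obtain H where H: "smooth H" "\<And>x. x \<le> 0 \<Longrightarrow> H x = (0::real)" "\<And>x. 1 \<le> x \<Longrightarrow> H x = 1"
    "\<And>x. 0 \<le> H x" "\<And>x. H x \<le> 1"
    using smooth_step_exists by auto
  have intv: "(\<integral>x. q x * indicator {a<..b} x \<partial>lborel) = 0" if ab: "0 < a" "a \<le> b" for a b
  proof -
    define \<theta> where "\<theta> n x = H (real n * x + (- real n * a)) - H (real n * x + (- real n * b))" for n x
    have sm: "smooth (\<theta> n)" for n
      unfolding \<theta>_def by (intro smooth_diff smooth_affine H(1))
    have left: "\<theta> n x = 0" if "x \<le> a" for n x
    proof -
      have "real n * x \<le> real n * a" "real n * x \<le> real n * b" 
        using that ab by (auto intro!: mult_left_mono)
      then show ?thesis by (simp add: \<theta>_def H(2))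
    qed
    have right: "\<theta> (Suc n) x = 0" if "b + 1 \<le> x" for n x
    proof -
      have "real (Suc n) * (x - b) \<ge> 1 * 1" "real (Suc n) * (x - a) \<ge> 1 * 1"
        using that ab by (intro mult_mono; simp)+
      then show ?thesis by (simp add: \<theta>_def H(3) right_diff_distrib del: of_nat_Suc)
    qed
    have bump: "bump_on a (b + 1) (\<theta> (Suc n))" for n
      using sm left right by (auto simp: bump_on_def)
    have lim: "(\<lambda>n. \<theta> (Suc n) x) \<longlonglongrightarrow> indicator {a<..b} x" for x
    proof -
      have Hlim: "(\<lambda>n. H (real (Suc n) * x + (- real (Suc n) * c))) \<longlonglongrightarrow> indicator {c<..} x" for c
      proof (cases "c < x")
        case True
        have "eventually (\<lambda>n. real n \<ge> 1 / (x - c)) sequentially"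
          using eventually_ge_at_top[of "nat \<lceil>1 / (x - c)\<rceil>"]
          by eventually_elim linarith
        then have "eventually (\<lambda>n. H (real (Suc n) * x + (- real (Suc n) * c)) = 1) sequentially"
        proof eventually_elim
          case (elim n)
          have "1 \<le> real (Suc n) * (x - c)"
            using elim True by (simp add: field_simps)
          then show ?case by (intro H(3)) (simp add: algebra_simps)
        qed
        then show ?thesis using True by (simp add: tendsto_eventually)
      next
        case False
        then have "real (Suc n) * x \<le> real (Suc n) * c" for n by (intro mult_left_mono) auto
        then have "real (Suc n) * x + (- real (Suc n) * c) \<le> 0" for n
          by (simp del: of_nat_Suc)
        then have "H (real (Suc n) * x + (- real (Suc n) * c)) = 0" for n
          by (rule H(2))
        then show ?thesis using False by simp
      qed
      have "(\<lambda>n. \<theta> (Suc n) x) \<longlonglongrightarrow> indicator {a<..} x - indicator {b<..} x"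
        unfolding \<theta>_def by (intro tendsto_diff Hlim)
      also have "indicator {a<..} x - indicator {b<..} x = (indicator {a<..b} x :: real)"
        using ab by (auto simp: indicator_def)
      finally show ?thesis .
    qed
    have qi: "integrable lborel (\<lambda>x. indicator {a..b+1} x *\<^sub>R q x)"
      using q ab by (auto simp: locint_pos_def set_integrable_def)
    have eq: "q x * \<theta> (Suc n) x = (indicator {a..b+1} x *\<^sub>R q x) * \<theta> (Suc n) x" for n x
      using left[of x "Suc n"] right[of x n] by (cases "x \<le> a \<or> b + 1 \<le> x") (auto simp: indicator_def)
    have [measurable]: "(\<lambda>x. indicator {a..b+1} x *\<^sub>R q x) \<in> borel_measurable borel"
      using borel_measurable_integrable[OF qi] by simp
    have [measurable]: "\<theta> n \<in> borel_measurable borel" for n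
      using smooth_continuous[OF sm] by (rule borel_measurable_continuous_onI)
    have "(\<lambda>n. \<integral>x. (indicator {a..b+1} x *\<^sub>R q x) * \<theta> (Suc n) x \<partial>lborel) \<longlonglongrightarrow>
       (\<integral>x. (indicator {a..b+1} x *\<^sub>R q x) * indicator {a<..b} x \<partial>lborel)"
    proof (rule integral_dominated_convergence)
      show "integrable lborel (\<lambda>x. norm (indicator {a..b+1} x *\<^sub>R q x))"
        by (rule integrable_norm[OF qi])
      show "AE x in lborel. (\<lambda>n. indicator {a..b+1} x *\<^sub>R q x * \<theta> (Suc n) x)
          \<longlonglongrightarrow> indicator {a..b+1} x *\<^sub>R q x * indicator {a<..b} x"
        by (intro AE_I2 tendsto_mult_left lim)
      have "\<bar>\<theta> (Suc n) x\<bar> \<le> 1" for n x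
        unfolding \<theta>_def abs_le_iff using H(4,5) by (smt (verit))
      then show "AE x in lborel. norm (indicator {a..b+1} x *\<^sub>R q x * \<theta> (Suc n) x)
          \<le> norm (indicator {a..b+1} x *\<^sub>R q x)" for n
        by (intro AE_I2) (simp add: abs_mult mult_left_le)
    qed measurable
    moreover have "(\<integral>x. (indicator {a..b+1} x *\<^sub>R q x) * \<theta> (Suc n) x \<partial>lborel) = 0" for n
      using zero[OF ab(1) bump[of n]] by (simp only: eq)
    ultimately have "(\<integral>x. (indicator {a..b+1} x *\<^sub>R q x) * indicator {a<..b} x \<partial>lborel) = 0"
      by (simp add: LIMSEQ_const_iff)
    moreover have "(\<lambda>x. (indicator {a..b+1} x *\<^sub>R q x) * indicator {a<..b} x) = (\<lambda>x. q x * indicator {a<..b} x)"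
      by (auto simp: indicator_def fun_eq_iff)
    ultimately show ?thesis by simp
  qed
  have "AE x in lborel. q x * indicator {1 / real (Suc n)<..real (Suc n)} x = 0" for n
  proof (rule AE_zero_of_ray_integrals)
    let ?a = "1 / real (Suc n)" and ?b = "real (Suc n)"
    have "?a \<le> 1" "1 \<le> ?b" by auto
    then have le: "?a \<le> ?b" by linarith
    have a0: "0 < ?a" by simp
    have i: "set_integrable lborel {?a..?b} q" using q by (simp add: locint_pos_def)
    have "set_integrable lborel {?a<..?b} q"
      by (rule set_integrable_subset[OF i]) auto
    then show "integrable lborel (\<lambda>x. q x * indicator {?a<..?b} x)"
      by (simp add: set_integrable_def mult.commute)
    show "(\<integral>x. q x * indicator {?a<..?b} x * indicator {a<..} x \<partial>lborel) = 0" for a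
    proof (cases "a \<le> ?b")
      case True
      have "(\<lambda>x. q x * indicator {?a<..?b} x * indicator {a<..} x) = (\<lambda>x. q x * indicator {max ?a a<..?b} x)"
        by (auto simp: indicator_def fun_eq_iff)
      moreover have "0 < max ?a a" "max ?a a \<le> ?b" using a0 le True by (auto simp: less_max_iff_disj)
      ultimately show ?thesis using intv[of "max ?a a" ?b] by simp
    next
      case False
      then have "(\<lambda>x. q x * indicator {?a<..?b} x * indicator {a<..} x) = (\<lambda>x. 0)"
        by (auto simp: indicator_def fun_eq_iff)
      then show ?thesis by simp
    qed
  qed
  then have "AE x in lborel. \<forall>n. q x * indicator {1 / real (Suc n)<..real (Suc n)} x = 0"
    unfolding AE_all_countable by blast
  then show ?thesis
  proof eventually_elim
    case (elim x)
    show ?case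
    proof
      assume x: "0 < x"
      obtain n where n: "real n > max x (1 / x)" using reals_Archimedean2 by blast
      have "1 < real n * x" using n x by (simp add: field_simps)
      also have "\<dots> < real (Suc n) * x" using x by simp
      finally have "1 / real (Suc n) < x" by (simp add: field_simps)
      then have "x \<in> {1 / real (Suc n)<..real (Suc n)}" using n by auto
      then show "q x = 0" using elim[rule_format, of n] by simp
    qed
  qed
qed

text \<open>A bump with integral zero is the derivative of a bump. Subtracting a multiple of \<open>\<rho>\<close> brings every bump into this form,
so a functional that vanishes on derivatives of bumps is determined by its value at \<open>\<rho>\<close>.\<close>

lemma bump_decompose:
  assumes \<rho>: "bump_on 1 2 \<rho>" "(\<integral>x. \<rho> x \<partial>lborel) = 1" and a: "0 < a" and \<theta>: "bump_on a b \<theta>"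
  shows "\<exists>a' b' \<kappa>. 0 < a' \<and> bump_on a' b' \<kappa> \<and>
    (\<forall>x. \<theta> x = (\<integral>x. \<theta> x \<partial>lborel) * \<rho> x + deriv \<kappa> x)"
proof -
  define m where "m = (\<integral>x. \<theta> x \<partial>lborel)"
  have "bump_on (min a 1) (max b 2) (\<lambda>x. \<theta> x - m * \<rho> x)"
    by (intro bump_on_diff bump_on_cmult bump_on_mono[OF \<rho>(1)] bump_on_mono[OF \<theta>]) auto
  moreover have "(\<integral>x. \<theta> x - m * \<rho> x \<partial>lborel) = 0"
    using bump_integrable[OF \<theta>] bump_integrable[OF \<rho>(1)] \<rho>(2) by (simp add: m_def)
  moreover have "min a 1 \<le> max b 2" by simp
  ultimately obtain \<kappa> where \<kappa>: "bump_on (min a 1) (max b 2) \<kappa>" "deriv \<kappa> = (\<lambda>x. \<theta> x - m * \<rho> x)"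
    using bump_primitive[of "min a 1" "max b 2" "\<lambda>x. \<theta> x - m * \<rho> x"] by blast
  have "0 < min a 1" using a by simp
  moreover have "\<theta> x = (\<integral>x. \<theta> x \<partial>lborel) * \<rho> x + deriv \<kappa> x" for x
    by (simp add: \<kappa>(2) m_def)
  ultimately show ?thesis using \<kappa>(1) by blast
qed

lemma du_Bois_Reymond:
  assumes q: "locint_pos q"
    and zero: "\<And>a b \<theta>. 0 < a \<Longrightarrow> bump_on a b \<theta> \<Longrightarrow> (\<integral>x. q x * deriv \<theta> x \<partial>lborel) = 0"
  shows "\<exists>c. AE x in lborel. 0 < x \<longrightarrow> q x = c"
proof -
  obtain \<rho> where \<rho>: "bump_on 1 2 \<rho>" "(\<integral>x. \<rho> x \<partial>lborel) = 1" using unit_bump_exists by blast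
  define c where "c = (\<integral>x. q x * \<rho> x \<partial>lborel)"
  have "AE x in lborel. 0 < x \<longrightarrow> q x - c = 0"
  proof (rule fundamental_lemma_variations)
    show "locint_pos (\<lambda>x. q x - c)"
      by (intro locint_pos_diff q locint_pos_continuous) auto
    fix a b \<theta> assume a: "0 < a" and \<theta>: "bump_on a b \<theta>"
    define m where "m = (\<integral>x. \<theta> x \<partial>lborel)"
    obtain a' b' \<kappa> where \<kappa>: "0 < a'" "bump_on a' b' \<kappa>" "\<And>x. \<theta> x = m * \<rho> x + deriv \<kappa> x"
      using bump_decompose[OF \<rho> a \<theta>] unfolding m_def[symmetric] by auto
    have "(\<integral>x. q x * \<theta> x \<partial>lborel) = (\<integral>x. m * (q x * \<rho> x) + q x * deriv \<kappa> x \<partial>lborel)"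
      by (simp add: \<kappa>(3) algebra_simps)
    also have "\<dots> = m * c + 0"
      using integrable_locint_bump[OF q \<kappa>(1) bump_on_deriv[OF \<kappa>(2)]]
        integrable_locint_bump[OF q _ \<rho>(1)] zero[OF \<kappa>(1,2)] by (simp add: c_def)
    finally have "(\<integral>x. q x * \<theta> x \<partial>lborel) = m * c" by simp
    then show "(\<integral>x. (q x - c) * \<theta> x \<partial>lborel) = 0"
      using integrable_locint_bump[OF q a \<theta>] bump_integrable[OF \<theta>]
      by (simp add: left_diff_distrib m_def)
  qed
  then show ?thesis by auto
qed

text \<open>The distributional derivative of \<open>q\<close> is a constant \<open>d\<close>, by the decomposition of bumps applied once. The first
order lemma for \<open>q(x) - d x\<close> then finishes the proof.\<close>

lemma du_Bois_Reymond_second_order: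
  assumes q: "locint_pos q"
    and zero: "\<And>a b \<theta>. 0 < a \<Longrightarrow> bump_on a b \<theta> \<Longrightarrow> (\<integral>x. q x * deriv (deriv \<theta>) x \<partial>lborel) = 0"
  shows "\<exists>c d. AE x in lborel. 0 < x \<longrightarrow> q x = c + d * x"
proof -
  obtain \<rho> where \<rho>: "bump_on 1 2 \<rho>" "(\<integral>x. \<rho> x \<partial>lborel) = 1" using unit_bump_exists by blast
  define d where "d = - (\<integral>x. q x * deriv \<rho> x \<partial>lborel)"
  have cont: "locint_pos (\<lambda>x. d * x)" by (intro locint_pos_continuous continuous_intros)
  have "\<exists>c. AE x in lborel. 0 < x \<longrightarrow> q x - d * x = c"
  proof (rule du_Bois_Reymond)
    show "locint_pos (\<lambda>x. q x - d * x)" by (intro locint_pos_diff q cont)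
    fix a b \<theta> assume a: "0 < a" and \<theta>: "bump_on a b \<theta>"
    define m where "m = (\<integral>x. \<theta> x \<partial>lborel)"
    obtain a' b' \<kappa> where \<kappa>: "0 < a'" "bump_on a' b' \<kappa>" "\<And>x. \<theta> x = m * \<rho> x + deriv \<kappa> x"
      using bump_decompose[OF \<rho> a \<theta>] unfolding m_def[symmetric] by auto
    have dd: "deriv \<theta> x = m * deriv \<rho> x + deriv (deriv \<kappa>) x" for x
    proof (rule DERIV_imp_deriv)
      have "(\<lambda>x. m * \<rho> x + deriv \<kappa> x) = \<theta>" using \<kappa>(3) by auto
      then show "(\<theta> has_real_derivative m * deriv \<rho> x + deriv (deriv \<kappa>) x) (at x)"
        using DERIV_add[OF DERIV_cmult[OF bump_on_has_deriv[OF \<rho>(1)]]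
            bump_on_has_deriv[OF bump_on_deriv[OF \<kappa>(2)]], of m x] by simp
    qed
    have "(\<integral>x. q x * deriv \<theta> x \<partial>lborel) = (\<integral>x. m * (q x * deriv \<rho> x) + q x * deriv (deriv \<kappa>) x \<partial>lborel)"
      by (simp add: dd algebra_simps)
    also have "\<dots> = m * (- d) + 0"
      using integrable_locint_bump[OF q \<kappa>(1) bump_on_deriv[OF bump_on_deriv[OF \<kappa>(2)]]]
        integrable_locint_bump[OF q _ bump_on_deriv[OF \<rho>(1)]] zero[OF \<kappa>(1,2)] by (simp add: d_def)
    finally have 1: "(\<integral>x. q x * deriv \<theta> x \<partial>lborel) = - m * d" by simp
    \<comment> \<open>Integrating the derivative of \<open>x * \<theta> x\<close> gives the integral of \<open>x * deriv \<theta> x\<close>.\<close>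
    have sm: "smooth (\<lambda>x. x)"
      by (rule smooth_antiderivative[of _ "\<lambda>x. 1"]) (auto simp: smooth_const)
    have b2: "bump_on a b (\<lambda>x. x * \<theta> x)"
      using \<theta> smooth_mult[OF sm] by (auto simp: bump_on_def)
    have dx: "deriv (\<lambda>x. x * \<theta> x) x = \<theta> x + x * deriv \<theta> x" for x
      using DERIV_mult[OF DERIV_ident bump_on_has_deriv[OF \<theta>], of x]
      by (intro DERIV_imp_deriv) (simp add: mult.commute)
    have lx: "locint_pos (\<lambda>x. x)" by (intro locint_pos_continuous continuous_intros)
    have "0 = (\<integral>x. \<theta> x + x * deriv \<theta> x \<partial>lborel)"
      using integral_deriv_bump[OF b2] by (simp add: dx)
    also have "\<dots> = m + (\<integral>x. x * deriv \<theta> x \<partial>lborel)"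
      using bump_integrable[OF \<theta>] integrable_locint_bump[OF lx a bump_on_deriv[OF \<theta>]]
      by (simp add: m_def)
    finally have 2: "(\<integral>x. x * deriv \<theta> x \<partial>lborel) = - m" by simp
    have "(\<integral>x. (q x - d * x) * deriv \<theta> x \<partial>lborel)
        = (\<integral>x. q x * deriv \<theta> x - d * (x * deriv \<theta> x) \<partial>lborel)"
      by (simp add: algebra_simps)
    also have "\<dots> = - m * d - d * (- m)"
      using integrable_locint_bump[OF lx a bump_on_deriv[OF \<theta>]]
        integrable_locint_bump[OF q a bump_on_deriv[OF \<theta>]] by (simp add: 1 2)
    finally show "(\<integral>x. (q x - d * x) * deriv \<theta> x \<partial>lborel) = 0" by simp
  qed
  then obtain c where "AE x in lborel. 0 < x \<longrightarrow> q x - d * x = c" by blast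
  then have "AE x in lborel. 0 < x \<longrightarrow> q x = c + d * x"
    by (rule AE_mp) (auto intro!: AE_I2)
  then show ?thesis by blast
qed

section \<open>Radial test functions in three dimensions\<close>

text \<open>At the origin the function is zero on a neighbourhood, and the linear form is zero because of the factor \<open>x \<bullet> h\<close>.\<close>

lemma has_derivative_radial:
  fixes \<zeta> :: "real \<Rightarrow> real" and x :: "real^3"
  assumes a: "0 < a" and \<zeta>: "bump_on a b \<zeta>"
  shows "((\<lambda>x. \<zeta> (norm x) / norm x ^ m) has_derivative
      (\<lambda>h. (x \<bullet> h) * (deriv \<zeta> (norm x) / norm x ^ (m + 1) - real m * (\<zeta> (norm x) / norm x ^ (m + 2))))) (at x)"
proof (cases "x = 0")
  case True
  have "((\<lambda>x::real^3. 0) has_derivative (\<lambda>h. 0)) (at 0)" by simp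
  then have "((\<lambda>x::real^3. \<zeta> (norm x) / norm x ^ m) has_derivative (\<lambda>h. 0)) (at 0)"
  proof (rule has_derivative_transform_within_open[of _ _ _ UNIV "ball 0 a"])
    show "0 = \<zeta> (norm x) / norm x ^ m" if "x \<in> ball 0 a" for x :: "real^3"
      using that \<zeta> by (simp add: bump_on_def)
  qed (use a in auto)
  then show ?thesis using True by simp
next
  case False
  define t where "t = norm x"
  have t: "0 < t" using False by (simp add: t_def)
  have "((\<lambda>t. \<zeta> t / t ^ m) has_real_derivative
      t * (deriv \<zeta> t / t ^ (m + 1) - real m * (\<zeta> t / t ^ (m + 2)))) (at t)"
  proof (rule DERIV_cong)
    show "((\<lambda>t. \<zeta> t / t ^ m) has_real_derivative
        (deriv \<zeta> t * t ^ m - \<zeta> t * (real m * (1 * t ^ (m - Suc 0)))) / (t ^ m * t ^ m)) (at t)"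
      using t by (intro DERIV_divide DERIV_power DERIV_ident bump_on_has_deriv[OF \<zeta>]) auto
    show "(deriv \<zeta> t * t ^ m - \<zeta> t * (real m * (1 * t ^ (m - Suc 0)))) / (t ^ m * t ^ m)
        = t * (deriv \<zeta> t / t ^ (m + 1) - real m * (\<zeta> t / t ^ (m + 2)))"
      using t by (cases m) (simp_all add: field_simps)
  qed
  then have "((\<lambda>t. \<zeta> t / t ^ m) has_derivative
      (\<lambda>h. t * (deriv \<zeta> t / t ^ (m + 1) - real m * (\<zeta> t / t ^ (m + 2))) * h)) (at (norm x))"
    by (simp add: has_field_derivative_def t_def)
  moreover have "(norm has_derivative (\<lambda>h. sgn x \<bullet> h)) (at x)"
    using has_derivative_norm[OF False] by (simp add: inner_commute)
  ultimately have deriv: "((\<lambda>x. \<zeta> (norm x) / norm x ^ m) has_derivative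
      (\<lambda>h. t * (deriv \<zeta> t / t ^ (m + 1) - real m * (\<zeta> t / t ^ (m + 2))) * (sgn x \<bullet> h))) (at x)"
    by (rule has_derivative_compose[rotated])
  have scal: "t * c * (sgn x \<bullet> h) = (x \<bullet> h) * c" for c h
    using t by (simp add: sgn_div_norm t_def)
  show ?thesis using deriv unfolding scal unfolding t_def .
qed

text \<open>The smallest convenient class of functions that contains \<open>\<zeta>(|x|) / |x|\<close> and is closed under partial derivatives.
Since the bump \<open>\<zeta>\<close> vanishes near zero, all its elements are smooth at the origin.\<close>

inductive radial_span :: "(real^3 \<Rightarrow> real) \<Rightarrow> bool" where
  base: "0 < a \<Longrightarrow> bump_on a b \<zeta> \<Longrightarrow> radial_span (\<lambda>x. \<zeta> (norm x) / norm x ^ m)"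
| coord: "radial_span f \<Longrightarrow> radial_span (\<lambda>x. x $ i * f x)"
| add: "radial_span f \<Longrightarrow> radial_span g \<Longrightarrow> radial_span (\<lambda>x. f x + g x)"
| scale: "radial_span f \<Longrightarrow> radial_span (\<lambda>x. c * f x)"

lemma has_derivative_component: "((\<lambda>x::real^3. x $ i) has_derivative (\<lambda>h. h $ i)) (at x)"
  by (rule bounded_linear_imp_has_derivative) (rule bounded_linear_vec_nth)

lemma radial_span_derivative:
  assumes "radial_span f"
  shows "\<exists>f'. (\<forall>x. (f has_derivative (\<lambda>h. \<Sum>i\<in>UNIV. h $ i * f' i x)) (at x)) \<and> (\<forall>i. radial_span (f' i))"
  using assms
proof induction
  case (base a b \<zeta> m)
  define f' where "f' i x = x $ i * (deriv \<zeta> (norm x) / norm x ^ (m + 1))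
      + (- real m) * (x $ i * (\<zeta> (norm x) / norm x ^ (m + 2)))" for i and x :: "real^3"
  have "radial_span (f' i)" for i
    unfolding f'_def
    by (rule radial_span.add[OF radial_span.coord[OF radial_span.base[OF base(1) bump_on_deriv[OF base(2)]]]
          radial_span.scale[OF radial_span.coord[OF radial_span.base[OF base]]]])
  moreover have "((\<lambda>x. \<zeta> (norm x) / norm x ^ m) has_derivative (\<lambda>h. \<Sum>i\<in>UNIV. h $ i * f' i x)) (at x)" for x
  proof -
    have "(\<Sum>i\<in>UNIV. h $ i * f' i x)
       = (x \<bullet> h) * (deriv \<zeta> (norm x) / norm x ^ (m + 1) - real m * (\<zeta> (norm x) / norm x ^ (m + 2)))" for h
      unfolding inner_vec_def sum_distrib_right by (intro sum.cong) (auto simp: f'_def algebra_simps)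
    then show ?thesis using has_derivative_radial[OF base] by simp
  qed
  ultimately show ?case by blast
next
  case (coord f i)
  then obtain f' where f': "\<And>x. (f has_derivative (\<lambda>h. \<Sum>j\<in>UNIV. h $ j * f' j x)) (at x)"
    "\<And>j. radial_span (f' j)" by blast
  define g where "g j x = (if j = i then 1 else 0) * f x + x $ i * f' j x" for j x
  have "radial_span (g j)" for j
    unfolding g_def by (intro radial_span.add radial_span.scale radial_span.coord coord f')
  moreover have "((\<lambda>x. x $ i * f x) has_derivative (\<lambda>h. \<Sum>j\<in>UNIV. h $ j * g j x)) (at x)" for x
  proof -
    have "(\<Sum>j\<in>UNIV. h $ j * g j x) = x $ i * (\<Sum>j\<in>UNIV. h $ j * f' j x) + h $ i * f x" for h
    proof -
      have "(\<Sum>j\<in>UNIV. h $ j * g j x) = (\<Sum>j\<in>UNIV. x $ i * (h $ j * f' j x) + (if j = i then h $ j * f x else 0))"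
        by (intro sum.cong) (auto simp: g_def algebra_simps)
      then show ?thesis by (simp add: sum.distrib sum_distrib_left)
    qed
    then show ?thesis
      using has_derivative_mult[OF has_derivative_component[of i x] f'(1)[of x]] by (simp add: add.commute)
  qed
  ultimately show ?case by blast
next
  case (add f g)
  obtain f' where f': "\<And>x. (f has_derivative (\<lambda>h. \<Sum>j\<in>UNIV. h $ j * f' j x)) (at x)"
    "\<And>j. radial_span (f' j)" using add.IH(1) by blast
  obtain g' where g': "\<And>x. (g has_derivative (\<lambda>h. \<Sum>j\<in>UNIV. h $ j * g' j x)) (at x)"
    "\<And>j. radial_span (g' j)" using add.IH(2) by blast
  show ?case
    using has_derivative_add[OF f'(1) g'(1)] radial_span.add[OF f'(2) g'(2)]
    by (intro exI[of _ "\<lambda>j x. f' j x + g' j x"]) (simp add: sum.distrib distrib_left)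
next
  case (scale f c)
  then obtain f' where f': "\<And>x. (f has_derivative (\<lambda>h. \<Sum>j\<in>UNIV. h $ j * f' j x)) (at x)"
    "\<And>j. radial_span (f' j)" by blast
  show ?case
    using has_derivative_mult_right[OF f'(1), of c] radial_span.scale[OF f'(2), of c]
    by (intro exI[of _ "\<lambda>j x. c * f' j x"]) (simp add: sum_distrib_left mult.left_commute)
qed

lemma partial_deriv_eq:
  assumes "(f has_derivative (\<lambda>h. \<Sum>i\<in>UNIV. h $ i * f' i)) (at x)"
  shows "partial_deriv i f x = f' i"
proof -
  have "frechet_derivative f (at x) = (\<lambda>h. \<Sum>i\<in>UNIV. h $ i * f' i)"
    using frechet_derivative_at[OF assms] by simp
  moreover have "(\<Sum>j\<in>UNIV. axis i (1::real) $ j * f' j) = f' i"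
    by (subst sum.remove[of _ i]) (auto simp: axis_def)
  ultimately show ?thesis by (simp add: partial_deriv_def)
qed

lemma radial_span_partial_deriv:
  assumes "radial_span f"
  shows "f differentiable (at x)" "radial_span (partial_deriv i f)"
proof -
  obtain f' where f': "\<And>x. (f has_derivative (\<lambda>h. \<Sum>j\<in>UNIV. h $ j * f' j x)) (at x)"
    "\<And>j. radial_span (f' j)" using radial_span_derivative[OF assms] by blast
  show "f differentiable (at x)" using f'(1) by (auto simp: differentiable_def)
  have "partial_deriv i f = f' i" using partial_deriv_eq[OF f'(1)] by auto
  then show "radial_span (partial_deriv i f)" using f'(2) by simp
qed

lemma radial_span_support:
  assumes "radial_span f"
  shows "\<exists>b. \<forall>x. b < norm x \<longrightarrow> f x = 0"
  using assms
proof induction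
  case (base a b \<zeta> m)
  then show ?case by (intro exI[of _ b]) (auto simp: bump_on_def)
next
  case (add f g)
  then obtain b c where "\<forall>x. b < norm x \<longrightarrow> f x = 0" "\<forall>x. c < norm x \<longrightarrow> g x = 0" by auto
  then show ?case by (intro exI[of _ "max b c"]) auto
qed auto

lemma radial_span_test_function:
  assumes "radial_span f"
  shows "f \<in> test_functions"
proof -
  have "Ck k f" for k
    using assms
  proof (induction k arbitrary: f)
    case 0
    then have "isCont f x" for x
      using radial_span_partial_deriv(1) differentiable_imp_continuous_within by blast
    then show ?case by (simp add: continuous_at_imp_continuous_on)
  next
    case (Suc k)
    then show ?case using radial_span_partial_deriv by auto
  qed
  moreover obtain b where b: "\<And>x. b < norm x \<Longrightarrow> f x = 0"
    using radial_span_support[OF assms] by blast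
  have "{x. f x \<noteq> 0} \<subseteq> cball 0 b" using b by force
  then have "bounded {x. f x \<noteq> 0}" using bounded_cball bounded_subset by blast
  then have "compact (closure {x. f x \<noteq> 0})" by (simp add: compact_closure)
  ultimately show ?thesis by (auto simp: test_functions_def)
qed

text \<open>This is the reason for dividing by \<open>|x|\<close>: in three dimensions the first order term of the radial Laplacian cancels.\<close>

lemma laplacian_radial:
  assumes a: "0 < a" and \<zeta>: "bump_on a b \<zeta>"
  shows "(\<Sum>i\<in>UNIV. partial_deriv i (partial_deriv i (\<lambda>x. \<zeta> (norm x) / norm x)) x)
    = deriv (deriv \<zeta>) (norm x) / norm x"
proof -
  define g where "g m x = deriv \<zeta> (norm x) / norm x ^ m" for m and x :: "real^3"
  define f where "f m x = \<zeta> (norm x) / norm x ^ m" for m and x :: "real^3"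
  define D where "D = deriv (deriv \<zeta>) (norm x)"
  have sum_x: "(\<lambda>h. (x \<bullet> h) * c) = (\<lambda>h. \<Sum>i\<in>UNIV. h $ i * (x $ i * c))" for x :: "real^3" and c
    by (auto simp: inner_vec_def sum_distrib_left sum_distrib_right ac_simps)
  have df: "(f m has_derivative (\<lambda>h. (x \<bullet> h) * (g (m + 1) x - real m * f (m + 2) x))) (at x)" for m x
    using has_derivative_radial[OF assms, of m x] unfolding f_def[abs_def] g_def .
  have dg: "(g m has_derivative (\<lambda>h. (x \<bullet> h) * (deriv (deriv \<zeta>) (norm x) / norm x ^ (m + 1) - real m * g (m + 2) x))) (at x)" for m x
    using has_derivative_radial[OF a bump_on_deriv[OF \<zeta>], of m x] unfolding g_def[abs_def] .
  have "partial_deriv i (f 1) = (\<lambda>x. x $ i * (g 2 x - f 3 x))" for i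
    using partial_deriv_eq[OF df[of 1, unfolded sum_x]] by (auto simp: numeral_2_eq_2 numeral_3_eq_3)
  moreover have "(\<lambda>x. \<zeta> (norm x) / norm x) = f 1" by (auto simp: f_def)
  ultimately have p1: "partial_deriv i (\<lambda>x. \<zeta> (norm x) / norm x) = (\<lambda>x. x $ i * (g 2 x - f 3 x))" for i
    by simp
  have p2: "partial_deriv i (\<lambda>x. x $ i * (g 2 x - f 3 x)) x
     = (g 2 x - f 3 x) + (x $ i)\<^sup>2 * (D / norm x ^ 3 - 3 * g 4 x + 3 * f 5 x)" for i
  proof -
    define c where "c = D / norm x ^ 3 - 3 * g 4 x + 3 * f 5 x"
    have "((\<lambda>x. g 2 x - f 3 x) has_derivative (\<lambda>h. (x \<bullet> h) * c)) (at x)"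
      using has_derivative_diff[OF dg[of 2 x] df[of 3 x]]
      by (simp add: c_def D_def algebra_simps power3_eq_cube)
    from has_derivative_mult[OF has_derivative_component[of i x] this]
    have "((\<lambda>x. x $ i * (g 2 x - f 3 x)) has_derivative
        (\<lambda>h. x $ i * ((x \<bullet> h) * c) + h $ i * (g 2 x - f 3 x))) (at x)" .
    then have "frechet_derivative (\<lambda>x. x $ i * (g 2 x - f 3 x)) (at x)
       = (\<lambda>h. x $ i * ((x \<bullet> h) * c) + h $ i * (g 2 x - f 3 x))"
      by (rule frechet_derivative_at[symmetric])
    then show ?thesis
      by (simp add: partial_deriv_def inner_axis c_def power2_eq_square)
  qed
  have "(\<Sum>i\<in>UNIV. partial_deriv i (partial_deriv i (\<lambda>x. \<zeta> (norm x) / norm x)) x)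
    = 3 * (g 2 x - f 3 x) + (\<Sum>i\<in>UNIV. (x $ i)\<^sup>2) * (D / norm x ^ 3 - 3 * g 4 x + 3 * f 5 x)"
    unfolding p1 p2 by (simp add: sum.distrib sum_distrib_right)
  also have "(\<Sum>i\<in>UNIV. (x $ i)\<^sup>2) = (norm x)\<^sup>2"
    unfolding power2_norm_eq_inner inner_vec_def inner_real_def by (simp add: power2_eq_square)
  also have "3 * (g 2 x - f 3 x) + (norm x)\<^sup>2 * (D / norm x ^ 3 - 3 * g 4 x + 3 * f 5 x) = D / norm x"
  proof (cases "x = 0")
    case False
    define n where "n = norm x"
    have n: "n \<noteq> 0" using False by (simp add: n_def)
    have "n\<^sup>2 * (D / n ^ 3) = D / n" "n\<^sup>2 * (3 * (deriv \<zeta> n / n ^ 4)) = 3 * (deriv \<zeta> n / n\<^sup>2)"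
      "n\<^sup>2 * (3 * (\<zeta> n / n ^ 5)) = 3 * (\<zeta> n / n ^ 3)"
      using n by (simp_all add: eval_nat_numeral)
    then show ?thesis
      unfolding f_def g_def n_def[symmetric] distrib_left right_diff_distrib by simp
  qed (simp add: f_def g_def)
  finally show ?thesis by (simp add: D_def)
qed

text \<open>The weak gradient disappears, because the partial derivatives of the test function are test functions themselves.\<close>

lemma weak_solution_radial_test:
  assumes sol: "weak_solution p \<mu> u" and a: "0 < a" and \<zeta>: "bump_on a b \<zeta>"
  shows "- (\<integral>x. u x * (deriv (deriv \<zeta>) (norm x) / norm x) \<partial>lborel)
      + (\<integral>x. coulomb_potential u x * u x * (\<zeta> (norm x) / norm x) \<partial>lborel)
    = \<mu> * (\<integral>x. \<bar>u x\<bar> powr (p - 1) * u x * (\<zeta> (norm x) / norm x) \<partial>lborel)"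
proof -
  define \<psi> where "\<psi> = (\<lambda>x::real^3. \<zeta> (norm x) / norm x)"
  obtain g where g: "has_weak_gradient u g" and eq: "\<And>\<psi>. \<psi> \<in> test_functions \<Longrightarrow>
      (\<integral>x. g x \<bullet> grad \<psi> x \<partial>lborel) + (\<integral>x. coulomb_potential u x * u x * \<psi> x \<partial>lborel)
           = \<mu> * (\<integral>x. \<bar>u x\<bar> powr (p - 1) * u x * \<psi> x \<partial>lborel)"
    using sol unfolding weak_solution_def by blast
  have sp: "radial_span \<psi>" unfolding \<psi>_def using radial_span.base[OF a \<zeta>, of 1] by simp
  have sp1: "radial_span (partial_deriv i \<psi>)" for i by (rule radial_span_partial_deriv(2)[OF sp])
  have sp2: "radial_span (partial_deriv i (partial_deriv i \<psi>))" for i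
    by (rule radial_span_partial_deriv(2)[OF sp1])
  have int: "integrable lborel (\<lambda>x. q x * f x)" if "radial_span f" "\<And>K. compact K \<Longrightarrow> set_integrable lborel K q"
    for f and q :: "real^3 \<Rightarrow> real"
  proof -
    obtain b where b: "\<And>x. b < norm x \<Longrightarrow> f x = 0" using radial_span_support[OF \<open>radial_span f\<close>] by blast
    have "Ck 0 f" using radial_span_test_function[OF \<open>radial_span f\<close>] unfolding test_functions_def by blast
    then show ?thesis
      by (intro integrable_mult_continuous_compact_support[of "cball 0 b"] that(2))
         (use b in \<open>auto simp: not_le\<close>)
  qed
  have gi: "set_integrable lborel K (\<lambda>x. g x $ i)" if "compact K" for K i
  proof -
    have "set_integrable lborel K g" using g that by (simp add: has_weak_gradient_def locally_integrable_def)
    then have "integrable lborel (\<lambda>x. (indicator K x *\<^sub>R g x) $ i)"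
      unfolding set_integrable_def by (rule integrable_bounded_linear[OF bounded_linear_vec_nth])
    then show ?thesis by (simp add: set_integrable_def)
  qed
  have ui: "set_integrable lborel K u" if "compact K" for K
    using g that by (simp add: has_weak_gradient_def locally_integrable_def)
  have "(\<integral>x. g x \<bullet> grad \<psi> x \<partial>lborel) = (\<integral>x. (\<Sum>i\<in>UNIV. g x $ i * partial_deriv i \<psi> x) \<partial>lborel)"
    by (simp add: inner_vec_def grad_def)
  also have "\<dots> = (\<Sum>i\<in>UNIV. \<integral>x. g x $ i * partial_deriv i \<psi> x \<partial>lborel)"
    by (intro Bochner_Integration.integral_sum int sp1 gi)
  also have "\<dots> = (\<Sum>i\<in>UNIV. - (\<integral>x. u x * partial_deriv i (partial_deriv i \<psi>) x \<partial>lborel))"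
  proof (intro sum.cong refl)
    fix i
    have "(\<integral>x. u x * partial_deriv i (partial_deriv i \<psi>) x \<partial>lborel)
        = - (\<integral>x. g x $ i * partial_deriv i \<psi> x \<partial>lborel)"
      using g radial_span_test_function[OF sp1] unfolding has_weak_gradient_def by blast
    then show "(\<integral>x. g x $ i * partial_deriv i \<psi> x \<partial>lborel)
        = - (\<integral>x. u x * partial_deriv i (partial_deriv i \<psi>) x \<partial>lborel)" by simp
  qed
  also have "\<dots> = - (\<Sum>i\<in>UNIV. \<integral>x. u x * partial_deriv i (partial_deriv i \<psi>) x \<partial>lborel)"
    by (rule sum_negf)
  also have "(\<Sum>i\<in>UNIV. \<integral>x. u x * partial_deriv i (partial_deriv i \<psi>) x \<partial>lborel)
     = (\<integral>x. (\<Sum>i\<in>UNIV. u x * partial_deriv i (partial_deriv i \<psi>) x) \<partial>lborel)"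
    by (intro Bochner_Integration.integral_sum[symmetric] int sp2 ui)
  also have "\<dots> = (\<integral>x. u x * (deriv (deriv \<zeta>) (norm x) / norm x) \<partial>lborel)"
    unfolding sum_distrib_left[symmetric] \<psi>_def laplacian_radial[OF a \<zeta>] ..
  finally show ?thesis
    using eq[OF radial_span_test_function[OF sp]] by (simp add: \<psi>_def)
qed

section \<open>Polar coordinates and measurable profiles\<close>

text \<open>The area of the sphere of radius \<open>r\<close>, that is, the density of the distribution of \<open>|x|\<close>.\<close>

definition shell :: "real \<Rightarrow> real" where
  "shell r = 4 * pi * r\<^sup>2 * indicator {0..} r"

lemma shell_nonneg: "0 \<le> shell r" and shell_pos_iff: "0 < shell r \<longleftrightarrow> 0 < r"
  by (auto simp: shell_def indicator_def zero_less_mult_iff)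

lemma shell_measurable [measurable]: "shell \<in> borel_measurable borel"
  unfolding shell_def[abs_def] by measurable

text \<open>Both measures give \<open>{..a}\<close> the volume of a ball of radius \<open>a\<close>. Only integrals of radial functions are needed later, so
this replaces the change to polar coordinates.\<close>

lemma distr_norm_lborel:
  "distr lborel borel (norm :: real^3 \<Rightarrow> real) = density lborel (\<lambda>r. ennreal (shell r))"
proof (rule measure_eqI_generator_eq[where E = "range (\<lambda>a::real. {..a})" and \<Omega> = UNIV and A = "\<lambda>n. {..real n}"])
  show "Int_stable (range (\<lambda>a::real. {..a}))"
    by (auto simp: Int_stable_def)
  have b: "sets borel = sigma_sets UNIV (range (\<lambda>a::real. {..a}))"
    by (subst borel_eq_atMost) simp
  show "sets (distr lborel borel (norm :: real^3 \<Rightarrow> real)) = sigma_sets UNIV (range (\<lambda>a::real. {..a}))"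
    using b by simp
  show "sets (density lborel (\<lambda>r. ennreal (shell r))) = sigma_sets UNIV (range (\<lambda>a::real. {..a}))"
    using b by simp
  have em: "emeasure (distr lborel borel (norm :: real^3 \<Rightarrow> real)) {..a} = ennreal (4 / 3 * pi * (max 0 a) ^ 3)" for a
  proof -
    have "emeasure (distr lborel borel (norm :: real^3 \<Rightarrow> real)) {..a} = emeasure lborel (norm -` {..a} :: (real^3) set)"
      by (subst emeasure_distr) auto
    also have "(norm -` {..a} :: (real^3) set) = (if 0 \<le> a then cball 0 a else {})"
      by (auto intro: order_trans[OF norm_ge_zero])
    also have "emeasure lborel \<dots> = ennreal (4 / 3 * pi * (max 0 a) ^ 3)"
      by (auto simp: emeasure_cball unit_ball_vol_3)
    finally show ?thesis .
  qed
  have em2: "emeasure (density lborel (\<lambda>r. ennreal (shell r))) {..a} = ennreal (4 / 3 * pi * (max 0 a) ^ 3)" for a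
  proof -
    have "emeasure (density lborel (\<lambda>r. ennreal (shell r))) {..a}
        = (\<integral>\<^sup>+r. ennreal (4 * pi * r\<^sup>2) * indicator {0..max 0 a} r \<partial>lborel)"
    proof (subst emeasure_density)
      have "AE r in lborel. r \<noteq> (0::real)" by (rule AE_lborel_singleton)
      then have "AE r in lborel. ennreal (shell r) * indicator {..a} r = ennreal (4 * pi * r\<^sup>2) * indicator {0..max 0 a} r"
        by eventually_elim (auto simp: shell_def indicator_def)
      then show "(\<integral>\<^sup>+r. ennreal (shell r) * indicator {..a} r \<partial>lborel)
          = (\<integral>\<^sup>+r. ennreal (4 * pi * r\<^sup>2) * indicator {0..max 0 a} r \<partial>lborel)"
        by (rule nn_integral_cong_AE)
    qed auto
    also have "\<dots> = ennreal (4 / 3 * pi * (max 0 a) ^ 3 - 4 / 3 * pi * 0 ^ 3)"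
      by (rule nn_integral_FTC_Icc) (auto intro!: derivative_eq_intros simp: power2_eq_square)
    finally show ?thesis by simp
  qed
  show "emeasure (distr lborel borel (norm :: real^3 \<Rightarrow> real)) X = emeasure (density lborel (\<lambda>r. ennreal (shell r))) X"
    if "X \<in> range (\<lambda>a::real. {..a})" for X
    using that em em2 by auto
  show "emeasure (distr lborel borel (norm :: real^3 \<Rightarrow> real)) {..real i} \<noteq> \<infinity>" for i
    by (simp add: em)
  show "(\<Union>i. {..real i}) = (UNIV :: real set)"
    using real_arch_simple by auto
qed auto

lemma AE_radial:
  assumes "Measurable.pred borel P"
  shows "(AE x in lborel. P (norm (x :: real^3))) \<longleftrightarrow> (AE r in lborel. 0 < r \<longrightarrow> P r)"
proof -
  have "(AE x in lborel. P (norm (x :: real^3))) \<longleftrightarrow> (AE r in distr lborel borel (norm :: real^3 \<Rightarrow> real). P r)"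
    using assms by (subst AE_distr_iff) (auto simp: pred_def)
  also have "\<dots> \<longleftrightarrow> (AE r in lborel. 0 < r \<longrightarrow> P r)"
    unfolding distr_norm_lborel by (subst AE_density) (auto simp: shell_pos_iff)
  finally show ?thesis .
qed

lemma nn_integral_radial:
  assumes [measurable]: "f \<in> borel_measurable borel"
  shows "(\<integral>\<^sup>+x. f (norm (x :: real^3)) \<partial>lborel) = (\<integral>\<^sup>+r. ennreal (shell r) * f r \<partial>lborel)"
proof -
  have "(\<integral>\<^sup>+x. f (norm (x :: real^3)) \<partial>lborel) = (\<integral>\<^sup>+r. f r \<partial>distr lborel borel (norm :: real^3 \<Rightarrow> real))"
    by (subst nn_integral_distr) auto
  then show ?thesis unfolding distr_norm_lborel by (simp add: nn_integral_density)
qed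

lemma integral_radial:
  fixes f :: "real \<Rightarrow> real"
  assumes [measurable]: "f \<in> borel_measurable borel"
  shows "(\<integral>x. f (norm (x :: real^3)) \<partial>lborel) = (\<integral>r. shell r * f r \<partial>lborel)"
    and "integrable lborel (\<lambda>x::real^3. f (norm x)) \<longleftrightarrow> integrable lborel (\<lambda>r. shell r * f r)"
proof -
  have "(\<integral>x. f (norm (x :: real^3)) \<partial>lborel) = (\<integral>r. f r \<partial>distr lborel borel (norm :: real^3 \<Rightarrow> real))"
    by (subst integral_distr) auto
  then show "(\<integral>x. f (norm (x :: real^3)) \<partial>lborel) = (\<integral>r. shell r * f r \<partial>lborel)"
    unfolding distr_norm_lborel by (simp add: integral_density shell_nonneg)
  have "integrable lborel (\<lambda>x::real^3. f (norm x)) \<longleftrightarrow> integrable (distr lborel borel (norm :: real^3 \<Rightarrow> real)) f"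
    by (subst integrable_distr_eq) auto
  then show "integrable lborel (\<lambda>x::real^3. f (norm x)) \<longleftrightarrow> integrable lborel (\<lambda>r. shell r * f r)"
    unfolding distr_norm_lborel by (simp add: integrable_density shell_nonneg)
qed

text \<open>Closed sets are countable unions of compact sets, and continuous images of compact sets are compact.\<close>

lemma norm_image_fsigma:
  fixes C :: "(real^3) set"
  assumes "fsigma C"
  shows "norm ` C \<in> sets borel"
  using assms
proof cases
  case (1 F)
  have "C = (\<Union>n. \<Union>m::nat. F n \<inter> cball 0 (real m))"
    unfolding 1 using real_arch_simple by (auto simp: mem_cball_0)
  then have "norm ` C = (\<Union>n. \<Union>m::nat. norm ` (F n \<inter> cball 0 (real m)))"
    by (simp only: image_UN)
  moreover have "norm ` (F n \<inter> cball 0 (real m)) \<in> sets borel" for n m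
  proof -
    have "compact (F n \<inter> cball 0 (real m))" using 1 by (intro closed_Int_compact) auto
    then have "compact (norm ` (F n \<inter> cball 0 (real m)))"
      by (intro compact_continuous_image continuous_intros)
    then show ?thesis by (intro borel_closed compact_imp_closed)
  qed
  ultimately show ?thesis by auto
qed

text \<open>The profile in \<open>radial_ae\<close> is arbitrary, and a preimage under the norm can be Lebesgue measurable without any
obvious reason for the set of radii to be so. Up to a null set, the Lebesgue set \<open>{x. c < v(|x|)}\<close> is a countable
union of closed sets, and its image under the norm is a Borel set of radii contained in \<open>{r. c < v r}\<close>. The function
\<open>V\<close> with these sets as superlevel sets for rational \<open>c\<close> is Borel, at most \<open>v\<close>, and equal to \<open>v\<close> at the norms of
almost all points.\<close>

lemma radial_ae_borel_profile:
  assumes [measurable]: "u \<in> borel_measurable borel" and "radial_ae u"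
  obtains v where "v \<in> borel_measurable borel" "AE x in lborel. u x = v (norm x)"
proof -
  obtain v where v: "AE x in lborel. u x = v (norm x)"
    using assms(2) by (auto simp: radial_ae_def)
  have "(\<lambda>x::real^3. v (norm x)) \<in> borel_measurable lebesgue"
    by (rule borel_measurable_AE[of u]) (use v in \<open>auto intro: AE_completion measurable_completion\<close>)
  then have L: "{x::real^3. c < v (norm x)} \<in> sets lebesgue" for c
    using borel_measurable_iff_greater[of "\<lambda>x::real^3. v (norm x)" lebesgue] by simp
  have "\<exists>C T. fsigma C \<and> T \<in> null_sets lebesgue \<and> C \<union> T = {x::real^3. c < v (norm x)}" for c
    using lebesgue_set_almost_fsigma[OF L[of c]] by metis
  then obtain C T where C: "\<And>c. fsigma (C c)" and T: "\<And>c. T c \<in> null_sets lebesgue"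
    and CT: "\<And>c. C c \<union> T c = {x::real^3. c < v (norm x)}"
    by metis
  \<comment> \<open>The supremum may be \<open>- \<infinity>\<close> on a null set of radii, where \<open>real_of_ereal\<close> gives 0.\<close>
  define V where "V r = (SUP c\<in>\<rat>. if r \<in> norm ` C c then ereal c else - \<infinity>)" for r
  have [measurable]: "norm ` C c \<in> sets borel" for c
    by (rule norm_image_fsigma[OF C])
  have V_meas: "V \<in> borel_measurable borel"
    unfolding V_def by (intro borel_measurable_SUP countable_rat) measurable
  have V_le: "V r \<le> v r" for r
    unfolding V_def
  proof (rule SUP_least)
    fix c :: real
    have "c < v (norm x)" if "x \<in> C c" for x using CT[of c] that by blast
    then show "(if r \<in> norm ` C c then ereal c else - \<infinity>) \<le> ereal (v r)"
      by (auto intro: less_imp_le)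
  qed
  have V_ge: "v (norm x) \<le> V (norm x)" if x: "\<And>c. c \<in> \<rat> \<Longrightarrow> x \<notin> T c" for x
  proof (rule ereal_le_real) 
    fix z :: real assume z: "V (norm x) \<le> ereal z"
    show "ereal (v (norm x)) \<le> ereal z"
    proof (rule ccontr)
      assume "\<not> ereal (v (norm x)) \<le> ereal z"
      then obtain q where q: "q \<in> \<rat>" "z < q" "q < v (norm x)"
        using Rats_dense_in_real[of z "v (norm x)"] by auto
      then have "x \<in> C q" using CT[of q] x[of q] by auto
      then have "ereal q \<le> V (norm x)"
        unfolding V_def using q(1) by (intro SUP_upper2[of q]) auto
      then show False using z q(2) by (metis ereal_less_eq(3) not_le order_trans)
    qed
  qed
  have "AE x in lebesgue. \<forall>c\<in>\<rat>. x \<notin> T c"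
    unfolding AE_ball_countable[OF countable_rat] by (intro ballI AE_not_in T)
  then have T_ae: "AE x in lborel. \<forall>c\<in>\<rat>. x \<notin> T c"
    by (simp add: AE_completion_iff)
  show ?thesis
  proof (rule that)
    show "(\<lambda>r. real_of_ereal (V r)) \<in> borel_measurable borel"
      using V_meas by measurable
    show "AE x in lborel. u x = real_of_ereal (V (norm x))"
      using v T_ae
    proof eventually_elim
      case (elim x)
      have "V (norm x) = ereal (v (norm x))"
        using V_le[of "norm x"] V_ge[of x] elim by (intro antisym) auto
      then show ?case using elim by simp
    qed
  qed
qed

section \<open>The Coulomb potential and the mass of balls\<close>

lemma integrable_lborel_translate:
  fixes f :: "real^3 \<Rightarrow> real"
  assumes "integrable lborel f"
  shows "integrable lborel (\<lambda>y. f (y - x))" "(\<integral>y. f (y - x) \<partial>lborel) = (\<integral>y. f y \<partial>lborel)"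
proof -
  have [measurable]: "f \<in> borel_measurable borel" using assms by auto
  have d: "distr lborel borel ((+) (- x)) = (lborel :: (real^3) measure)" by (rule lborel_distr_plus)
  have "integrable (distr lborel borel ((+) (- x))) f" unfolding d by fact
  then show "integrable lborel (\<lambda>y. f (y - x))" by (subst (asm) integrable_distr_eq) auto
  have "(\<integral>y. f y \<partial>lborel) = (\<integral>y. f y \<partial>distr lborel borel ((+) (- x)))" unfolding d ..
  also have "\<dots> = (\<integral>y. f (y - x) \<partial>lborel)" by (subst integral_distr) auto
  finally show "(\<integral>y. f (y - x) \<partial>lborel) = (\<integral>y. f y \<partial>lborel)" ..
qed

text \<open>The singular part of the kernel after Young's inequality: the power \<open>3/2\<close> of \<open>1 / |z|\<close> is dual to the power \<open>3\<close> of
\<open>u^2\<close>, hence to \<open>u\<close> in \<open>L^6\<close>, and it is locally integrable.\<close>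

definition near_kernel :: "real \<Rightarrow> real^3 \<Rightarrow> real" where
  "near_kernel d z = (if norm z < d then norm z powr (- 3 / 2) else 0)"

lemma near_kernel_integral:
  assumes d: "0 < d"
  shows "integrable lborel (near_kernel d)" "(\<integral>z. near_kernel d z \<partial>lborel) = 8 / 3 * pi * d powr (3 / 2)"
proof -
  define k where "k r = (if r < d then r powr (- 3 / 2) else 0)" for r :: real
  have [measurable]: "k \<in> borel_measurable borel" unfolding k_def[abs_def] by measurable
  have eq: "near_kernel d = (\<lambda>z. k (norm z))" by (auto simp: near_kernel_def k_def)
  have "has_bochner_integral lborel (\<lambda>r. (4 * pi * sqrt r) * indicator {0..d} r)
      (8 / 3 * pi * d powr (3 / 2) - 8 / 3 * pi * 0 powr (3 / 2))"
  proof -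
    have "((\<lambda>r. 4 * pi * sqrt r) has_integral (8 / 3 * pi * d powr (3 / 2) - 8 / 3 * pi * 0 powr (3 / 2))) {0..d}"
    proof (rule fundamental_theorem_of_calculus_interior)
      show "continuous_on {0..d} (\<lambda>r. 8 / 3 * pi * r powr (3 / 2))"
        by (intro continuous_intros continuous_on_powr') auto
      fix r assume r: "r \<in> {0<..<d}"
      have "((\<lambda>r. 8 / 3 * pi * r powr (3 / 2)) has_real_derivative 8 / 3 * pi * (3 / 2 * r powr (3 / 2 - 1))) (at r)"
        using r by (intro DERIV_cmult has_real_derivative_powr) auto
      moreover have "r powr (3 / 2 - 1) = sqrt r" using r by (simp add: powr_half_sqrt)
      ultimately show "((\<lambda>r. 8 / 3 * pi * r powr (3 / 2)) has_vector_derivative 4 * pi * sqrt r) (at r)"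
        by (simp add: has_real_derivative_iff_has_vector_derivative mult.assoc)
    qed (use d in simp)
    moreover have i: "set_integrable lborel {0..d} (\<lambda>r. 4 * pi * sqrt r)"
      by (intro borel_integrable_atLeastAtMost' continuous_intros)
    ultimately have "(LINT r:{0..d}|lborel. 4 * pi * sqrt r) = 8 / 3 * pi * d powr (3 / 2) - 8 / 3 * pi * 0 powr (3 / 2)"
      by (simp only: set_borel_integral_eq_integral(2) integral_unique)
    moreover have "(\<lambda>r. (4 * pi * sqrt r) * indicator {0..d} r) = (\<lambda>r. indicator {0..d} r *\<^sub>R (4 * pi * sqrt r))"
      by (auto simp: mult.commute)
    ultimately show ?thesis
      using i unfolding has_bochner_integral_iff set_integrable_def set_lebesgue_integral_def by simp
  qed
  moreover have "AE r in lborel. shell r * k r = (4 * pi * sqrt r) * indicator {0..d} r"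
  proof -
    have "AE r in lborel. r \<noteq> 0 \<and> r \<noteq> d" using AE_lborel_singleton[of 0] AE_lborel_singleton[of d] by eventually_elim auto
    then show ?thesis
    proof eventually_elim
      case (elim r)
      show ?case
      proof (cases "0 < r \<and> r < d")
        case True
        have "r\<^sup>2 * r powr (- 3 / 2) = r powr 2 * r powr (- 3 / 2)" using True by simp
        also have "\<dots> = r powr (2 + - 3 / 2)" by (rule powr_add[symmetric])
        also have "\<dots> = sqrt r" using True by (simp add: powr_half_sqrt)
        finally show ?thesis using True by (simp add: shell_def k_def)
      qed (use elim in \<open>auto simp: shell_def k_def indicator_def\<close>)
    qed
  qed
  ultimately have "has_bochner_integral lborel (\<lambda>r. shell r * k r) (8 / 3 * pi * d powr (3 / 2))"
    by (subst has_bochner_integral_cong_AE[where g = "\<lambda>r. (4 * pi * sqrt r) * indicator {0..d} r"]) auto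
  then show "integrable lborel (near_kernel d)" "(\<integral>z. near_kernel d z \<partial>lborel) = 8 / 3 * pi * d powr (3 / 2)"
    unfolding eq using integral_radial[of k] by (simp_all add: has_bochner_integral_iff)
qed

text \<open>Young's inequality with exponents \<open>3\<close> and \<open>3/2\<close> for \<open>s^2\<close> and \<open>1 / t\<close>, with a weight \<open>e\<close> that can be chosen small. The
cases distinguish which of the two terms on the right dominates.\<close>

lemma young_cube:
  fixes s t e :: real
  assumes "0 < e" "0 \<le> s" "0 < t"
  shows "s\<^sup>2 / t \<le> e * s ^ 6 + t powr (- 3 / 2) / sqrt e"
proof (cases "1 \<le> e * s ^ 4 * t")
  case True
  have "1 * (s\<^sup>2 / t) \<le> e * s ^ 4 * t * (s\<^sup>2 / t)" using True assms by (intro mult_right_mono) auto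
  then have "s\<^sup>2 / t \<le> e * s ^ 4 * t * (s\<^sup>2 / t)" by simp
  also have "\<dots> = e * s ^ 6" using assms by (simp add: eval_nat_numeral)
  also have "\<dots> \<le> e * s ^ 6 + t powr (- 3 / 2) / sqrt e" using assms by simp
  finally show ?thesis .
next
  case False
  then have "e * (s\<^sup>2)\<^sup>2 * t < 1" by (simp add: power2_eq_square eval_nat_numeral)
  then have "(s\<^sup>2)\<^sup>2 < 1 / (e * t)" using assms by (simp add: field_simps)
  then have "s\<^sup>2 \<le> sqrt (1 / (e * t))" by (intro real_le_rsqrt) simp
  then have "s\<^sup>2 / t \<le> sqrt (1 / (e * t)) / t" using assms by (intro divide_right_mono) auto
  also have "\<dots> = t powr (- 3 / 2) / sqrt e"
  proof -
    have "t powr (- 3 / 2) = t powr (- (1 / 2) - 1)" by simp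
    also have "\<dots> = 1 / sqrt t / t" using assms by (simp only: powr_diff powr_one powr_minus_divide powr_half_sqrt less_imp_le)
    finally show ?thesis by (simp add: real_sqrt_divide real_sqrt_mult)
  qed
  also have "\<dots> \<le> e * s ^ 6 + t powr (- 3 / 2) / sqrt e" using assms by simp
  finally show ?thesis .
qed

text \<open>One point at which the potential is finite controls the contribution of distant mass to the potential at every point, and
\<open>u\<close> in \<open>L^6\<close> controls the contribution of nearby mass.\<close>

locale coulomb_density =
  fixes u :: "real^3 \<Rightarrow> real" and x0 :: "real^3"
  assumes u_meas [measurable]: "u \<in> borel_measurable borel"
    and u6: "integrable lborel (\<lambda>x. \<bar>u x\<bar> ^ 6)"
    and finite_at: "integrable lborel (\<lambda>y. (u y)\<^sup>2 / norm (x0 - y))"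
begin

text \<open>The distance \<open>|x0 - y|\<close> is at most \<open>d + |x - x0|\<close>, hence at most a multiple of \<open>d\<close> once \<open>d\<close> is bounded below. With
\<open>d = |x - y|\<close> this concerns distant mass, with \<open>d = max |x - y| (1 / N)\<close> the truncated kernel.\<close>

lemma far_bound:
  assumes "y \<noteq> x0" "1 \<le> t" "1 / t \<le> d" "norm (x - y) \<le> d"
  shows "(u y)\<^sup>2 / d \<le> t * (1 + norm (x - x0)) * ((u y)\<^sup>2 / norm (x0 - y))"
proof -
  have n: "0 < norm (x0 - y)" using assms by simp
  have d: "0 < d" using assms by (smt (verit) divide_pos_pos)
  have "1 \<le> t * d" using assms d by (simp add: field_simps)
  have "norm (x0 - y) \<le> norm (x - y) + norm (x - x0)"
    using norm_triangle_ineq[of "x - y" "x0 - x"] by (simp add: norm_minus_commute)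
  also have "\<dots> \<le> d + norm (x - x0)" using assms by simp
  also have "\<dots> \<le> t * d + t * d * norm (x - x0)"
  proof -
    have "d \<le> t * d" using assms d by simp
    moreover have "1 * norm (x - x0) \<le> t * d * norm (x - x0)" using \<open>1 \<le> t * d\<close> by (intro mult_right_mono) auto
    ultimately show ?thesis by simp
  qed
  also have "\<dots> = t * (1 + norm (x - x0)) * d" by (simp add: algebra_simps)
  finally have le: "norm (x0 - y) \<le> t * (1 + norm (x - x0)) * d" .
  have "1 / d \<le> t * (1 + norm (x - x0)) / norm (x0 - y)"
    using le n d by (simp add: field_simps)
  from mult_left_mono[OF this, of "(u y)\<^sup>2"] show ?thesis by (simp add: ac_simps)
qed

text \<open>Young's inequality treats the unit ball around \<open>x\<close>, and comparison with the potential at \<open>x0\<close> the rest.\<close>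

lemma integrable_coulomb: "integrable lborel (\<lambda>y. (u y)\<^sup>2 / norm (x - y))"
proof (rule Bochner_Integration.integrable_bound)
  show "integrable lborel (\<lambda>y. \<bar>u y\<bar> ^ 6 + near_kernel 1 (y - x)
      + (1 + norm (x - x0)) * ((u y)\<^sup>2 / norm (x0 - y)))"
    by (intro Bochner_Integration.integrable_add u6 integrable_lborel_translate near_kernel_integral
        integrable_mult_right finite_at) auto
  have "AE y in lborel. y \<noteq> x \<and> y \<noteq> x0"
    using AE_lborel_singleton[of x] AE_lborel_singleton[of x0] by eventually_elim auto
  then show "AE y in lborel. norm ((u y)\<^sup>2 / norm (x - y)) \<le> norm (\<bar>u y\<bar> ^ 6 + near_kernel 1 (y - x)
      + (1 + norm (x - x0)) * ((u y)\<^sup>2 / norm (x0 - y)))"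
  proof eventually_elim
    case (elim y)
    have nn: "0 \<le> near_kernel 1 (y - x)" "0 \<le> (1 + norm (x - x0)) * ((u y)\<^sup>2 / norm (x0 - y))"
      by (auto simp: near_kernel_def)
    have n: "norm (x - y) = norm (y - x)" by (rule norm_minus_commute)
    have "(u y)\<^sup>2 / norm (x - y) \<le> \<bar>u y\<bar> ^ 6 + near_kernel 1 (y - x) + (1 + norm (x - x0)) * ((u y)\<^sup>2 / norm (x0 - y))"
    proof (cases "norm (x - y) < 1")
      case True
      have "\<bar>u y\<bar>\<^sup>2 / norm (x - y) \<le> 1 * \<bar>u y\<bar> ^ 6 + norm (x - y) powr (- 3 / 2) / sqrt 1"
        using elim by (intro young_cube) auto
      then have "(u y)\<^sup>2 / norm (x - y) \<le> \<bar>u y\<bar> ^ 6 + near_kernel 1 (y - x)"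
        using True by (simp add: near_kernel_def n)
      then show ?thesis using nn by linarith
    next
      case False
      have "(u y)\<^sup>2 / norm (x - y) \<le> 1 * (1 + norm (x - x0)) * ((u y)\<^sup>2 / norm (x0 - y))"
        using elim False by (intro far_bound) auto
      then show ?thesis using nn by (simp add: add_increasing)
    qed
    then show ?case using nn by simp
  qed
qed measurable

text \<open>The truncated kernels are bounded and continuous, so these functions are continuous by dominated convergence. They
converge uniformly to the full potential.\<close>

definition truncated :: "nat \<Rightarrow> real^3 \<Rightarrow> real" where
  "truncated n x = (\<integral>y. (u y)\<^sup>2 / max (norm (x - y)) (1 / real (Suc n)) \<partial>lborel)"

lemma truncated_bound:
  assumes "y \<noteq> x0"
  shows "(u y)\<^sup>2 / max (norm (x - y)) (1 / real (Suc n))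
    \<le> real (Suc n) * (1 + norm (x - x0)) * ((u y)\<^sup>2 / norm (x0 - y))"
  using assms by (intro far_bound) auto

lemma truncated_integrable: "integrable lborel (\<lambda>y. (u y)\<^sup>2 / max (norm (x - y)) (1 / real (Suc n)))"
proof (rule Bochner_Integration.integrable_bound)
  show "integrable lborel (\<lambda>y. real (Suc n) * (1 + norm (x - x0)) * ((u y)\<^sup>2 / norm (x0 - y)))"
    by (intro integrable_mult_right finite_at)
  show "AE y in lborel. norm ((u y)\<^sup>2 / max (norm (x - y)) (1 / real (Suc n)))
      \<le> norm (real (Suc n) * (1 + norm (x - x0)) * ((u y)\<^sup>2 / norm (x0 - y)))"
    using AE_lborel_singleton[of x0]
  proof eventually_elim
    case (elim y)
    have "0 \<le> (u y)\<^sup>2 / max (norm (x - y)) (1 / real (Suc n))" by (intro divide_nonneg_nonneg) (auto simp: le_max_iff_disj)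
    then show ?case using truncated_bound[OF elim, of x n] by simp
  qed
qed measurable

lemma truncated_continuous: "continuous_on UNIV (truncated n)"
  unfolding continuous_on_sequentially comp_def
proof (intro ballI allI impI, elim conjE)
  fix s :: "nat \<Rightarrow> real^3" and x assume s: "s \<longlonglongrightarrow> x"
  define N where "N = real (Suc n)"
  have N: "1 \<le> N" by (simp add: N_def)
  have "(\<lambda>k. s k - x0) \<longlonglongrightarrow> x - x0" by (intro tendsto_intros s)
  then have "Bseq (\<lambda>k. s k - x0)" by (intro convergent_imp_Bseq convergentI)
  then obtain B where B: "\<And>k. norm (s k - x0) \<le> B" by (auto simp: Bseq_def)
  show "(\<lambda>k. truncated n (s k)) \<longlonglongrightarrow> truncated n x"
    unfolding truncated_def N_def[symmetric]
  proof (rule integral_dominated_convergence)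
    show "integrable lborel (\<lambda>y. N * (1 + B) * ((u y)\<^sup>2 / norm (x0 - y)))"
      by (intro integrable_mult_right finite_at)
    have pos: "0 < max (norm z) (1 / N)" for z :: "real^3" using N by (simp add: less_max_iff_disj)
    then have "max (norm z) (1 / N) \<noteq> 0" for z :: "real^3" by (metis less_irrefl)
    then show "AE y in lborel. (\<lambda>k. (u y)\<^sup>2 / max (norm (s k - y)) (1 / N)) \<longlonglongrightarrow> (u y)\<^sup>2 / max (norm (x - y)) (1 / N)"
      by (intro AE_I2 tendsto_intros s) auto
    show "AE y in lborel. norm ((u y)\<^sup>2 / max (norm (s k - y)) (1 / N)) \<le> N * (1 + B) * ((u y)\<^sup>2 / norm (x0 - y))" for k
      using AE_lborel_singleton[of x0]
    proof eventually_elim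
      case (elim y)
      have "norm ((u y)\<^sup>2 / max (norm (s k - y)) (1 / N)) = (u y)\<^sup>2 / max (norm (s k - y)) (1 / N)"
        using pos[of "s k - y"] by simp
      also have "\<dots> \<le> N * (1 + norm (s k - x0)) * ((u y)\<^sup>2 / norm (x0 - y))"
        using truncated_bound[OF elim, of "s k" n] by (simp only: N_def)
      also have "\<dots> \<le> N * (1 + B) * ((u y)\<^sup>2 / norm (x0 - y))"
        using B[of k] N by (intro mult_right_mono mult_left_mono) auto
      finally show ?case .
    qed
  qed measurable
qed

definition newton :: "real^3 \<Rightarrow> real" where
  "newton x = (\<integral>y. (u y)\<^sup>2 / norm (x - y) \<partial>lborel)"

lemma coulomb_potential_newton: "coulomb_potential u x = newton x / (4 * pi)"
proof -
  have "(\<lambda>y. (u y)\<^sup>2 / (4 * pi * norm (x - y))) = (\<lambda>y. (1 / (4 * pi)) * ((u y)\<^sup>2 / norm (x - y)))"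
    by auto
  then have "coulomb_potential u x = (1 / (4 * pi)) * newton x"
    unfolding newton_def coulomb_potential_def by (simp only: integral_mult_right_zero)
  then show ?thesis by simp
qed

text \<open>The two kernels differ only for \<open>|x - y| < 1 / N\<close>. There Young's inequality with weight \<open>1 / N\<close> is used: the first term is
\<open>O(1 / N)\<close>, and the second is \<open>sqrt N\<close> times an integral of order \<open>N^(-3/2)\<close>.\<close>

lemma truncated_error:
  "\<bar>newton x - truncated n x\<bar> \<le> ((\<integral>y. \<bar>u y\<bar> ^ 6 \<partial>lborel) + 8 / 3 * pi) / real (Suc n)"
proof -
  define N where "N = real (Suc n)"
  have N: "1 \<le> N" by (simp add: N_def)
  have "\<bar>newton x - truncated n x\<bar>
      = \<bar>\<integral>y. (u y)\<^sup>2 / norm (x - y) - (u y)\<^sup>2 / max (norm (x - y)) (1 / N) \<partial>lborel\<bar>"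
    unfolding newton_def truncated_def N_def
    by (subst Bochner_Integration.integral_diff[OF integrable_coulomb truncated_integrable]) simp
  also have "\<dots> \<le> (\<integral>y. \<bar>(u y)\<^sup>2 / norm (x - y) - (u y)\<^sup>2 / max (norm (x - y)) (1 / N)\<bar> \<partial>lborel)"
    by (rule integral_abs_bound)
  also have "\<dots> \<le> (\<integral>y. 1 / N * \<bar>u y\<bar> ^ 6 + sqrt N * near_kernel (1 / N) (y - x) \<partial>lborel)"
  proof (rule integral_mono_AE)
    show "integrable lborel (\<lambda>y. \<bar>(u y)\<^sup>2 / norm (x - y) - (u y)\<^sup>2 / max (norm (x - y)) (1 / N)\<bar>)"
      unfolding N_def by (intro integrable_abs Bochner_Integration.integrable_diff integrable_coulomb truncated_integrable)
    show "integrable lborel (\<lambda>y. 1 / N * \<bar>u y\<bar> ^ 6 + sqrt N * near_kernel (1 / N) (y - x))"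
      using N by (intro Bochner_Integration.integrable_add integrable_mult_right u6
          integrable_lborel_translate near_kernel_integral) auto
    show "AE y in lborel. \<bar>(u y)\<^sup>2 / norm (x - y) - (u y)\<^sup>2 / max (norm (x - y)) (1 / N)\<bar>
        \<le> 1 / N * \<bar>u y\<bar> ^ 6 + sqrt N * near_kernel (1 / N) (y - x)"
      using AE_lborel_singleton[of x]
    proof eventually_elim
      case (elim y)
      have n: "norm (x - y) = norm (y - x)" by (rule norm_minus_commute)
      show ?case
      proof (cases "norm (x - y) < 1 / N")
        case True
        have p: "0 < norm (x - y)" using elim by simp
        have "0 \<le> (u y)\<^sup>2 / max (norm (x - y)) (1 / N)"
          using p by (intro divide_nonneg_nonneg) (auto simp: le_max_iff_disj)
        moreover have "(u y)\<^sup>2 / max (norm (x - y)) (1 / N) \<le> (u y)\<^sup>2 / norm (x - y)"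
          using p by (intro divide_left_mono) (auto simp: less_max_iff_disj intro!: mult_pos_pos)
        ultimately have "\<bar>(u y)\<^sup>2 / norm (x - y) - (u y)\<^sup>2 / max (norm (x - y)) (1 / N)\<bar> \<le> (u y)\<^sup>2 / norm (x - y)"
          by simp
        also have "\<dots> = \<bar>u y\<bar>\<^sup>2 / norm (x - y)" by simp
        also have "\<dots> \<le> 1 / N * \<bar>u y\<bar> ^ 6 + norm (x - y) powr (- 3 / 2) / sqrt (1 / N)"
          using p N by (intro young_cube) auto
        also have "norm (x - y) powr (- 3 / 2) / sqrt (1 / N) = sqrt N * near_kernel (1 / N) (y - x)"
          using True by (simp add: near_kernel_def n real_sqrt_divide mult.commute)
        finally show ?thesis .
      next
        case False
        then have "max (norm (x - y)) (1 / N) = norm (x - y)" by simp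
        then show ?thesis using N by (simp add: near_kernel_def)
      qed
    qed
  qed
  also have "\<dots> = (\<integral>y. 1 / N * \<bar>u y\<bar> ^ 6 \<partial>lborel) + (\<integral>y. sqrt N * near_kernel (1 / N) (y - x) \<partial>lborel)"
    using N by (intro Bochner_Integration.integral_add integrable_mult_right u6
          integrable_lborel_translate near_kernel_integral) auto
  also have "(\<integral>y. 1 / N * \<bar>u y\<bar> ^ 6 \<partial>lborel) = 1 / N * (\<integral>y. \<bar>u y\<bar> ^ 6 \<partial>lborel)" by simp
  also have "(\<integral>y. sqrt N * near_kernel (1 / N) (y - x) \<partial>lborel) = sqrt N * (8 / 3 * pi * (1 / N) powr (3 / 2))"
    using N by (simp add: integrable_lborel_translate near_kernel_integral)
  also have "\<dots> = 8 / 3 * pi * (1 / N)"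
  proof -
    have "(1 / N) powr (3 / 2) = (1 / N) powr (1 + 1 / 2)" by simp
    also have "\<dots> = 1 / N * sqrt (1 / N)" using N by (simp only: powr_add powr_half_sqrt powr_one zero_le_divide_1_iff)
    finally show ?thesis using N by (simp add: real_sqrt_divide)
  qed
  finally show ?thesis by (simp add: N_def add_divide_distrib)
qed

lemma newton_continuous: "continuous_on UNIV newton"
proof (rule uniform_limit_theorem)
  show "eventually (\<lambda>n. continuous_on UNIV (truncated n)) sequentially"
    by (simp add: truncated_continuous)
  define A where "A = (\<integral>y. \<bar>u y\<bar> ^ 6 \<partial>lborel) + 8 / 3 * pi"
  show "uniform_limit UNIV truncated newton sequentially"
  proof (rule uniform_limitI)
    fix e :: real assume e: "0 < e"
    have "(\<lambda>n. A / real (Suc n)) \<longlonglongrightarrow> 0"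
      by (rule LIMSEQ_Suc[OF lim_const_over_n])
    then have "eventually (\<lambda>n. A / real (Suc n) < e) sequentially"
      using e by (rule order_tendstoD)
    then show "eventually (\<lambda>n. \<forall>x\<in>UNIV. dist (truncated n x) (newton x) < e) sequentially"
    proof eventually_elim
      case (elim n)
      then show ?case
        using truncated_error[of _ n] by (auto simp: dist_real_def A_def abs_minus_commute intro: le_less_trans)
    qed
  qed
qed simp

text \<open>Some ball of radius \<open>n\<close> carries positive mass, and for \<open>|x| \<ge> n\<close> all its points have distance at most \<open>2 |x|\<close> from
\<open>x\<close>.\<close>

lemma newton_lower_bound:
  assumes nz: "\<not> (AE x in lborel. u x = 0)"
  obtains c R where "0 < c" "0 < R" "\<And>x. R \<le> norm x \<Longrightarrow> c / norm x \<le> newton x"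
proof -
  have [measurable]: "(cball 0 (real n) :: (real^3) set) \<in> sets borel" for n by simp
  have int: "integrable lborel (\<lambda>y. indicator (cball 0 (real n)) y * (u y)\<^sup>2)" for n
  proof (rule Bochner_Integration.integrable_bound)
    show "integrable lborel (\<lambda>y. indicator (cball 0 (real n)) y + \<bar>u y\<bar> ^ 6)"
      using u6 by (intro Bochner_Integration.integrable_add) (auto intro!: integrable_real_indicator simp: emeasure_cball)
    have "t\<^sup>2 \<le> 1 + t ^ 6" if "0 \<le> t" for t :: real
    proof (cases "t \<le> 1")
      case True then show ?thesis using that power_le_one[of t 2] by (simp add: add_increasing2)
    next
      case False then have "t ^ 2 \<le> t ^ 6" by (intro power_increasing) auto
      then show ?thesis by simp
    qed
    from this[of "\<bar>u y\<bar>" for y]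
    show "AE y in lborel. norm (indicator (cball 0 (real n)) y * (u y)\<^sup>2)
        \<le> norm (indicator (cball 0 (real n)) y + \<bar>u y\<bar> ^ 6)"
      by (intro AE_I2) (auto simp: indicator_def)
  qed measurable
  have "\<exists>n. (\<integral>y. indicator (cball 0 (real n)) y * (u y)\<^sup>2 \<partial>lborel) \<noteq> 0"
  proof (rule ccontr)
    assume "\<not> ?thesis"
    then have "AE y in lborel. indicator (cball 0 (real n)) y * (u y)\<^sup>2 = 0" for n
      using integral_nonneg_eq_0_iff_AE[OF int[of n]] by auto
    then have "AE y in lborel. \<forall>n. indicator (cball 0 (real n)) y * (u y)\<^sup>2 = 0"
      unfolding AE_all_countable by blast
    then have "AE y in lborel. u y = 0"
    proof eventually_elim
      case (elim y)
      obtain n where "norm y \<le> real n" using real_arch_simple by blast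
      then show ?case using elim[rule_format, of n] by simp
    qed
    then show False using nz by simp
  qed
  then obtain n where n: "(\<integral>y. indicator (cball 0 (real n)) y * (u y)\<^sup>2 \<partial>lborel) \<noteq> 0" by blast
  define m where "m = (\<integral>y. indicator (cball 0 (real n)) y * (u y)\<^sup>2 \<partial>lborel)"
  have "0 \<le> m" unfolding m_def by (intro integral_nonneg_AE AE_I2) auto
  moreover have "m \<noteq> 0" using n unfolding m_def .
  ultimately have m: "0 < m" by simp
  show ?thesis
  proof (rule that)
    show "0 < m / 2" using m by simp
    show "0 < real (Suc n)" by simp
    fix x :: "real^3" assume x: "real (Suc n) \<le> norm x"
    have x': "0 < norm x" using x by (smt (verit) of_nat_0_less_iff zero_less_Suc)
    have "m / 2 / norm x = (\<integral>y. (1 / (2 * norm x)) * (indicator (cball 0 (real n)) y * (u y)\<^sup>2) \<partial>lborel)"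
      by (simp add: m_def)
    also have "\<dots> \<le> newton x"
      unfolding newton_def
    proof (rule integral_mono_AE[OF integrable_mult_right[OF int] integrable_coulomb])
      show "AE y in lborel. (1 / (2 * norm x)) * (indicator (cball 0 (real n)) y * (u y)\<^sup>2) \<le> (u y)\<^sup>2 / norm (x - y)"
        using AE_lborel_singleton[of x]
      proof eventually_elim
        case (elim y)
        show ?case
        proof (cases "norm y \<le> real n")
          case True
          have "norm (x - y) \<le> norm x + norm y" by (rule norm_triangle_ineq4)
          also have "\<dots> \<le> 2 * norm x" using True x by simp
          finally have "norm (x - y) \<le> 2 * norm x" .
          then have "(u y)\<^sup>2 / (2 * norm x) \<le> (u y)\<^sup>2 / norm (x - y)"
            using elim x' by (intro divide_left_mono) auto
          then show ?thesis using True by simp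
        qed simp
      qed
    qed
    finally show "m / 2 / norm x \<le> newton x" .
  qed
qed

end

lemma distr_orthogonal_lborel:
  fixes T :: "real^3 \<Rightarrow> real^3"
  assumes T: "orthogonal_transformation T"
  shows "distr lborel borel T = lborel"
proof (rule lborel_eqI[symmetric])
  have lin: "linear T" using T by (rule orthogonal_transformation_linear)
  then have [measurable]: "T \<in> borel_measurable borel"
    by (intro borel_measurable_continuous_onI linear_continuous_on linear_conv_bounded_linear[THEN iffD1])
  fix l u :: "real^3" assume lu: "\<And>b. b \<in> Basis \<Longrightarrow> l \<bullet> b \<le> u \<bullet> b"
  have inv: "orthogonal_transformation (inv T)" using T by (rule orthogonal_transformation_inv)
  have bij: "bij T" using T by (rule orthogonal_transformation_bij)
  have "emeasure (distr lborel borel T) (box l u) = emeasure lborel (T -` box l u)"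
    by (subst emeasure_distr) auto
  also have "T -` box l u = inv T ` box l u" using bij by (rule bij_vimage_eq_inv_image)
  also have "emeasure lborel (inv T ` box l u) = emeasure lebesgue (inv T ` box l u)"
  proof -
    have "T -` box l u \<in> sets borel" using measurable_sets[of T borel borel "box l u"] by simp
    then show ?thesis using bij_vimage_eq_inv_image[OF bij, of "box l u"] by simp
  qed
  also have "\<dots> = ennreal (measure lebesgue (inv T ` box l u))"
    by (intro emeasure_eq_measure2 fmeasurableD2) (rule measurable_orthogonal_image[OF inv]; simp)
  also have "\<dots> = emeasure lborel (box l u)"
    using measure_orthogonal_image[OF inv, of "box l u"] by (simp add: emeasure_eq_measure2)
  also have "\<dots> = ennreal (\<Prod>b\<in>Basis. (u - l) \<bullet> b)"
    using lu by (simp add: emeasure_lborel_box_eq)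
  finally show "emeasure (distr lborel borel T) (box l u) = ennreal (\<Prod>b\<in>Basis. (u - l) \<bullet> b)" .
qed simp

text \<open>Points of equal norm are exchanged by an orthogonal map, which preserves Lebesgue measure, distances and \<open>u\<close>.\<close>

lemma coulomb_potential_radial:
  assumes [measurable]: "u \<in> borel_measurable borel" and v: "AE x in lborel. u x = v (norm x)"
    and [measurable]: "v \<in> borel_measurable borel" and xy: "norm x = norm y"
  shows "coulomb_potential u x = coulomb_potential u y"
proof -
  obtain T where T: "orthogonal_transformation T" and Tx: "T x = y"
    using orthogonal_transformation_exists[OF xy] by blast
  have lin: "linear T" using T by (rule orthogonal_transformation_linear)
  then have [measurable]: "T \<in> borel_measurable borel"
    by (intro borel_measurable_continuous_onI linear_continuous_on linear_conv_bounded_linear[THEN iffD1])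
  note d = distr_orthogonal_lborel[OF T]
  have nT: "norm (T z) = norm z" for z using T by (simp add: orthogonal_transformation_norm)
  have "AE x in distr lborel borel T. u x = v (norm x)" unfolding d by (rule v)
  then have vT: "AE z in lborel. u (T z) = v (norm (T z))"
    by (subst (asm) AE_distr_iff) auto
  have "coulomb_potential u y = (\<integral>z. (u z)\<^sup>2 / (4 * pi * norm (y - z)) \<partial>distr lborel borel T)"
    unfolding d coulomb_potential_def ..
  also have "\<dots> = (\<integral>z. (u (T z))\<^sup>2 / (4 * pi * norm (y - T z)) \<partial>lborel)"
    by (subst integral_distr) auto
  also have "\<dots> = (\<integral>z. (u z)\<^sup>2 / (4 * pi * norm (x - z)) \<partial>lborel)"
  proof (rule integral_cong_AE)
    show "AE z in lborel. (u (T z))\<^sup>2 / (4 * pi * norm (y - T z)) = (u z)\<^sup>2 / (4 * pi * norm (x - z))"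
      using v vT
    proof eventually_elim
      case (elim z)
      have "norm (y - T z) = norm (x - z)"
        unfolding Tx[symmetric] linear_diff[OF lin, symmetric] by (rule nT)
      then show ?case using elim by (simp add: nT)
    qed
  qed measurable
  finally show ?thesis by (simp add: coulomb_potential_def)
qed

text \<open>The inner integral of the energy is finite for almost every \<open>x\<close>, and it is \<open>(u x)\<^sup>2\<close> times the potential at \<open>x\<close>.\<close>

lemma energy_finite_point:
  assumes [measurable]: "u \<in> borel_measurable borel"
    and fin: "(\<integral>\<^sup>+x. \<integral>\<^sup>+y. ennreal ((u x)\<^sup>2 * (u y)\<^sup>2 / norm (x - y)) \<partial>lborel \<partial>lborel) < \<infinity>"
    and nz: "\<not> (AE x in lborel. u x = 0)"
  obtains x0 :: "real^3" where "integrable lborel (\<lambda>y. (u y)\<^sup>2 / norm (x0 - y))"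
proof -
  have "AE x in lborel. (\<integral>\<^sup>+y. ennreal ((u x)\<^sup>2 * (u y)\<^sup>2 / norm (x - y)) \<partial>lborel) \<noteq> \<infinity>"
    using fin by (intro nn_integral_PInf_AE) auto
  then have "\<exists>x. u x \<noteq> 0 \<and> (\<integral>\<^sup>+y. ennreal ((u x)\<^sup>2 * (u y)\<^sup>2 / norm (x - y)) \<partial>lborel) \<noteq> \<infinity>"
  proof (rule contrapos_pp)
    assume "\<nexists>x. u x \<noteq> 0 \<and> (\<integral>\<^sup>+y. ennreal ((u x)\<^sup>2 * (u y)\<^sup>2 / norm (x - y)) \<partial>lborel) \<noteq> \<infinity>"
    then have "(\<integral>\<^sup>+y. ennreal ((u x)\<^sup>2 * (u y)\<^sup>2 / norm (x - y)) \<partial>lborel) \<noteq> \<infinity> \<Longrightarrow> u x = 0" for x by blast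
    then show "\<not> (AE x in lborel. (\<integral>\<^sup>+y. ennreal ((u x)\<^sup>2 * (u y)\<^sup>2 / norm (x - y)) \<partial>lborel) \<noteq> \<infinity>)"
      using nz by (metis (mono_tags, lifting) AE_mp AE_I2)
  qed
  then obtain x where x: "u x \<noteq> 0" "(\<integral>\<^sup>+y. ennreal ((u x)\<^sup>2 * (u y)\<^sup>2 / norm (x - y)) \<partial>lborel) \<noteq> \<infinity>" by blast
  have "integrable lborel (\<lambda>y. (u x)\<^sup>2 * (u y)\<^sup>2 / norm (x - y))"
    using x(2) by (intro integrableI_nonneg) (auto simp: top.not_eq_extremum)
  then have "integrable lborel (\<lambda>y. (1 / (u x)\<^sup>2) * ((u x)\<^sup>2 * (u y)\<^sup>2 / norm (x - y)))"
    by (rule integrable_mult_right)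
  then have "integrable lborel (\<lambda>y. (u y)\<^sup>2 / norm (x - y))" using x(1) by simp
  then show ?thesis by (rule that)
qed

text \<open>On the ball of radius \<open>b\<close> the kernel \<open>1 / |x - y|\<close> is at least \<open>1 / (2 b)\<close>. So the energy is at least the squared mass divided by
\<open>2 b\<close>.\<close>

lemma mass_bound:
  fixes u :: "real^3 \<Rightarrow> real"
  assumes [measurable]: "u \<in> borel_measurable borel"
    and fin: "(\<integral>\<^sup>+x. \<integral>\<^sup>+y. ennreal ((u x)\<^sup>2 * (u y)\<^sup>2 / norm (x - y)) \<partial>lborel \<partial>lborel) < \<infinity>"
  obtains K where "0 \<le> K" "\<And>b. 0 \<le> b \<Longrightarrow>
    (\<integral>\<^sup>+x. ennreal (indicator (cball 0 b) x * (u x)\<^sup>2) \<partial>lborel) \<le> ennreal (K * sqrt b)"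
proof -
  define D where "D = (\<integral>\<^sup>+x. \<integral>\<^sup>+y. ennreal ((u x)\<^sup>2 * (u y)\<^sup>2 / norm (x - y)) \<partial>lborel \<partial>lborel)"
  define d where "d = enn2real D"
  have D: "D = ennreal d" "0 \<le> d" using fin by (auto simp: d_def D_def)
  have "(\<integral>\<^sup>+x. ennreal (indicator (cball 0 b) x * (u x)\<^sup>2) \<partial>lborel) \<le> ennreal (sqrt (2 * d) * sqrt b)" if b: "0 \<le> b" for b
  proof -
    define U where "U x = indicator (cball 0 b) x * (u x)\<^sup>2" for x :: "real^3"
    have [measurable]: "(cball 0 b :: (real^3) set) \<in> sets borel" by simp
    have [measurable]: "U \<in> borel_measurable borel" unfolding U_def[abs_def] by measurable
    have U0: "0 \<le> U x" for x by (simp add: U_def)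
    define M where "M = (\<integral>\<^sup>+x. ennreal (U x) \<partial>lborel)"
    \<comment> \<open>The mass may still be infinite here, so the square is computed in the extended nonnegative reals.\<close>
    have "M * M = (\<integral>\<^sup>+x. ennreal (U x) * M \<partial>lborel)"
      unfolding M_def by (subst nn_integral_multc) auto
    also have "\<dots> = (\<integral>\<^sup>+x. \<integral>\<^sup>+y. ennreal (U x) * ennreal (U y) \<partial>lborel \<partial>lborel)"
      unfolding M_def by (subst nn_integral_cmult) auto
    also have "\<dots> \<le> (\<integral>\<^sup>+x. \<integral>\<^sup>+y. ennreal (2 * b) * ennreal ((u x)\<^sup>2 * (u y)\<^sup>2 / norm (x - y)) \<partial>lborel \<partial>lborel)"
    proof (rule nn_integral_mono, rule nn_integral_mono_AE)
      fix x :: "real^3"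
      show "AE y in lborel. ennreal (U x) * ennreal (U y) \<le> ennreal (2 * b) * ennreal ((u x)\<^sup>2 * (u y)\<^sup>2 / norm (x - y))"
        using AE_lborel_singleton[of x]
      proof eventually_elim
        case (elim y)
        have "U x * U y \<le> 2 * b * ((u x)\<^sup>2 * (u y)\<^sup>2 / norm (x - y))"
        proof (cases "norm x \<le> b \<and> norm y \<le> b")
          case True
          have n: "0 < norm (x - y)" using elim by simp
          have "norm (x - y) \<le> 2 * b" using True norm_triangle_ineq4[of x y] by linarith
          then have "1 \<le> 2 * b / norm (x - y)" using n by simp
          from mult_left_mono[OF this, of "(u x)\<^sup>2 * (u y)\<^sup>2"] show ?thesis
            using True by (simp add: U_def ac_simps)
        qed (use b in \<open>auto simp: U_def\<close>)
        then show ?case using b U0 by (simp flip: ennreal_mult')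
      qed
    qed
    also have "\<dots> = ennreal (2 * b) * D"
      unfolding D_def by (simp add: nn_integral_cmult)
    also have "\<dots> = ennreal (2 * b * d)" unfolding D(1) by (rule ennreal_mult[symmetric]) (use b D(2) in auto)
    finally have MM: "M * M \<le> ennreal (2 * b * d)" .
    then have "M \<noteq> \<infinity>" by (auto simp: top_unique ennreal_top_mult split: if_splits)
    then obtain m where m: "M = ennreal m" "0 \<le> m" by (cases M) auto
    have "m * m \<le> 2 * b * d" using MM m b D by (simp flip: ennreal_mult')
    then have "m \<le> sqrt (2 * b * d)" by (intro real_le_rsqrt) (simp add: power2_eq_square)
    then show ?thesis using m unfolding M_def U_def by (simp add: real_sqrt_mult ac_simps ennreal_leI)
  qed
  then show ?thesis using D by (intro that[of "sqrt (2 * d)"]) auto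
qed

section \<open>The radial equation and its classical solutions\<close>

text \<open>The Green function of the second derivative with zero value and slope at \<open>t = 1\<close>. For \<open>t > 0\<close> it vanishes unless
\<open>s\<close> lies between \<open>1\<close> and \<open>t\<close>, so only values of the integrand away from \<open>0\<close> enter.\<close>

definition green :: "real \<Rightarrow> real \<Rightarrow> real" where
  "green t s = (if 1 \<le> s then max 0 (t - s) else max 0 (s - t))"

lemma green_measurable [measurable]: "case_prod green \<in> borel_measurable (borel \<Otimes>\<^sub>M borel)"
  unfolding green_def by measurable

lemma green_bound:
  assumes "\<alpha> \<le> t" "t \<le> \<beta>" "\<alpha> \<le> 1" "1 \<le> \<beta>"
  shows "\<bar>green t s\<bar> \<le> (\<beta> - \<alpha>) * indicator {\<alpha>..\<beta>} s"
  using assms by (auto simp: green_def indicator_def)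

text \<open>Taylor's formula with integral remainder at an end of the support, where \<open>\<zeta>\<close> and its derivative vanish: the right end
for \<open>1 \<le> s\<close>, and the left end otherwise.\<close>

lemma green_represents:
  assumes \<zeta>: "bump_on a b \<zeta>"
  shows "(\<integral>t. green t s * deriv (deriv \<zeta>) t \<partial>lborel) = \<zeta> s"
proof -
  define H where "H t = (t - s) * deriv \<zeta> t - \<zeta> t" for t
  define h where "h t = (t - s) * deriv (deriv \<zeta>) t" for t
  have dH: "(H has_real_derivative h t) (at t)" for t
    unfolding H_def h_def
    by (rule derivative_eq_intros bump_on_has_deriv[OF \<zeta>] bump_on_has_deriv[OF bump_on_deriv[OF \<zeta>]] refl)+ simp
  have ch: "isCont h t" for t
  proof -
    have "continuous_on UNIV h"
      unfolding h_def by (intro continuous_intros bump_on_continuous[OF bump_on_deriv[OF bump_on_deriv[OF \<zeta>]]])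
    then show ?thesis by (simp add: continuous_on_eq_continuous_at)
  qed
  have z: "\<zeta> t = 0" "deriv \<zeta> t = 0" "deriv (deriv \<zeta>) t = 0" if "t \<le> a \<or> b \<le> t" for t
    using \<zeta> bump_on_deriv[OF \<zeta>] bump_on_deriv[OF bump_on_deriv[OF \<zeta>]] that by (auto simp: bump_on_def)
  show ?thesis
  proof (cases "1 \<le> s")
    case True
    define B where "B = max b s"
    have "(\<integral>t. h t * indicator {s..B} t \<partial>lborel) = H B - H s"
      by (intro integral_FTC_Icc_real dH ch) (simp add: B_def)
    moreover have "h t * indicator {s..B} t = green t s * deriv (deriv \<zeta>) t" for t
      using z(3)[of t] True by (auto simp: h_def green_def B_def indicator_def max_def)
    moreover have "H B = 0" using z(1,2)[of B] by (simp add: H_def B_def)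
    ultimately show ?thesis by (simp add: H_def)
  next
    case False
    define A where "A = min a s"
    have "(\<integral>t. h t * indicator {A..s} t \<partial>lborel) = H s - H A"
      by (intro integral_FTC_Icc_real dH ch) (simp add: A_def)
    moreover have "h t * indicator {A..s} t = - (green t s * deriv (deriv \<zeta>) t)" for t
      using z(3)[of t] False by (auto simp: h_def green_def A_def indicator_def min_def max_def algebra_simps)
    moreover have "H A = 0" using z(1,2)[of A] by (simp add: H_def A_def)
    ultimately show ?thesis by (simp add: H_def)
  qed
qed

text \<open>The primitive is the integral against the Green function. By Fubini's theorem its weak second derivative is
\<open>f\<close>, and continuity follows by dominated convergence because the Green function is continuous in \<open>t\<close>. A locally
integrable \<open>f\<close> suffices, so this gives the first gain of regularity.\<close>

lemma weak_double_primitive: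
  assumes f [measurable]: "f \<in> borel_measurable borel" and loc: "locint_pos f"
  obtains F where "continuous_on {0<..} F"
    "\<And>a b \<zeta>. 0 < a \<Longrightarrow> bump_on a b \<zeta> \<Longrightarrow>
      (\<integral>t. F t * deriv (deriv \<zeta>) t \<partial>lborel) = (\<integral>s. f s * \<zeta> s \<partial>lborel)"
proof -
  define F where "F t = (\<integral>s. green t s * f s \<partial>lborel)" for t
  have dom: "integrable lborel (\<lambda>s. (\<beta> - \<alpha>) * (indicator {\<alpha>..\<beta>} s * \<bar>f s\<bar>))" if "0 < \<alpha>" for \<alpha> \<beta>
  proof -
    have "integrable lborel (\<lambda>s. indicator {\<alpha>..\<beta>} s *\<^sub>R f s)"
      using loc that by (simp add: locint_pos_def set_integrable_def)
    from integrable_mult_right[OF integrable_abs[OF this], of "\<beta> - \<alpha>"]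
    show ?thesis by (simp add: abs_mult)
  qed
  have bound: "\<bar>green t s * f s\<bar> \<le> (\<beta> - \<alpha>) * (indicator {\<alpha>..\<beta>} s * \<bar>f s\<bar>)"
    if "\<alpha> \<le> t" "t \<le> \<beta>" "\<alpha> \<le> 1" "1 \<le> \<beta>" for \<alpha> \<beta> t s
    using mult_right_mono[OF green_bound[OF that, of s], of "\<bar>f s\<bar>"] by (simp add: abs_mult mult.assoc)
  have cont: "continuous_on {\<alpha><..<\<beta>} F" if ab: "0 < \<alpha>" "\<alpha> \<le> 1" "1 \<le> \<beta>" for \<alpha> \<beta>
    unfolding continuous_on_sequentially comp_def
  proof (intro ballI allI impI, elim conjE)
    fix x :: "nat \<Rightarrow> real" and t
    assume x: "\<forall>n. x n \<in> {\<alpha><..<\<beta>}" "x \<longlonglongrightarrow> t"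
    show "(\<lambda>n. F (x n)) \<longlonglongrightarrow> F t"
      unfolding F_def
    proof (rule integral_dominated_convergence[OF _ _ dom[OF ab(1), of \<beta>]])
      show "AE s in lborel. (\<lambda>n. green (x n) s * f s) \<longlonglongrightarrow> green t s * f s"
        unfolding green_def by (intro AE_I2) (auto intro!: tendsto_intros x)
      show "AE s in lborel. norm (green (x n) s * f s) \<le> (\<beta> - \<alpha>) * (indicator {\<alpha>..\<beta>} s * \<bar>f s\<bar>)" for n
        using x(1) ab bound[of \<alpha> "x n" \<beta>] by (intro AE_I2) (auto intro: less_imp_le)
    qed measurable
  qed
  have cont_all: "continuous_on {0<..} F"
  proof (intro continuous_at_imp_continuous_on ballI)
    fix t :: real assume t: "t \<in> {0<..}"
    \<comment> \<open>The interval reaches 1, the base point of the Green function.\<close>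
    have "continuous_on {min t 1 / 2<..<max t 1 + 1} F"
      using t by (intro cont) auto
    moreover have "t \<in> {min t 1 / 2<..<max t 1 + 1}" using t by auto
    ultimately show "isCont F t" by (simp add: continuous_on_eq_continuous_at del: greaterThanLessThan_iff)
  qed
  moreover have "(\<integral>t. F t * deriv (deriv \<zeta>) t \<partial>lborel) = (\<integral>s. f s * \<zeta> s \<partial>lborel)"
    if a: "0 < a" and \<zeta>: "bump_on a b \<zeta>" for a b \<zeta>
  proof -
    define g where "g = deriv (deriv \<zeta>)"
    have gb: "bump_on a b g" unfolding g_def by (intro bump_on_deriv \<zeta>)
    have [measurable]: "g \<in> borel_measurable borel"
      using bump_on_continuous[OF gb] by (rule borel_measurable_continuous_onI)
    define \<alpha> where "\<alpha> = min a 1"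
    define \<beta> where "\<beta> = max b 1"
    have ab: "0 < \<alpha>" "\<alpha> \<le> 1" "1 \<le> \<beta>" using a by (auto simp: \<alpha>_def \<beta>_def)
    define h where "h s = (\<beta> - \<alpha>) * (indicator {\<alpha>..\<beta>} s * \<bar>f s\<bar>)" for s
    have h: "integrable lborel h" unfolding h_def[abs_def] by (rule dom[OF ab(1)])
    have h0: "0 \<le> h s" for s using ab by (simp add: h_def)
    have gi: "integrable lborel (\<lambda>t. \<bar>g t\<bar>)" by (rule integrable_abs[OF bump_integrable[OF gb]])
    have [measurable]: "h \<in> borel_measurable borel" using h by auto
    have prod: "integrable (lborel \<Otimes>\<^sub>M lborel) (\<lambda>(t, s). \<bar>g t\<bar> * h s)"
    proof (rule lborel_pair.Fubini_integrable)
      show "integrable lborel (\<lambda>t. \<integral>s. norm (case (t, s) of (t, s) \<Rightarrow> \<bar>g t\<bar> * h s) \<partial>lborel)"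
        using gi h0 by (simp add: abs_mult)
      show "AE t in lborel. integrable lborel (\<lambda>s. case (t, s) of (t, s) \<Rightarrow> \<bar>g t\<bar> * h s)"
        using h by simp
    qed measurable
    have int: "integrable (lborel \<Otimes>\<^sub>M lborel) (\<lambda>(t, s). g t * (green t s * f s))"
    proof (rule Bochner_Integration.integrable_bound[OF prod])
      show "AE z in lborel \<Otimes>\<^sub>M lborel. norm (case z of (t, s) \<Rightarrow> g t * (green t s * f s))
          \<le> norm (case z of (t, s) \<Rightarrow> \<bar>g t\<bar> * h s)"
      proof (intro AE_I2, clarify)
        fix t s :: real
        show "norm (g t * (green t s * f s)) \<le> norm (\<bar>g t\<bar> * h s)"
        proof (cases "a < t \<and> t < b")
          case True
          then have "\<bar>green t s * f s\<bar> \<le> h s"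
            unfolding h_def using ab by (intro bound) (auto simp: \<alpha>_def \<beta>_def)
          then have "\<bar>g t\<bar> * \<bar>green t s * f s\<bar> \<le> \<bar>g t\<bar> * h s" by (intro mult_left_mono) auto
          then show ?thesis using h0[of s] by (simp add: abs_mult)
        next
          case False
          then have "g t = 0" using gb by (auto simp: bump_on_def)
          then show ?thesis by simp
        qed
      qed
    qed measurable
    have "(\<integral>t. F t * g t \<partial>lborel) = (\<integral>t. (\<integral>s. g t * (green t s * f s) \<partial>lborel) \<partial>lborel)"
      unfolding F_def by (simp add: mult.commute)
    also have "\<dots> = (\<integral>s. (\<integral>t. g t * (green t s * f s) \<partial>lborel) \<partial>lborel)"
      by (rule lborel_pair.Fubini_integral[OF int, symmetric])
    also have "\<dots> = (\<integral>s. f s * (\<integral>t. green t s * g t \<partial>lborel) \<partial>lborel)"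
      by (simp add: ac_simps flip: integral_mult_right_zero)
    also have "\<dots> = (\<integral>s. f s * \<zeta> s \<partial>lborel)"
      unfolding g_def green_represents[OF \<zeta>] ..
    finally show ?thesis unfolding g_def .
  qed
  ultimately show ?thesis by (rule that)
qed

text \<open>Integration by parts twice. Once \<open>w\<close> is known to be continuous, comparing it with such a \<open>G\<close> shows that it is twice
differentiable.\<close>

lemma classical_double_primitive:
  assumes f: "continuous_on {0<..} f"
  shows "\<exists>G G1. (\<forall>r>0. (G has_real_derivative G1 r) (at r)) \<and>
    (\<forall>r>0. (G1 has_real_derivative f r) (at r)) \<and>
    (\<forall>a b \<zeta>. 0 < a \<longrightarrow> bump_on a b \<zeta> \<longrightarrow>
      (\<integral>t. G t * deriv (deriv \<zeta>) t \<partial>lborel) = (\<integral>s. f s * \<zeta> s \<partial>lborel))"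
proof -
  have ex: "\<exists>F. \<forall>r>0. (F has_real_derivative g r) (at r)" if "continuous_on {0<..} g" for g :: "real \<Rightarrow> real"
  proof -
    have "isCont g x" if "0 < x" for x
      using \<open>continuous_on {0<..} g\<close> that by (simp add: continuous_on_eq_continuous_at)
    then have "\<exists>F. \<forall>x::real. ereal 0 < ereal x \<longrightarrow> ereal x < \<infinity> \<longrightarrow> (F has_vector_derivative g x) (at x)"
      by (intro einterval_antiderivative) auto
    then show ?thesis by (auto simp: has_real_derivative_iff_has_vector_derivative)
  qed
  obtain G1 where G1: "\<And>r. 0 < r \<Longrightarrow> (G1 has_real_derivative f r) (at r)" using ex[OF f] by auto
  have cG1: "continuous_on {0<..} G1"
    by (intro continuous_at_imp_continuous_on ballI DERIV_isCont[OF G1]) auto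
  obtain G where G: "\<And>r. 0 < r \<Longrightarrow> (G has_real_derivative G1 r) (at r)" using ex[OF cG1] by auto
  have cG: "continuous_on {0<..} G"
    by (intro continuous_at_imp_continuous_on ballI DERIV_isCont[OF G]) auto
  show ?thesis
  proof (rule exI[of _ G], rule exI[of _ G1], intro conjI allI impI; (rule G G1, assumption)?)
    fix a b \<zeta> assume a: "0 < a" and \<zeta>0: "bump_on a b \<zeta>"
    define B where "B = max a b"
    have \<zeta>: "bump_on a B \<zeta>" using bump_on_mono[OF \<zeta>0] by (simp add: B_def)
    note b1 = bump_on_deriv[OF \<zeta>]
    note b2 = bump_on_deriv[OF b1]
    define H where "H t = G t * deriv \<zeta> t - G1 t * \<zeta> t" for t
    define h where "h t = G t * deriv (deriv \<zeta>) t - f t * \<zeta> t" for t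
    have dH: "(H has_real_derivative h t) (at t)" if "0 < t" for t
      unfolding H_def h_def
      by (rule derivative_eq_intros G[OF that] G1[OF that] bump_on_has_deriv[OF \<zeta>] bump_on_has_deriv[OF b1] refl)+ simp
    have ch: "isCont h t" if "0 < t" for t
    proof -
      have "continuous_on {0<..} h"
        unfolding h_def by (intro continuous_intros cG f bump_on_continuous[OF b2] bump_on_continuous[OF \<zeta>])
      then show ?thesis using that by (simp add: continuous_on_eq_continuous_at)
    qed
    have "(\<integral>t. h t * indicator {a..B} t \<partial>lborel) = H B - H a"
      using a by (intro integral_FTC_Icc_real dH ch) (auto simp: B_def)
    moreover have "h t * indicator {a..B} t = h t" for t
      using \<zeta> b2 by (cases "t \<le> a \<or> B \<le> t") (auto simp: h_def bump_on_def indicator_def)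
    moreover have "H B = 0" "H a = 0" using \<zeta> b1 by (auto simp: H_def bump_on_def)
    ultimately have "(\<integral>t. h t \<partial>lborel) = 0" by simp
    then show "(\<integral>t. G t * deriv (deriv \<zeta>) t \<partial>lborel) = (\<integral>s. f s * \<zeta> s \<partial>lborel)"
      unfolding h_def
      using integrable_locint_bump[OF locint_pos_continuous[OF cG] a b2]
        integrable_locint_bump[OF locint_pos_continuous[OF f] a \<zeta>] by simp
  qed
qed

lemma continuous_AE_eq_imp_eq:
  fixes f g :: "real \<Rightarrow> real"
  assumes f: "continuous_on {0<..} f" and g: "continuous_on {0<..} g"
    and ae: "AE r in lborel. 0 < r \<longrightarrow> f r = g r" and r: "0 < r"
  shows "f r = g r"
proof (rule ccontr)
  assume ne: "f r \<noteq> g r"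
  define S where "S = {0<..} \<inter> (\<lambda>r. f r - g r) -` (- {0})"
  have "open S"
    unfolding S_def by (intro continuous_open_preimage continuous_intros f g)
  moreover have "r \<in> S" using r ne by (simp add: S_def)
  ultimately obtain e where e: "0 < e" "ball r e \<subseteq> S" using open_contains_ball by blast
  have "AE x in lborel. \<not> (x \<in> {r - e<..<r + e})"
    using ae
  proof eventually_elim
    case (elim x)
    have "x \<notin> S" using elim by (auto simp: S_def)
    then show ?case using e(2) unfolding ball_eq_greaterThanLessThan by blast
  qed
  then have "emeasure lborel {x \<in> space lborel. x \<in> {r - e<..<r + e}} = 0" by (rule emeasure_eq_0_AE)
  moreover have "{x \<in> space lborel. x \<in> {r - e<..<r + e}} = {r - e<..<r + e}" by auto
  ultimately show False using e(1) by simp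
qed

lemma abs_le_one_plus_sixth_power:
  fixes t :: real
  assumes "0 \<le> q" "q \<le> 6"
  shows "\<bar>t\<bar> powr q \<le> 1 + \<bar>t\<bar> ^ 6"
proof (cases "\<bar>t\<bar> \<le> 1")
  case True
  then have "\<bar>t\<bar> powr q \<le> 1" using assms by (intro powr_le1) auto
  then show ?thesis by (simp add: add_increasing2)
next
  case False
  then have "\<bar>t\<bar> powr q \<le> \<bar>t\<bar> powr 6" using assms by (intro powr_mono) auto
  also have "\<dots> = \<bar>t\<bar> ^ 6" using False by (simp add: powr_numeral)
  finally show ?thesis by simp
qed

text \<open>Away from the origin the density \<open>shell\<close> is bounded below, so integrability of \<open>v(|x|)^6\<close> in space bounds the integral
of \<open>v^6\<close> over compact intervals of radii.\<close>

lemma locint_pos_of_L6_bound: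
  assumes [measurable]: "v \<in> borel_measurable borel" "g \<in> borel_measurable borel"
    and v6: "integrable lborel (\<lambda>x::real^3. \<bar>v (norm x)\<bar> ^ 6)"
    and g: "\<And>a b. 0 < a \<Longrightarrow> \<exists>C. \<forall>r\<in>{a..b}. \<bar>g r\<bar> \<le> C * (1 + \<bar>v r\<bar> ^ 6)"
  shows "locint_pos g"
  unfolding locint_pos_def set_integrable_def
proof (intro allI impI)
  fix a b :: real assume a: "0 < a"
  obtain C where C: "\<And>r. r \<in> {a..b} \<Longrightarrow> \<bar>g r\<bar> \<le> C * (1 + \<bar>v r\<bar> ^ 6)" using g[OF a] by blast
  have s6: "integrable lborel (\<lambda>r. shell r * \<bar>v r\<bar> ^ 6)"
    using integral_radial(2)[of "\<lambda>r. \<bar>v r\<bar> ^ 6"] v6 by simp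
  show "integrable lborel (\<lambda>r. indicator {a..b} r *\<^sub>R g r)"
  proof (rule Bochner_Integration.integrable_bound)
    show "integrable lborel (\<lambda>r. \<bar>C\<bar> * (indicator {a..b} r + 1 / (4 * pi * a\<^sup>2) * (shell r * \<bar>v r\<bar> ^ 6)))"
      by (intro integrable_mult_right Bochner_Integration.integrable_add s6 integrable_real_indicator)
         (auto simp: emeasure_lborel_Icc_eq)
    show "AE r in lborel. norm (indicator {a..b} r *\<^sub>R g r)
        \<le> norm (\<bar>C\<bar> * (indicator {a..b} r + 1 / (4 * pi * a\<^sup>2) * (shell r * \<bar>v r\<bar> ^ 6)))"
    proof (rule AE_I2)
      fix r
      have nn: "0 \<le> \<bar>C\<bar> * (indicator {a..b} r + 1 / (4 * pi * a\<^sup>2) * (shell r * \<bar>v r\<bar> ^ 6))"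
        using shell_nonneg[of r] by simp
      show "norm (indicator {a..b} r *\<^sub>R g r)
        \<le> norm (\<bar>C\<bar> * (indicator {a..b} r + 1 / (4 * pi * a\<^sup>2) * (shell r * \<bar>v r\<bar> ^ 6)))"
      proof (cases "r \<in> {a..b}")
        case True
        have "a\<^sup>2 \<le> r\<^sup>2" using True a by (intro power_mono) auto
        then have "1 \<le> 1 / (4 * pi * a\<^sup>2) * shell r" using True a by (simp add: shell_def field_simps)
        then have "1 * \<bar>v r\<bar> ^ 6 \<le> 1 / (4 * pi * a\<^sup>2) * shell r * \<bar>v r\<bar> ^ 6" by (intro mult_right_mono) auto
        then have "\<bar>C\<bar> * (1 + \<bar>v r\<bar> ^ 6) \<le> \<bar>C\<bar> * (indicator {a..b} r + 1 / (4 * pi * a\<^sup>2) * (shell r * \<bar>v r\<bar> ^ 6))"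
          using True by (intro mult_left_mono) (auto simp: mult.assoc)
        moreover have "C * (1 + \<bar>v r\<bar> ^ 6) \<le> \<bar>C\<bar> * (1 + \<bar>v r\<bar> ^ 6)" by (intro mult_right_mono) auto
        ultimately have "\<bar>g r\<bar> \<le> \<bar>C\<bar> * (indicator {a..b} r + 1 / (4 * pi * a\<^sup>2) * (shell r * \<bar>v r\<bar> ^ 6))"
          using C[OF True] by linarith
        then show ?thesis using nn True by simp
      qed (use nn in simp)
    qed
  qed measurable
qed

text \<open>With \<open>w(r) = r v(r)\<close>, every term of the equation tested with \<open>\<zeta>(|x|) / |x|\<close> becomes \<open>4 \<pi>\<close> times an integral over the
half-line.\<close>

lemma radial_weak_equation:
  assumes p: "2 < p" "p < 5"
    and u_meas: "u \<in> borel_measurable borel" and u6: "integrable lborel (\<lambda>x. \<bar>u x\<bar> ^ 6)"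
    and sol: "weak_solution p \<mu> u"
    and v [measurable]: "v \<in> borel_measurable borel" and uv: "AE x in lborel. u x = v (norm x)"
    and \<Phi>: "continuous_on UNIV \<Phi>" "\<And>x. coulomb_potential u x = \<Phi> (norm x)"
  shows "locint_pos (\<lambda>r. r * v r)"
    and "locint_pos (\<lambda>r. (\<Phi> r - \<mu> * \<bar>v r\<bar> powr (p - 1)) * (r * v r))"
    and "0 < a \<Longrightarrow> bump_on a b \<zeta> \<Longrightarrow> (\<integral>r. (r * v r) * deriv (deriv \<zeta>) r \<partial>lborel)
      = (\<integral>r. ((\<Phi> r - \<mu> * \<bar>v r\<bar> powr (p - 1)) * (r * v r)) * \<zeta> r \<partial>lborel)"
proof -
  have [measurable]: "\<Phi> \<in> borel_measurable borel" using \<Phi>(1) by (rule borel_measurable_continuous_onI)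
  have "AE x in lborel. \<bar>u x\<bar> ^ 6 = \<bar>v (norm x)\<bar> ^ 6" using uv by eventually_elim simp
  then have v6: "integrable lborel (\<lambda>x::real^3. \<bar>v (norm x)\<bar> ^ 6)"
    using u6 u_meas by (subst integrable_cong_AE[where g = "\<lambda>x. \<bar>u x\<bar> ^ 6"]) (auto elim: eventually_mono)
  have v1: "\<bar>v r\<bar> \<le> 1 + \<bar>v r\<bar> ^ 6" for r
    using abs_le_one_plus_sixth_power[of 1 "v r"] by simp
  have rv: "\<bar>r * v r\<bar> \<le> \<bar>b\<bar> * (1 + \<bar>v r\<bar> ^ 6)" if "0 < a" "r \<in> {a..b}" for a b r
    unfolding abs_mult using that v1 by (intro mult_mono) auto
  show L1: "locint_pos (\<lambda>r. r * v r)"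
    by (rule locint_pos_of_L6_bound[OF v _ v6]) (use rv in \<open>measurable, blast\<close>)
  have L2: "locint_pos (\<lambda>r. \<Phi> r * (r * v r))"
  proof (rule locint_pos_of_L6_bound[OF v _ v6])
    fix a b :: real assume a: "0 < a"
    have "compact (\<Phi> ` {a..b})"
      using \<Phi>(1) by (intro compact_continuous_image) (auto intro: continuous_on_subset)
    then obtain B where B: "\<And>r. r \<in> {a..b} \<Longrightarrow> \<bar>\<Phi> r\<bar> \<le> B"
      by (metis (no_types) bounded_iff compact_imp_bounded image_eqI real_norm_def)
    show "\<exists>C. \<forall>r\<in>{a..b}. \<bar>\<Phi> r * (r * v r)\<bar> \<le> C * (1 + \<bar>v r\<bar> ^ 6)"
    proof (intro exI ballI)
      fix r assume r: "r \<in> {a..b}"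
      have "\<bar>\<Phi> r\<bar> * \<bar>r * v r\<bar> \<le> B * (\<bar>b\<bar> * (1 + \<bar>v r\<bar> ^ 6))"
        using B[OF r] by (intro mult_mono rv[OF a r]) auto
      then show "\<bar>\<Phi> r * (r * v r)\<bar> \<le> (B * \<bar>b\<bar>) * (1 + \<bar>v r\<bar> ^ 6)" by (simp add: abs_mult mult.assoc)
    qed
  qed measurable
  have L3: "locint_pos (\<lambda>r. \<bar>v r\<bar> powr (p - 1) * (r * v r))"
  proof (rule locint_pos_of_L6_bound[OF v _ v6])
    fix a b :: real assume a: "0 < a"
    show "\<exists>C. \<forall>r\<in>{a..b}. \<bar>\<bar>v r\<bar> powr (p - 1) * (r * v r)\<bar> \<le> C * (1 + \<bar>v r\<bar> ^ 6)"
    proof (intro exI ballI)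
      fix r assume r: "r \<in> {a..b}"
      have "\<bar>\<bar>v r\<bar> powr (p - 1) * (r * v r)\<bar> = \<bar>r\<bar> * (\<bar>v r\<bar> powr (p - 1) * \<bar>v r\<bar> powr 1)"
        by (simp add: abs_mult)
      also have "\<dots> = \<bar>r\<bar> * \<bar>v r\<bar> powr p" unfolding powr_add[symmetric] by simp
      also have "\<dots> \<le> \<bar>b\<bar> * (1 + \<bar>v r\<bar> ^ 6)"
        using r a p by (intro mult_mono abs_le_one_plus_sixth_power) auto
      finally show "\<bar>\<bar>v r\<bar> powr (p - 1) * (r * v r)\<bar> \<le> \<bar>b\<bar> * (1 + \<bar>v r\<bar> ^ 6)" .
    qed
  qed measurable
  have L3': "locint_pos (\<lambda>r. \<mu> * (\<bar>v r\<bar> powr (p - 1) * (r * v r)))"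
    using L3 unfolding locint_pos_def by (auto intro: set_integrable_mult_right)
  have split: "(\<lambda>r. (\<Phi> r - \<mu> * \<bar>v r\<bar> powr (p - 1)) * (r * v r))
    = (\<lambda>r. \<Phi> r * (r * v r) - \<mu> * (\<bar>v r\<bar> powr (p - 1) * (r * v r)))"
    by (auto simp: algebra_simps)
  show "locint_pos (\<lambda>r. (\<Phi> r - \<mu> * \<bar>v r\<bar> powr (p - 1)) * (r * v r))"
    unfolding split by (intro locint_pos_diff L2 L3')
  assume a: "0 < a" and \<zeta>: "bump_on a b \<zeta>"
  note \<zeta>'' = bump_on_deriv[OF bump_on_deriv[OF \<zeta>]]
  \<comment> \<open>Replacing \<open>u x\<close> by \<open>v (norm x)\<close> inside a function of \<open>u x\<close> and \<open>norm x\<close> covers the three integrals of the equation.\<close>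
  have polar: "(\<integral>x. h (u x) (norm x) * (\<eta> (norm x) / norm x) \<partial>lborel) = 4 * pi * (\<integral>r. k r * \<eta> r \<partial>lborel)"
    if \<eta>: "bump_on a b \<eta>" and [measurable]: "(\<lambda>r. h (v r) r) \<in> borel_measurable borel"
      "(\<lambda>x. h (u x) (norm x)) \<in> borel_measurable borel"
      and k: "\<And>r. 0 < r \<Longrightarrow> k r = r * h (v r) r" for \<eta> h k
  proof -
    have [measurable]: "\<eta> \<in> borel_measurable borel"
      using bump_on_continuous[OF \<eta>] by (rule borel_measurable_continuous_onI)
    have "(\<integral>x. h (u x) (norm x) * (\<eta> (norm x) / norm x) \<partial>lborel)
        = (\<integral>x. h (v (norm x)) (norm (x::real^3)) * (\<eta> (norm x) / norm x) \<partial>lborel)"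
      using uv by (intro integral_cong_AE) (auto elim: eventually_mono)
    also have "\<dots> = (\<integral>r. shell r * (h (v r) r * (\<eta> r / r)) \<partial>lborel)"
      by (rule integral_radial(1)) measurable
    also have "\<dots> = (\<integral>r. 4 * pi * (k r * \<eta> r) \<partial>lborel)"
    proof (rule Bochner_Integration.integral_cong[OF refl])
      fix r
      show "shell r * (h (v r) r * (\<eta> r / r)) = 4 * pi * (k r * \<eta> r)"
      proof (cases "0 < r")
        case True
        then show ?thesis by (simp add: shell_def k power2_eq_square)
      next
        case False
        then have "\<eta> r = 0" using \<eta> a by (simp add: bump_on_def)
        then show ?thesis by simp
      qed
    qed
    finally show ?thesis by simp
  qed
  have e1: "(\<integral>x. u x * (deriv (deriv \<zeta>) (norm x) / norm x) \<partial>lborel) = 4 * pi * (\<integral>r. (r * v r) * deriv (deriv \<zeta>) r \<partial>lborel)"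
    by (rule polar[OF \<zeta>'', of "\<lambda>y r. y"]) (use u_meas in auto)
  have e2: "(\<integral>x. coulomb_potential u x * u x * (\<zeta> (norm x) / norm x) \<partial>lborel)
      = 4 * pi * (\<integral>r. (\<Phi> r * (r * v r)) * \<zeta> r \<partial>lborel)"
    unfolding \<Phi>(2) by (rule polar[OF \<zeta>, of "\<lambda>y r. \<Phi> r * y"]) (use u_meas in auto)
  have e3: "(\<integral>x. \<bar>u x\<bar> powr (p - 1) * u x * (\<zeta> (norm x) / norm x) \<partial>lborel)
      = 4 * pi * (\<integral>r. (\<bar>v r\<bar> powr (p - 1) * (r * v r)) * \<zeta> r \<partial>lborel)"
    by (rule polar[OF \<zeta>, of "\<lambda>y r. \<bar>y\<bar> powr (p - 1) * y"]) (use u_meas in auto)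
  have "- (4 * pi * (\<integral>r. (r * v r) * deriv (deriv \<zeta>) r \<partial>lborel)) + 4 * pi * (\<integral>r. (\<Phi> r * (r * v r)) * \<zeta> r \<partial>lborel)
     = \<mu> * (4 * pi * (\<integral>r. (\<bar>v r\<bar> powr (p - 1) * (r * v r)) * \<zeta> r \<partial>lborel))"
    using weak_solution_radial_test[OF sol a \<zeta>] unfolding e1 e2 e3 .
  then have "4 * pi * (\<integral>r. (r * v r) * deriv (deriv \<zeta>) r \<partial>lborel)
     = 4 * pi * ((\<integral>r. (\<Phi> r * (r * v r)) * \<zeta> r \<partial>lborel) - \<mu> * (\<integral>r. (\<bar>v r\<bar> powr (p - 1) * (r * v r)) * \<zeta> r \<partial>lborel))"
    by (simp add: algebra_simps)
  then have "(\<integral>r. (r * v r) * deriv (deriv \<zeta>) r \<partial>lborel)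
     = (\<integral>r. (\<Phi> r * (r * v r)) * \<zeta> r \<partial>lborel) - \<mu> * (\<integral>r. (\<bar>v r\<bar> powr (p - 1) * (r * v r)) * \<zeta> r \<partial>lborel)"
    by simp
  also have "\<dots> = (\<integral>r. (\<Phi> r * (r * v r)) * \<zeta> r - \<mu> * ((\<bar>v r\<bar> powr (p - 1) * (r * v r)) * \<zeta> r) \<partial>lborel)"
    using integrable_locint_bump[OF L2 a \<zeta>] integrable_locint_bump[OF L3 a \<zeta>] by simp
  also have "\<dots> = (\<integral>r. ((\<Phi> r - \<mu> * \<bar>v r\<bar> powr (p - 1)) * (r * v r)) * \<zeta> r \<partial>lborel)"
    by (simp add: algebra_simps)
  finally show "(\<integral>r. (r * v r) * deriv (deriv \<zeta>) r \<partial>lborel)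
      = (\<integral>r. ((\<Phi> r - \<mu> * \<bar>v r\<bar> powr (p - 1)) * (r * v r)) * \<zeta> r \<partial>lborel)" .
qed

text \<open>The lemma of Du Bois-Reymond is applied twice. Comparing \<open>r v0(r)\<close> with the continuous primitive of its locally
integrable right-hand side gives a continuous version \<open>w\<close>. With \<open>w\<close> in place of \<open>r v0(r)\<close> the right-hand side is
continuous, and comparing with its classical primitive gives the two derivatives.\<close>

lemma radial_classical_solution:
  assumes p: "2 < p" "p < 5"
    and u_meas: "u \<in> borel_measurable borel" and u6: "integrable lborel (\<lambda>x. \<bar>u x\<bar> ^ 6)"
    and sol: "weak_solution p \<mu> u"
    and v0 [measurable]: "v0 \<in> borel_measurable borel" and uv: "AE x in lborel. u x = v0 (norm x)"
    and \<Phi>: "continuous_on UNIV \<Phi>" "\<And>x. coulomb_potential u x = \<Phi> (norm x)"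
  shows "\<exists>w w1. (\<forall>r>0. (w has_real_derivative w1 r) (at r)) \<and>
    (\<forall>r>0. (w1 has_real_derivative (\<Phi> r - \<mu> * \<bar>w r / r\<bar> powr (p - 1)) * w r) (at r)) \<and>
    (AE r in lborel. 0 < r \<longrightarrow> v0 r = w r / r)"
proof -
  define f0 where "f0 r = (\<Phi> r - \<mu> * \<bar>v0 r\<bar> powr (p - 1)) * (r * v0 r)" for r
  have [measurable]: "\<Phi> \<in> borel_measurable borel" using \<Phi>(1) by (rule borel_measurable_continuous_onI)
  have f0_meas: "f0 \<in> borel_measurable borel" unfolding f0_def[abs_def] by measurable
  note weak = radial_weak_equation[OF p u_meas u6 sol v0 uv \<Phi>, folded f0_def]
  have f0_loc: "locint_pos f0" using weak(2) .
  obtain F where F: "continuous_on {0<..} F" and FW: "\<And>a b \<zeta>. 0 < a \<Longrightarrow> bump_on a b \<zeta> \<Longrightarrow>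
      (\<integral>t. F t * deriv (deriv \<zeta>) t \<partial>lborel) = (\<integral>s. f0 s * \<zeta> s \<partial>lborel)"
    using weak_double_primitive[OF f0_meas f0_loc] by metis
  have "\<exists>c d. AE r in lborel. 0 < r \<longrightarrow> r * v0 r - F r = c + d * r"
  proof (rule du_Bois_Reymond_second_order)
    show "locint_pos (\<lambda>r. r * v0 r - F r)" by (intro locint_pos_diff weak(1) locint_pos_continuous F)
    fix a b \<zeta> assume a: "0 < a" and \<zeta>: "bump_on a b \<zeta>"
    note b2 = bump_on_deriv[OF bump_on_deriv[OF \<zeta>]]
    show "(\<integral>r. (r * v0 r - F r) * deriv (deriv \<zeta>) r \<partial>lborel) = 0"
      using weak(3)[OF a \<zeta>] FW[OF a \<zeta>] integrable_locint_bump[OF weak(1) a b2]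
        integrable_locint_bump[OF locint_pos_continuous[OF F] a b2]
      by (simp add: left_diff_distrib)
  qed
  then obtain c d where cd: "AE r in lborel. 0 < r \<longrightarrow> r * v0 r - F r = c + d * r" by blast
  define w where "w r = F r + (c + d * r)" for r
  have w_cont: "continuous_on {0<..} w" unfolding w_def by (intro continuous_intros F)
  have wv: "AE r in lborel. 0 < r \<longrightarrow> v0 r = w r / r"
    using cd by eventually_elim (auto simp: w_def field_simps)
  define f where "f r = (\<Phi> r - \<mu> * \<bar>w r / r\<bar> powr (p - 1)) * w r" for r
  have f_cont: "continuous_on {0<..} f"
  proof -
    have "continuous_on {0<..} (\<lambda>r. \<bar>w r / r\<bar>)" by (intro continuous_intros w_cont) auto
    then have "continuous_on {0<..} (\<lambda>r. \<bar>w r / r\<bar> powr (p - 1))"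
      using p by (intro continuous_on_powr' continuous_on_const) auto
    then show ?thesis
      unfolding f_def
      by (intro continuous_on_mult continuous_on_diff continuous_on_const w_cont continuous_on_subset[OF \<Phi>(1)]) auto
  qed
  have ff0: "AE r in lborel. 0 < r \<longrightarrow> f0 r = f r"
    using wv by eventually_elim (auto simp: f0_def f_def)
  obtain G G1 where "\<forall>r>0. (G has_real_derivative G1 r) (at r)"
    "\<forall>r>0. (G1 has_real_derivative f r) (at r)"
    "\<forall>a b \<zeta>. 0 < a \<longrightarrow> bump_on a b \<zeta> \<longrightarrow>
      (\<integral>t. G t * deriv (deriv \<zeta>) t \<partial>lborel) = (\<integral>s. f s * \<zeta> s \<partial>lborel)"
    using classical_double_primitive[OF f_cont] by (elim exE conjE)
  note G = this(1)[rule_format] and G1 = this(2)[rule_format] and GW = this(3)[rule_format]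
  have G_cont: "continuous_on {0<..} G"
    by (intro continuous_at_imp_continuous_on ballI DERIV_isCont[OF G]) auto
  have f_loc: "locint_pos f" by (rule locint_pos_continuous[OF f_cont])
  have "\<exists>c d. AE r in lborel. 0 < r \<longrightarrow> r * v0 r - G r = c + d * r"
  proof (rule du_Bois_Reymond_second_order)
    show "locint_pos (\<lambda>r. r * v0 r - G r)" by (intro locint_pos_diff weak(1) locint_pos_continuous G_cont)
    fix a b \<zeta> assume a: "0 < a" and \<zeta>: "bump_on a b \<zeta>"
    note b2 = bump_on_deriv[OF bump_on_deriv[OF \<zeta>]]
    have "(\<integral>s. f0 s * \<zeta> s \<partial>lborel) = (\<integral>s. f s * \<zeta> s \<partial>lborel)"
    proof (rule integral_cong_AE)
      show "AE s in lborel. f0 s * \<zeta> s = f s * \<zeta> s"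
        using ff0
      proof eventually_elim
        case (elim s)
        then show ?case using \<zeta> a by (cases "0 < s") (auto simp: bump_on_def)
      qed
    qed (use borel_measurable_integrable[OF integrable_locint_bump[OF f0_loc a \<zeta>]]
        borel_measurable_integrable[OF integrable_locint_bump[OF f_loc a \<zeta>]] in auto)
    then show "(\<integral>r. (r * v0 r - G r) * deriv (deriv \<zeta>) r \<partial>lborel) = 0"
      using weak(3)[OF a \<zeta>] GW[OF a \<zeta>] integrable_locint_bump[OF weak(1) a b2]
        integrable_locint_bump[OF locint_pos_continuous[OF G_cont] a b2]
      by (simp add: left_diff_distrib)
  qed
  then obtain c' d' where cd': "AE r in lborel. 0 < r \<longrightarrow> r * v0 r - G r = c' + d' * r" by blast
  have weq: "w r = G r + (c' + d' * r)" if "0 < r" for r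
  proof (rule continuous_AE_eq_imp_eq[OF w_cont _ _ that])
    show "continuous_on {0<..} (\<lambda>r. G r + (c' + d' * r))" by (intro continuous_intros G_cont)
    show "AE r in lborel. 0 < r \<longrightarrow> w r = G r + (c' + d' * r)"
      using cd cd' by eventually_elim (auto simp: w_def)
  qed
  show ?thesis
  proof (rule exI[of _ w], rule exI[of _ "\<lambda>r. G1 r + d'"], intro conjI allI impI wv)
    fix r :: real assume r: "0 < r"
    have "((\<lambda>r. G r + (c' + d' * r)) has_real_derivative G1 r + d') (at r)"
      by (rule derivative_eq_intros G[OF r] refl)+ simp
    then show "(w has_real_derivative G1 r + d') (at r)"
      by (rule has_field_derivative_transform_within_open[of _ _ _ "{0<..}"]) (use r weq in auto)
    have "((\<lambda>r. G1 r + d') has_real_derivative f r) (at r)"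
      by (rule derivative_eq_intros G1[OF r] refl)+ simp
    then show "((\<lambda>r. G1 r + d') has_real_derivative (\<Phi> r - \<mu> * \<bar>w r / r\<bar> powr (p - 1)) * w r) (at r)"
      by (simp add: f_def)
  qed
qed

text \<open>In polar coordinates the mass density of \<open>u^2\<close> is \<open>4 \<pi> w^2\<close>. The factor \<open>4 \<pi> \<ge> 1\<close> is dropped.\<close>

lemma radial_mass_bound:
  fixes u :: "real^3 \<Rightarrow> real"
  assumes u [measurable]: "u \<in> borel_measurable borel"
    and K: "0 \<le> K" "\<And>b. 0 \<le> b \<Longrightarrow>
      (\<integral>\<^sup>+x. ennreal (indicator (cball 0 b) x * (u x)\<^sup>2) \<partial>lborel) \<le> ennreal (K * sqrt b)"
    and v0 [measurable]: "v0 \<in> borel_measurable borel" and uv: "AE x in lborel. u x = v0 (norm x)"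
    and w: "continuous_on {0<..} w" and wv: "AE r in lborel. 0 < r \<longrightarrow> v0 r = w r / r"
    and ab: "0 < a" "a \<le> b"
  shows "integral {a..b} (\<lambda>r. (w r)\<^sup>2) \<le> K * sqrt b"
proof -
  have cont: "continuous_on {a..b} (\<lambda>r. (w r)\<^sup>2)"
    using ab by (intro continuous_intros continuous_on_subset[OF w]) auto
  have int: "integrable lborel (\<lambda>r. indicator {a..b} r * (w r)\<^sup>2)"
    using borel_integrable_atLeastAtMost'[OF cont] by (simp add: set_integrable_def)
  have "ennreal (integral {a..b} (\<lambda>r. (w r)\<^sup>2)) = ennreal (\<integral>r. indicator {a..b} r * (w r)\<^sup>2 \<partial>lborel)"
    using set_borel_integral_eq_integral(2)[OF borel_integrable_atLeastAtMost'[OF cont]]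
    by (simp add: set_lebesgue_integral_def)
  also have "\<dots> = (\<integral>\<^sup>+r. ennreal (indicator {a..b} r * (w r)\<^sup>2) \<partial>lborel)"
    by (rule nn_integral_eq_integral[OF int, symmetric]) auto
  also have "\<dots> \<le> (\<integral>\<^sup>+r. ennreal (shell r) * ennreal (indicator {..b} r * (v0 r)\<^sup>2) \<partial>lborel)"
  proof (rule nn_integral_mono_AE)
    show "AE r in lborel. ennreal (indicator {a..b} r * (w r)\<^sup>2) \<le> ennreal (shell r) * ennreal (indicator {..b} r * (v0 r)\<^sup>2)"
      using wv
    proof eventually_elim
      case (elim r)
      have "indicator {a..b} r * (w r)\<^sup>2 \<le> shell r * (indicator {..b} r * (v0 r)\<^sup>2)"
      proof (cases "r \<in> {a..b}")
        case True
        then have r: "0 < r" using ab by simp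
        have "shell r * (v0 r)\<^sup>2 = (4 * pi) * (w r)\<^sup>2"
          using elim r by (simp add: shell_def power_divide)
        moreover have "1 * (w r)\<^sup>2 \<le> (4 * pi) * (w r)\<^sup>2"
          using pi_gt3 by (intro mult_right_mono) auto
        ultimately show ?thesis using True by simp
      qed (use shell_nonneg[of r] in auto)
      then show ?case using shell_nonneg[of r] by (simp flip: ennreal_mult')
    qed
  qed
  also have "\<dots> = (\<integral>\<^sup>+x. ennreal (indicator {..b} (norm (x::real^3)) * (v0 (norm x))\<^sup>2) \<partial>lborel)"
    by (rule nn_integral_radial[symmetric]) measurable
  also have "\<dots> = (\<integral>\<^sup>+x. ennreal (indicator (cball 0 b) x * (u x)\<^sup>2) \<partial>lborel)"
  proof (rule nn_integral_cong_AE)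
    show "AE x in lborel. ennreal (indicator {..b} (norm x) * (v0 (norm x))\<^sup>2)
        = ennreal (indicator (cball 0 b) x * (u x)\<^sup>2)"
      using uv by eventually_elim (simp add: indicator_def)
  qed
  also have "\<dots> \<le> ennreal (K * sqrt b)" using ab by (intro K) auto
  finally show ?thesis using K(1) ab by simp
qed

section \<open>Exponential decay for the radial ordinary differential equation\<close>

text \<open>Adding \<open>B (t - s)^2 / 2\<close> to \<open>W\<close> gives a convex function, which lies above its tangent at \<open>s\<close>. The linear term integrates to
zero over the symmetric interval.\<close>

lemma mean_value_almost_convex:
  fixes W W1 W2 :: "real \<Rightarrow> real"
  assumes l: "0 < l"
    and W: "\<And>t. t \<in> {s - l..s + l} \<Longrightarrow> (W has_real_derivative W1 t) (at t)"
    and W1: "\<And>t. t \<in> {s - l..s + l} \<Longrightarrow> (W1 has_real_derivative W2 t) (at t)"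
    and W2: "\<And>t. t \<in> {s - l..s + l} \<Longrightarrow> W2 t \<ge> - B"
  shows "2 * l * W s \<le> integral {s - l..s + l} W + B * l ^ 3 / 3"
proof -
  define f where "f t = W t + B / 2 * (t - s)\<^sup>2" for t
  define f1 where "f1 t = W1 t + B * (t - s)" for t
  define g where "g t = W s + W1 s * (t - s) - B / 2 * (t - s)\<^sup>2" for t
  define G where "G t = W s * t + W1 s / 2 * (t - s)\<^sup>2 - B / 6 * (t - s) ^ 3" for t
  have df: "(f has_real_derivative f1 t) (at t)" if "t \<in> {s - l..s + l}" for t
    unfolding f_def f1_def by (rule derivative_eq_intros W[OF that] refl)+ simp
  have df1: "(f1 has_real_derivative W2 t + B) (at t)" if "t \<in> {s - l..s + l}" for t
    unfolding f1_def by (rule derivative_eq_intros W1[OF that] refl)+ simp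
  have conv: "convex_on {s - l..s + l} f"
    by (rule f''_ge0_imp_convex[OF _ df df1]) (use W2 in force)+
  have above: "g t \<le> W t" if t: "t \<in> {s - l..s + l}" for t
  proof -
    have "f t - f s \<ge> f1 s * (t - s)"
    proof (rule convex_on_imp_above_tangent[OF conv])
      show "(f has_real_derivative f1 s) (at s within {s - l..s + l})"
        using df[of s] l by (simp add: has_field_derivative_at_within)
    qed (use t l in \<open>auto\<close>)
    then show ?thesis by (simp add: f_def f1_def g_def)
  qed
  have "(g has_integral (G (s + l) - G (s - l))) {s - l..s + l}"
  proof (rule fundamental_theorem_of_calculus)
    fix t
    have "(G has_real_derivative g t) (at t)"
      unfolding G_def g_def
      by (auto intro!: derivative_eq_intros simp: power2_eq_square)
    then show "(G has_vector_derivative g t) (at t within {s - l..s + l})"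
      by (simp add: has_real_derivative_iff_has_vector_derivative has_vector_derivative_at_within)
  qed (use l in simp)
  moreover have "(W has_integral integral {s - l..s + l} W) {s - l..s + l}"
  proof (intro integrable_integral integrable_continuous_interval)
    show "continuous_on {s - l..s + l} W"
      using W DERIV_isCont continuous_at_imp_continuous_on by blast
  qed
  ultimately have "G (s + l) - G (s - l) \<le> integral {s - l..s + l} W"
    by (rule has_integral_le) (rule above)
  moreover have "G (s + l) - G (s - l) = 2 * l * W s - B * l ^ 3 / 3"
    by (simp add: G_def power2_eq_square power3_eq_cube field_simps)
  ultimately show ?thesis by simp
qed

text \<open>What the decay needs to know about a radial solution: the equation for \<open>w\<close>, a lower bound for the potential at large
radii, and growth of the mass not faster than a square root.\<close>

locale radial_ode =
  fixes p \<mu> c R0 K :: real and w w1 \<Phi> :: "real \<Rightarrow> real"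
  assumes p: "2 < p" "p < 5" and \<mu>: "0 < \<mu>" and c: "0 < c" and R0: "0 < R0"
    and w: "\<And>r. 0 < r \<Longrightarrow> (w has_real_derivative w1 r) (at r)"
    and w1: "\<And>r. 0 < r \<Longrightarrow>
        (w1 has_real_derivative (\<Phi> r - \<mu> * \<bar>w r / r\<bar> powr (p - 1)) * w r) (at r)"
    and \<Phi>: "\<And>r. R0 \<le> r \<Longrightarrow> c / r \<le> \<Phi> r"
    and mass: "\<And>a b. 0 < a \<Longrightarrow> a \<le> b \<Longrightarrow> integral {a..b} (\<lambda>r. (w r)\<^sup>2) \<le> K * sqrt b"
begin

text \<open>The square \<open>W\<close> of \<open>w\<close> replaces the absolute value because it is twice differentiable at the zeros of \<open>w\<close>, and the
inequality \<open>W2_lower\<close> holds there too.\<close>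

definition "V r = \<mu> * \<bar>w r / r\<bar> powr (p - 1)"
definition "W r = (w r)\<^sup>2"
definition "W1 r = 2 * w r * w1 r"
definition "W2 r = 2 * (w1 r)\<^sup>2 + 2 * (\<Phi> r - V r) * W r"

lemma dW: "0 < r \<Longrightarrow> (W has_real_derivative W1 r) (at r)"
  unfolding W_def W1_def by (rule derivative_eq_intros w refl | assumption)+ simp

lemma dW1: "0 < r \<Longrightarrow> (W1 has_real_derivative W2 r) (at r)"
  unfolding W1_def W2_def V_def W_def
  by (rule derivative_eq_intros w w1 refl | assumption)+ (simp add: power2_eq_square algebra_simps)

lemma W_nonneg: "0 \<le> W r" by (simp add: W_def)

lemma W2_lower: "2 * (\<Phi> r - V r) * W r \<le> W2 r"
  by (simp add: W2_def)

lemma continuous_w: "S \<subseteq> {0<..} \<Longrightarrow> continuous_on S w"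
  by (meson DERIV_isCont continuous_at_imp_continuous_on greaterThan_iff subsetD w)

text \<open>Where \<open>V\<close> exceeds \<open>c / (2 r)\<close>, the solution is large enough to force much mass near \<open>r\<close>. The point
\<open>s1\<close> maximises \<open>lam s * d s\<close>, where \<open>lam\<close> is the inverse length scale of the equation and \<open>d\<close> the distance to the end
points of \<open>[r/2, 3r/2]\<close>. Within half the distance \<open>d s1\<close> of \<open>s1\<close>, \<open>lam\<close> is at most doubled, and the product
\<open>lam s1 * d s1\<close> is so large that this range contains an interval of length comparable to \<open>1 / lam s1\<close>.\<close>

lemma large_nonlinearity_bounds_radius:
  fixes r :: real
  defines "e \<equiv> 2 / (p - 1)" and "\<epsilon> \<equiv> 1 / sqrt (384 * \<mu>)"
  assumes r: "0 < r" "2 * R0 \<le> r" and big: "c / (2 * r) < V r"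
    and far: "2 * \<epsilon> \<le> sqrt (c / (8 * \<mu>)) * sqrt r"
  shows "\<epsilon> / 4 * (c / (2 * \<mu>)) powr (e - 1 / 2) * r powr (2 - e) \<le> 2 * K"
proof -
  define v where "v s = \<bar>w s / s\<bar>" for s
  define lam where "lam s = v s powr ((p - 1) / 2)" for s
  define d where "d s = r / 2 - \<bar>s - r\<bar>" for s
  have e: "1 / 2 < e" "e < 2" using p by (auto simp: e_def field_simps)
  have v0: "v s \<ge> 0" for s by (simp add: v_def)
  have lam0: "lam s \<ge> 0" for s by (simp add: lam_def)
  have V_lam: "V s = \<mu> * (lam s)\<^sup>2" for s
    by (simp add: V_def v_def lam_def power2_eq_square flip: powr_add)
  have v_lam: "v s = lam s powr e" for s
  proof -
    have "(p - 1) / 2 * (2 / (p - 1)) = 1" using p by simp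
    then show ?thesis using v0[of s] by (simp only: lam_def e_def powr_powr powr_one)
  qed
  have cont: "continuous_on {r/2..3*r/2} (\<lambda>s. lam s * d s)"
  proof (intro continuous_on_mult)
    have "continuous_on {r/2..3*r/2} v"
      unfolding v_def using r by (intro continuous_intros continuous_w) auto
    then show "continuous_on {r/2..3*r/2} lam"
      unfolding lam_def using p v0 by (intro continuous_on_powr') auto
    show "continuous_on {r/2..3*r/2} d"
      unfolding d_def by (intro continuous_intros)
  qed
  obtain s1 where s1: "s1 \<in> {r/2..3*r/2}"
    and max: "\<And>s. s \<in> {r/2..3*r/2} \<Longrightarrow> lam s * d s \<le> lam s1 * d s1"
    using continuous_attains_sup[OF compact_Icc _ cont] r by auto
  define L where "L = lam r"
  define L1 where "L1 = lam s1"
  define d1 where "d1 = d s1"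
  have "\<mu> * L\<^sup>2 > c / (2 * r)" using big by (simp add: V_lam L_def)
  then have "c / (2 * r) / \<mu> < L\<^sup>2" using \<mu> by (simp only: pos_divide_less_eq mult.commute)
  then have L2: "c / (2 * \<mu> * r) < L\<^sup>2" by (simp add: ac_simps)
  have "0 < c / (2 * \<mu> * r)" using c \<mu> r by simp
  then have L: "0 < L" using L2 lam0[of r] unfolding L_def
    by (metis less_eq_real_def not_less_iff_gr_or_eq power_zero_numeral)
  have Lsqrt: "sqrt (c / (2 * \<mu> * r)) \<le> L" using L2 L by (intro real_le_lsqrt) auto
  have d1_le: "d1 \<le> r / 2" by (simp add: d1_def d_def)
  have Q: "L * (r / 2) \<le> L1 * d1"
    using max[of r] r by (simp add: L_def L1_def d1_def d_def)
  have "0 < L1 * d1" using Q L r by (smt (verit) mult_pos_pos divide_pos_pos)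
  then have L1: "0 < L1" and d1: "0 < d1"
    using lam0[of s1] by (auto simp: L1_def zero_less_mult_iff)
  have LL1: "L \<le> L1"
  proof -
    have "L * (r / 2) \<le> L1 * (r / 2)"
      using Q d1_le L1 by (meson less_eq_real_def mult_left_mono order_trans)
    then show ?thesis using r by simp
  qed
  \<comment> \<open>The choice of \<open>\<epsilon>\<close> makes the error term of the mean value inequality on this scale equal to \<open>l * W s1\<close>, half of the left-hand side.\<close>
  define l where "l = \<epsilon> / L1"
  have eps: "0 < \<epsilon>" using \<mu> by (simp add: \<epsilon>_def)
  have l: "0 < l" using eps L1 by (simp add: l_def)
  have "2 * \<epsilon> \<le> sqrt (c / (2 * \<mu> * r)) * (r / 2)"
  proof -
    have "sqrt (c / (2 * \<mu> * r)) * (r / 2) = sqrt (c / (2 * \<mu> * r)) * sqrt (r\<^sup>2 / 4)"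
      using r by (simp add: real_sqrt_divide)
    also have "\<dots> = sqrt (c / (8 * \<mu>)) * sqrt r"
      using r \<mu> by (simp add: power2_eq_square flip: real_sqrt_mult)
    finally show ?thesis using far by simp
  qed
  also have "\<dots> \<le> L * (r / 2)" using Lsqrt r by (intro mult_right_mono) auto
  finally have "2 * \<epsilon> \<le> L1 * d1" using Q by simp
  then have ld: "l \<le> d1 / 2" using L1 by (simp add: l_def field_simps)
  have sub: "t \<in> {r/2..3*r/2}" "d t \<ge> d1 / 2" if "t \<in> {s1 - l..s1 + l}" for t
    using that ld d1 s1 by (auto simp: d1_def d_def abs_if split: if_splits)
  have lam_le: "lam t \<le> 2 * L1" if t: "t \<in> {s1 - l..s1 + l}" for t
  proof -
    have "lam t * (d1 / 2) \<le> lam t * d t" using sub[OF t] lam0 by (intro mult_left_mono) auto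
    also have "\<dots> \<le> L1 * d1" using max[OF sub(1)[OF t]] by (simp add: L1_def d1_def)
    finally have "lam t * d1 \<le> (2 * L1) * d1" by simp
    then show ?thesis using d1 by (simp only: mult_le_cancel_right_pos)
  qed
  have v_le: "v t \<le> 4 * v s1" if t: "t \<in> {s1 - l..s1 + l}" for t
  proof -
    have "v t \<le> (2 * L1) powr e"
      unfolding v_lam using lam_le[OF t] lam0 e by (intro powr_mono2) auto
    also have "\<dots> = 2 powr e * v s1" using L1 by (simp add: powr_mult v_lam L1_def)
    also have "\<dots> \<le> 2 powr 2 * v s1" using e v0 by (intro mult_right_mono powr_mono) auto
    finally show ?thesis by simp
  qed
  have Wv: "W t = (t * v t)\<^sup>2" if "0 < t" for t
    using that by (simp add: W_def v_def power_mult_distrib power_divide)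
  have s1pos: "0 < s1" using s1 r by auto
  have W_s1: "(r / 2)\<^sup>2 * (v s1)\<^sup>2 \<le> W s1"
    unfolding Wv[OF s1pos] power_mult_distrib using s1 r
    by (intro mult_right_mono power_mono) auto
  have W_le: "W t \<le> 144 * W s1" if t: "t \<in> {s1 - l..s1 + l}" for t
  proof -
    have tp: "0 < t" "t \<le> 3 * r / 2" using sub(1)[OF t] r by auto
    have "t * v t \<le> (3 * r / 2) * (4 * v s1)"
      using v_le[OF t] tp v0 r by (intro mult_mono) auto
    then have "(t * v t)\<^sup>2 \<le> ((3 * r / 2) * (4 * v s1))\<^sup>2"
      using tp v0 by (intro power_mono) auto
    \<comment> \<open>The factor is \<open>(3 * 4)\<^sup>2\<close>: radii vary by a factor of at most 3, values of \<open>v\<close> by at most 4.\<close>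
    also have "\<dots> = 144 * ((r / 2)\<^sup>2 * (v s1)\<^sup>2)" by (simp add: power2_eq_square)
    also have "\<dots> \<le> 144 * W s1" using W_s1 by simp
    finally show ?thesis using Wv[OF tp(1)] by simp
  qed
  \<comment> \<open>Twice the product of the bounds for \<open>V\<close> and \<open>W\<close>, with \<open>1152 = 2 * 4 * 144\<close>.\<close>
  define B where "B = 1152 * \<mu> * L1\<^sup>2 * W s1"
  have W2_ge: "W2 t \<ge> - B" if t: "t \<in> {s1 - l..s1 + l}" for t
  proof -
    have tR: "R0 \<le> t" "0 < t" using sub(1)[OF t] r by auto
    have "0 < c / t" using c tR by simp
    then have Phi: "\<Phi> t \<ge> 0" using \<Phi>[OF tR(1)] by linarith
    have "V t * W t \<le> (\<mu> * (2 * L1)\<^sup>2) * (144 * W s1)"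
      unfolding V_lam using lam_le[OF t] W_le[OF t] lam0 W_nonneg \<mu>
      by (intro mult_mono power_mono) auto
    also have "2 * ((\<mu> * (2 * L1)\<^sup>2) * (144 * W s1)) = B" by (simp add: B_def power2_eq_square)
    finally have "2 * (V t * W t) \<le> B" by (simp add: B_def power2_eq_square)
    moreover have "0 \<le> \<Phi> t * W t" using Phi W_nonneg by simp
    ultimately show ?thesis using W2_lower[of t] by (simp add: algebra_simps)
  qed
  have pos: "0 < t" if "t \<in> {s1 - l..s1 + l}" for t using sub(1)[OF that] r by auto
  have "2 * l * W s1 \<le> integral {s1 - l..s1 + l} W + B * l ^ 3 / 3"
    by (rule mean_value_almost_convex[OF l dW[OF pos] dW1[OF pos] W2_ge])
  also have "B * l ^ 3 / 3 = l * W s1"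
  proof -
    have "L1 * l = \<epsilon>" using L1 by (simp add: l_def)
    then have "L1\<^sup>2 * l\<^sup>2 = 1 / (384 * \<mu>)"
      using \<mu> by (simp add: \<epsilon>_def power_divide flip: power_mult_distrib)
    then have "384 * \<mu> * (L1\<^sup>2 * l\<^sup>2) = 1" using \<mu> by simp
    moreover have "B * l ^ 3 / 3 = 384 * \<mu> * (L1\<^sup>2 * l\<^sup>2) * (l * W s1)"
      by (simp add: B_def power2_eq_square power3_eq_cube)
    ultimately show ?thesis by simp
  qed
  also have "integral {s1 - l..s1 + l} W \<le> K * sqrt (s1 + l)"
    unfolding W_def using pos[of "s1 - l"] l by (intro mass) auto
  finally have low: "l * W s1 \<le> K * sqrt (s1 + l)" by simp
  have "0 < l * W s1"
  proof -
    have "v s1 > 0" using L1 v0[of s1] by (auto simp: L1_def lam_def less_le)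
    then show ?thesis using l s1pos by (simp add: Wv)
  qed
  then have "0 < K * sqrt (s1 + l)" using low by linarith
  then have K: "0 < K" using l s1pos by (simp add: zero_less_mult_iff)
  have "K * sqrt (s1 + l) \<le> K * sqrt (4 * r)"
    using sub(1)[of "s1 + l"] l K r by (intro mult_left_mono real_sqrt_le_mono) auto
  then have up: "l * W s1 \<le> 2 * K * sqrt r"
    using low by (simp add: real_sqrt_mult)
  have "(c / (2 * \<mu>)) powr (e - 1 / 2) * r powr (2 - e) * sqrt r
      = r\<^sup>2 * (c / (2 * \<mu> * r)) powr (e - 1 / 2)"
  proof -
    have eq1: "(c / (2 * \<mu> * r)) powr (e - 1 / 2) = (c / (2 * \<mu>)) powr (e - 1 / 2) / r powr (e - 1 / 2)"
      using c \<mu> r by (simp add: powr_divide powr_mult)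
    have eq2: "r powr (2 - e) * sqrt r = r\<^sup>2 / r powr (e - 1 / 2)"
    proof -
      have "r\<^sup>2 / r powr (e - 1 / 2) = r powr 2 / r powr (e - 1 / 2)" using r by simp
      also have "\<dots> = r powr (2 - (e - 1 / 2))" by (simp only: powr_diff)
      also have "\<dots> = r powr ((2 - e) + 1 / 2)" by (rule arg_cong[of _ _ "(powr) r"]) simp
      also have "\<dots> = r powr (2 - e) * sqrt r" using r by (simp only: powr_add powr_half_sqrt)
      finally show ?thesis by simp
    qed
    show ?thesis unfolding eq1 mult.assoc[of _ "r powr (2 - e)"] eq2 by simp
  qed
  also have "\<dots> \<le> r\<^sup>2 * L1 powr (2 * e - 1)"
  proof -
    have "(c / (2 * \<mu> * r)) powr (e - 1 / 2) \<le> (L\<^sup>2) powr (e - 1 / 2)"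
      using L2 e c \<mu> r by (intro powr_mono2) auto
    also have "\<dots> \<le> (L1\<^sup>2) powr (e - 1 / 2)"
      using LL1 L e by (intro powr_mono2 power_mono) auto
    also have "\<dots> = (L1 powr 2) powr (e - 1 / 2)" using L1 by simp
    also have "\<dots> = L1 powr (2 * e - 1)" by (simp add: powr_powr algebra_simps)
    finally show ?thesis by (intro mult_left_mono) auto
  qed
  also have "\<dots> = r\<^sup>2 * ((v s1)\<^sup>2 / L1)"
    using L1 by (simp add: v_lam powr_diff power2_eq_square flip: powr_add L1_def) 
  finally have "(c / (2 * \<mu>)) powr (e - 1 / 2) * r powr (2 - e) * sqrt r \<le> r\<^sup>2 * ((v s1)\<^sup>2 / L1)" .
  then have "\<epsilon> / 4 * ((c / (2 * \<mu>)) powr (e - 1 / 2) * r powr (2 - e) * sqrt r)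
      \<le> \<epsilon> / 4 * (r\<^sup>2 * ((v s1)\<^sup>2 / L1))"
    using eps by (intro mult_left_mono) auto
  also have "\<dots> = l * ((r / 2)\<^sup>2 * (v s1)\<^sup>2)" by (simp add: l_def power2_eq_square)
  also have "\<dots> \<le> l * W s1" using W_s1 l by (intro mult_left_mono) auto
  also note up
  finally have "(\<epsilon> / 4 * (c / (2 * \<mu>)) powr (e - 1 / 2) * r powr (2 - e)) * sqrt r \<le> (2 * K) * sqrt r"
    by (simp add: mult.assoc)
  then show ?thesis using r by (simp only: mult_le_cancel_right_pos real_sqrt_gt_0_iff)
qed

text \<open>For large \<open>r\<close> both requirements on the size of \<open>r\<close> are met and the bound of the preceding lemma fails, because
\<open>2 - e = 2 (p - 2) / (p - 1)\<close> is positive.\<close>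

lemma potential_dominates:
  obtains R where "R0 \<le> R" "\<And>r. R \<le> r \<Longrightarrow> V r \<le> c / (2 * r)"
proof -
  define e where "e = 2 / (p - 1)"
  define \<epsilon> where "\<epsilon> = 1 / sqrt (384 * \<mu>)"
  define A where "A = \<epsilon> / 4 * (c / (2 * \<mu>)) powr (e - 1 / 2)"
  define k where "k = sqrt (c / (8 * \<mu>))"
  have A: "0 < A" using \<mu> c by (simp add: A_def \<epsilon>_def)
  have k: "0 < k" using \<mu> c by (simp add: k_def)
  have e: "0 < 2 - e" using p by (auto simp: e_def field_simps)
  have "filterlim (\<lambda>r::real. exp ((2 - e) * ln r)) at_top at_top"
    by (rule filterlim_compose[OF exp_at_top
          filterlim_tendsto_pos_mult_at_top[OF tendsto_const e ln_at_top]])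
  moreover have "eventually (\<lambda>r::real. exp ((2 - e) * ln r) = r powr (2 - e)) at_top"
    using eventually_gt_at_top[of 0] by eventually_elim (simp add: powr_def)
  ultimately have "filterlim (\<lambda>r. r powr (2 - e)) at_top at_top"
    by (rule filterlim_cong[OF refl refl, THEN iffD1, rotated])
  then have 1: "eventually (\<lambda>r. r powr (2 - e) > 2 * K / A) at_top"
    by (simp add: filterlim_at_top_dense)
  have 2: "eventually (\<lambda>r. sqrt r \<ge> 2 * \<epsilon> / k) at_top"
    using sqrt_at_top by (simp add: filterlim_at_top)
  have "eventually (\<lambda>r. V r \<le> c / (2 * r)) at_top"
    using 1 2 eventually_ge_at_top[of "2 * R0"] eventually_gt_at_top[of 0]
  proof eventually_elim
    case (elim r)
    have "2 * \<epsilon> \<le> k * sqrt r" using elim(2) k by (simp add: field_simps)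
    note far = this[unfolded \<epsilon>_def k_def]
    show ?case
    proof (rule ccontr)
      assume large: "\<not> ?thesis"
      then have "A * r powr (2 - e) \<le> 2 * K"
        unfolding A_def e_def \<epsilon>_def
        by (intro large_nonlinearity_bounds_radius)
           (use elim far large in \<open>auto simp: not_le\<close>)
      then show False using elim A by (simp add: field_simps)
    qed
  qed
  then obtain R where "\<And>r. R \<le> r \<Longrightarrow> V r \<le> c / (2 * r)"
    by (auto simp: eventually_at_top_linorder)
  then show ?thesis by (intro that[of "max R R0"]) auto
qed

text \<open>The barrier \<open>z\<close> comes from the exponential ansatz for \<open>y'' = (k^2 / r) y\<close>: its leading decaying solution is
\<open>r^(1/4) exp (- 2 k sqrt r)\<close>. The larger power \<open>sqrt r\<close> adds a term of order \<open>r^(- 3/2)\<close> to \<open>z'' / z\<close>, which has the favourable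
sign.\<close>

lemma barrier_second_derivative:
  fixes k r :: real
  assumes r: "0 < r"
  defines "z \<equiv> \<lambda>r. sqrt r * exp (- (2 * k * sqrt r))"
    and "z1 \<equiv> \<lambda>r. (1 / (2 * sqrt r) - k) * exp (- (2 * k * sqrt r))"
    and "z2 \<equiv> \<lambda>r. (- 1 / (4 * sqrt r ^ 3) - k * (1 / (2 * sqrt r) - k) / sqrt r) * exp (- (2 * k * sqrt r))"
  shows "(z has_real_derivative z1 r) (at r)" "(z1 has_real_derivative z2 r) (at r)"
    "0 \<le> k \<Longrightarrow> z2 r \<le> k\<^sup>2 / r * z r"
proof -
  have s: "(sqrt has_real_derivative 1 / (2 * sqrt r)) (at r)"
    using r by (auto intro!: derivative_eq_intros simp: field_simps)
  have ex: "((\<lambda>r. exp (- (2 * k * sqrt r))) has_real_derivative (- k / sqrt r) * exp (- (2 * k * sqrt r))) (at r)"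
    by (rule derivative_eq_intros s refl)+ simp
  have iv: "((\<lambda>r. 1 / (2 * sqrt r) - k) has_real_derivative - 1 / (4 * sqrt r ^ 3)) (at r)"
  proof (rule DERIV_cong)
    show "((\<lambda>r. 1 / (2 * sqrt r) - k) has_real_derivative
        (0 * (2 * sqrt r) - 1 * (2 * (1 / (2 * sqrt r)))) / ((2 * sqrt r) * (2 * sqrt r)) - 0) (at r)"
      using r by (intro DERIV_diff DERIV_divide DERIV_const DERIV_cmult s) auto
    show "(0 * (2 * sqrt r) - 1 * (2 * (1 / (2 * sqrt r)))) / ((2 * sqrt r) * (2 * sqrt r)) - 0
        = - 1 / (4 * sqrt r ^ 3)"
      using r by (simp add: divide_simps power3_eq_cube)
  qed
  show "(z has_real_derivative z1 r) (at r)"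
    unfolding z_def z1_def using DERIV_mult[OF s ex] r by (simp add: algebra_simps)
  show "(z1 has_real_derivative z2 r) (at r)"
    unfolding z1_def z2_def using DERIV_mult[OF iv ex] r by (simp add: algebra_simps)
  assume k: "0 \<le> k"
  define q where "q = sqrt r"
  have q: "q > 0" "r = q\<^sup>2" using r by (auto simp: q_def)
  have "- 1 / (4 * q ^ 3) - k * (1 / (2 * q) - k) / q \<le> k\<^sup>2 / q\<^sup>2 * q"
    using q k by (simp add: field_simps power2_eq_square power3_eq_cube)
  then have "(- 1 / (4 * q ^ 3) - k * (1 / (2 * q) - k) / q) * exp (- (2 * k * q))
      \<le> (k\<^sup>2 / q\<^sup>2 * q) * exp (- (2 * k * q))"
    by (rule mult_right_mono) simp
  moreover have "z2 r = (- 1 / (4 * q ^ 3) - k * (1 / (2 * q) - k) / q) * exp (- (2 * k * q))"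
    by (simp add: z2_def q_def)
  moreover have "k\<^sup>2 / r * z r = (k\<^sup>2 / q\<^sup>2 * q) * exp (- (2 * k * q))"
    using r by (simp add: z_def q_def)
  ultimately show "z2 r \<le> k\<^sup>2 / r * z r" by simp
qed

text \<open>A convex function with positive slope somewhere grows at least linearly, so its integral grows quadratically,
against the bound on the mass. Hence \<open>W\<close> decreases, and \<open>W b\<close> is at most the mean over \<open>[b/2, b]\<close>, which
is \<open>O(1 / sqrt b)\<close>.\<close>

lemma W_tendsto_0:
  assumes R: "0 < R" and W2: "\<And>r. R \<le> r \<Longrightarrow> 0 \<le> W2 r"
  shows "(W \<longlongrightarrow> 0) at_top"
proof -
  have conv: "convex_on {R..} W"
    by (rule f''_ge0_imp_convex[OF _ dW dW1]) (use R W2 in auto)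
  have W1_le: "W1 s \<le> 0" if s: "R < s" for s
  proof (rule ccontr)
    assume "\<not> W1 s \<le> 0"
    then have m: "0 < W1 s" by simp
    have above: "W1 s * (t - s) \<le> W t" if t: "t \<in> {s..b}" for t b
    proof -
      have "W t - W s \<ge> W1 s * (t - s)"
      proof (rule convex_on_imp_above_tangent[OF conv])
        show "(W has_real_derivative W1 s) (at s within {R..})"
          using dW[of s] s R by (simp add: has_field_derivative_at_within)
      qed (use t s in \<open>auto\<close>)
      then show ?thesis using W_nonneg[of s] by simp
    qed
    have quad: "W1 s / 2 * (b - s)\<^sup>2 \<le> K * sqrt b" if b: "s \<le> b" for b
    proof -
      have "((\<lambda>t. W1 s * (t - s)) has_integral (W1 s / 2 * (b - s)\<^sup>2 - W1 s / 2 * (s - s)\<^sup>2)) {s..b}"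
      proof (rule fundamental_theorem_of_calculus[OF b])
        fix t
        have "((\<lambda>t. W1 s / 2 * (t - s)\<^sup>2) has_real_derivative W1 s * (t - s)) (at t)"
          by (auto intro!: derivative_eq_intros)
        then show "((\<lambda>t. W1 s / 2 * (t - s)\<^sup>2) has_vector_derivative W1 s * (t - s)) (at t within {s..b})"
          by (simp add: has_real_derivative_iff_has_vector_derivative has_vector_derivative_at_within)
      qed
      moreover have "(W has_integral integral {s..b} W) {s..b}"
        by (intro integrable_integral integrable_continuous_interval)
           (unfold W_def, use R s in \<open>intro continuous_intros continuous_w; auto\<close>)
      ultimately have "W1 s / 2 * (b - s)\<^sup>2 - W1 s / 2 * (s - s)\<^sup>2 \<le> integral {s..b} W"
        by (rule has_integral_le) (rule above)
      also have "\<dots> \<le> K * sqrt b" using mass[of s b] b R s by (simp add: W_def[abs_def])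
      finally show ?thesis by simp
    qed
    \<comment> \<open>At this radius the quadratic lower bound exceeds \<open>K * sqrt b\<close>; the summands 1 and \<open>2 * s\<close> give \<open>sqrt b \<le> b\<close> and \<open>b / 2 \<le> b - s\<close>.\<close>
    define b where "b = (\<bar>K\<bar> * 8 / W1 s + 1 + 2 * s)"
    have b1: "2 * s \<le> b" "1 \<le> b" using m R s by (auto simp: b_def)
    have "(b / 2)\<^sup>2 \<le> (b - s)\<^sup>2" using b1 by (intro power_mono) auto
    then have "W1 s / 2 * (b / 2)\<^sup>2 \<le> W1 s / 2 * (b - s)\<^sup>2" using m by (intro mult_left_mono) auto
    also have "\<dots> \<le> K * sqrt b" using quad b1 s R by auto
    also have "\<dots> \<le> \<bar>K\<bar> * b"
      using b1 by (intro mult_mono real_le_lsqrt) (auto simp: power2_eq_square)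
    finally have "W1 s * b * b \<le> \<bar>K\<bar> * 8 * b" by (simp add: power2_eq_square)
    then have "W1 s * b \<le> \<bar>K\<bar> * 8" using b1 by simp
    moreover have "W1 s * b > \<bar>K\<bar> * 8"
    proof -
      have "W1 s * b = \<bar>K\<bar> * 8 + W1 s * (1 + 2 * s)" using m by (simp add: b_def field_simps)
      then show ?thesis using m s R by (simp add: add_pos_pos)
    qed
    ultimately show False by simp
  qed
  have anti: "W b \<le> W t" if "R < t" "t \<le> b" for t b
    by (rule DERIV_nonpos_imp_nonincreasing[OF that(2)])
       (use W1_le dW R that in \<open>meson less_le_trans less_trans order_trans\<close>)
  have bound: "W b \<le> 2 * K / sqrt b" if b: "2 * R < b" for b
  proof -
    have "integral {b/2..b} (\<lambda>t. W b) \<le> integral {b/2..b} W"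
    proof (rule integral_le)
      show "W integrable_on {b/2..b}"
        by (intro integrable_continuous_interval)
           (unfold W_def, use R b in \<open>intro continuous_intros continuous_w; auto\<close>)
    qed (use anti b in auto)
    also have "\<dots> \<le> K * sqrt b" using mass[of "b/2" b] b R by (simp add: W_def[abs_def])
    finally have "W b * b \<le> 2 * K * sqrt b" using b R by (simp add: ac_simps)
    moreover have "W b * b = (W b * sqrt b) * sqrt b" using b R by simp
    ultimately have "(W b * sqrt b) * sqrt b \<le> (2 * K) * sqrt b" by simp
    moreover have "0 < sqrt b" using b R by simp
    ultimately have "W b * sqrt b \<le> 2 * K" by (simp only: mult_le_cancel_right_pos)
    then show ?thesis using \<open>0 < sqrt b\<close> by (simp only: pos_le_divide_eq)
  qed
  show ?thesis
  proof (rule tendsto_sandwich)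
    show "eventually (\<lambda>b. 0 \<le> W b) at_top" by (simp add: W_nonneg)
    show "eventually (\<lambda>b. W b \<le> 2 * K / sqrt b) at_top"
      using eventually_gt_at_top[of "2 * R"] by eventually_elim (rule bound)
    show "((\<lambda>b. 2 * K / sqrt b) \<longlongrightarrow> 0) at_top"
      by (rule tendsto_divide_0[OF tendsto_const]) (simp add: filterlim_at_top_imp_at_infinity sqrt_at_top)
  qed simp
qed

text \<open>Maximum principle: at a positive interior maximum of \<open>W - A z\<close> the second derivative would be positive, and there is no
other place for a positive maximum, because \<open>W - A z\<close> is nonpositive at \<open>R\<close> and at most \<open>W\<close>, which tends to \<open>0\<close>.\<close>

theorem exponential_decay:
  "\<exists>C1>0. \<exists>C2>0. \<exists>R>0. \<forall>r>R. w r / r \<le> C1 * r powr (- (3 / 4)) * exp (- C2 * sqrt r)"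
proof -
  obtain R where R: "R0 \<le> R" and V: "\<And>r. R \<le> r \<Longrightarrow> V r \<le> c / (2 * r)"
    using potential_dominates by blast
  have Rpos: "0 < R" using R R0 by simp
  have W2: "c / r * W r \<le> W2 r" if r: "R \<le> r" for r
  proof -
    have "c / r \<le> 2 * (\<Phi> r - V r)"
      using V[OF r] \<Phi>[of r] r R by (simp add: field_simps)
    then have "c / r * W r \<le> 2 * (\<Phi> r - V r) * W r" by (intro mult_right_mono W_nonneg)
    then show ?thesis using W2_lower[of r] by simp
  qed
  have "0 \<le> W2 r" if r: "R \<le> r" for r
  proof -
    have "0 \<le> c / r * W r" using r Rpos c W_nonneg by simp
    then show ?thesis using W2[OF r] by simp
  qed
  note W0 = W_tendsto_0[OF Rpos this]
  define k where "k = sqrt c"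
  have k: "0 < k" "k\<^sup>2 = c" using c by (auto simp: k_def)
  define z where "z r = sqrt r * exp (- (2 * k * sqrt r))" for r
  define z1 where "z1 r = (1 / (2 * sqrt r) - k) * exp (- (2 * k * sqrt r))" for r
  define z2 where "z2 r = (- 1 / (4 * sqrt r ^ 3) - k * (1 / (2 * sqrt r) - k) / sqrt r) * exp (- (2 * k * sqrt r))" for r
  have z: "(z has_real_derivative z1 r) (at r)" "(z1 has_real_derivative z2 r) (at r)"
    "z2 r \<le> c / r * z r" if "0 < r" for r
    using barrier_second_derivative[OF that, of k] k unfolding z_def[abs_def] z1_def[abs_def] z2_def
    by auto
  \<comment> \<open>The summand 1 makes \<open>A\<close> positive even if \<open>W R = 0\<close>.\<close>
  define A where "A = W R / z R + 1"
  have zpos: "0 < z r" if "0 < r" for r using that by (simp add: z_def)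
  have A: "0 < A" using zpos[OF Rpos] W_nonneg[of R] by (simp add: A_def add_nonneg_pos)
  define y where "y r = W r - A * z r" for r
  define y1 where "y1 r = W1 r - A * z1 r" for r
  define y2 where "y2 r = W2 r - A * z2 r" for r
  have dy: "(y has_real_derivative y1 r) (at r)" if "0 < r" for r
    unfolding y_def[abs_def] y1_def by (intro DERIV_diff DERIV_cmult dW z that)
  have dy1: "(y1 has_real_derivative y2 r) (at r)" if "0 < r" for r
    unfolding y1_def[abs_def] y2_def by (intro DERIV_diff DERIV_cmult dW1 z that)
  have cont_y: "continuous_on S y" if "S \<subseteq> {0<..}" for S
  proof (intro continuous_at_imp_continuous_on ballI)
    fix x assume "x \<in> S"
    then show "isCont y x" using that by (intro DERIV_isCont[OF dy]) auto
  qed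
  have yR: "y R \<le> 0" using zpos[OF Rpos] by (simp add: y_def A_def field_simps)
  have y2pos: "0 < y2 r" if "R \<le> r" "0 < y r" for r
  proof -
    have r: "0 < r" using that Rpos by simp
    have "A * z2 r \<le> A * (c / r * z r)" using z(3)[OF r] A by (intro mult_left_mono) auto
    then have "c / r * y r \<le> y2 r" using W2[OF that(1)] by (simp add: y_def y2_def algebra_simps)
    moreover have "0 < c / r * y r" using c r that by simp
    ultimately show ?thesis by simp
  qed
  have y_le: "y r \<le> W r" if "0 < r" for r using zpos[OF that] A by (simp add: y_def)
  have neg: "y s \<le> 0" if s: "R \<le> s" for s
  proof (rule ccontr)
    assume "\<not> y s \<le> 0"
    then have ys: "0 < y s" by simp
    have "eventually (\<lambda>b. W b < y s) at_top" using W0 ys by (rule order_tendstoD)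
    then have "eventually (\<lambda>b. W b < y s \<and> s < b) at_top"
      by (intro eventually_conj eventually_gt_at_top)
    then obtain b where b: "s < b" "W b < y s"
      unfolding eventually_at_top_linorder by blast
    have "continuous_on {R..b} y"
      using Rpos by (intro cont_y) auto
    then obtain m where m: "m \<in> {R..b}" "\<And>t. t \<in> {R..b} \<Longrightarrow> y t \<le> y m"
      using continuous_attains_sup[OF compact_Icc, of R b y] s b by auto
    have ym: "0 < y m" using m(2)[of s] ys s b by auto
    have "m \<noteq> R" using ym yR by auto
    moreover have "m \<noteq> b" using m(2)[of s] b y_le[of b] s Rpos by auto
    ultimately have mm: "R < m" "m < b" using m(1) by auto
    have mpos: "0 < m" using mm Rpos by simp
    have y1m: "y1 m = 0"
      by (rule DERIV_local_max[OF dy[OF mpos], of "min (m - R) (b - m)"]) (use mm m(2) in \<open>auto simp: abs_if split: if_splits\<close>)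
    obtain d where d: "0 < d" "\<And>h. 0 < h \<Longrightarrow> h < d \<Longrightarrow> y1 m < y1 (m + h)"
      using DERIV_pos_inc_right[OF dy1[OF mpos] y2pos] mm ym by auto
    define h where "h = min d (b - m) / 2"
    have h: "0 < h" "h < d" "m + h < b" using d mm by (auto simp: h_def min_def field_simps)
    have "y m < y (m + h)"
    proof (rule DERIV_pos_imp_increasing_open[of m "m + h" y])
      show "m < m + h" using h by simp
      show "\<exists>l. ((y has_real_derivative l) (at x)) \<and> 0 < l" if "m < x" "x < m + h" for x
        using d(2)[of "x - m"] that h y1m dy[of x] mpos by auto
      show "continuous_on {m..m + h} y"
        using mpos by (intro cont_y) auto
    qed
    then show False using m(2)[of "m + h"] h mm by auto
  qed
  have "w r / r \<le> sqrt A * r powr (- (3 / 4)) * exp (- k * sqrt r)" if r: "R < r" for r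
  proof -
    have rp: "0 < r" using r Rpos by simp
    have "(w r)\<^sup>2 \<le> A * z r" using neg[of r] r by (simp add: y_def W_def)
    also have "\<dots> = (sqrt A * r powr (1 / 4) * exp (- k * sqrt r))\<^sup>2"
    proof -
      have "(r powr (1 / 4))\<^sup>2 = sqrt r" using rp by (simp add: power2_eq_square powr_half_sqrt flip: powr_add)
      moreover have "(exp (- k * sqrt r))\<^sup>2 = exp (- (2 * k * sqrt r))"
        by (simp add: power2_eq_square flip: exp_add)
      ultimately show ?thesis using A by (simp add: power_mult_distrib z_def)
    qed
    finally have "w r \<le> sqrt A * r powr (1 / 4) * exp (- k * sqrt r)"
      by (rule power2_le_imp_le) (use A in simp)
    then have "w r / r \<le> sqrt A * r powr (1 / 4) * exp (- k * sqrt r) / r"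
      using rp by (intro divide_right_mono) auto
    also have "\<dots> = sqrt A * (r powr (1 / 4) / r) * exp (- k * sqrt r)" by simp
    also have "r powr (1 / 4) / r = r powr (- (3 / 4))"
      using rp powr_diff[of r "1/4" 1] by simp
    finally show ?thesis .
  qed
  then show ?thesis using A k Rpos by (intro exI[of _ "sqrt A"] exI[of _ k] exI[of _ R] conjI) auto
qed

end

section \<open>Decay of radial solutions\<close>

theorem theorem6p1:
  fixes p \<mu> :: real and u :: "real^3 \<Rightarrow> real"
  assumes "2 < p" and "p < 5" and "\<mu> > 0"
    and "u \<in> E_space" and "radial_ae u" and "weak_solution p \<mu> u"
  shows "\<exists>v. continuous_radial_profile u v \<and>
           (\<exists>C1>0. \<exists>C2>0. \<exists>R>0. \<forall>r>R.
              v r \<le> C1 * r powr (- (3 / 4)) * exp (- C2 * sqrt r))"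
proof (cases "AE x in lborel. u x = 0")
  case True
  then have "continuous_radial_profile u (\<lambda>r. 0)" by (simp add: continuous_radial_profile_def)
  moreover have "\<forall>r>1. (0::real) \<le> 1 * r powr (- (3 / 4)) * exp (- 1 * sqrt r)" by simp
  ultimately show ?thesis using zero_less_one by blast
next
  case False
  have u_meas: "u \<in> borel_measurable borel" and u6: "integrable lborel (\<lambda>x. \<bar>u x\<bar> ^ 6)"
    and fin: "(\<integral>\<^sup>+x. \<integral>\<^sup>+y. ennreal ((u x)\<^sup>2 * (u y)\<^sup>2 / norm (x - y)) \<partial>lborel \<partial>lborel) < \<infinity>"
    using assms(4) by (auto simp: E_space_def D12_def)
  obtain x0 where x0: "integrable lborel (\<lambda>y. (u y)\<^sup>2 / norm (x0 - y))"
    using energy_finite_point[OF u_meas fin False] by blast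
  interpret coulomb_density u x0 by unfold_locales (fact u_meas u6 x0)+
  obtain v0 where v0: "v0 \<in> borel_measurable borel" and uv: "AE x in lborel. u x = v0 (norm x)"
    using radial_ae_borel_profile[OF u_meas assms(5)] by blast
  define e :: "real^3" where "e = axis 1 1"
  have e: "norm e = 1" by (simp add: e_def norm_axis_1)
  define \<Phi> where "\<Phi> r = coulomb_potential u (r *\<^sub>R e)" for r
  have \<Phi>_cont: "continuous_on UNIV \<Phi>"
    unfolding \<Phi>_def coulomb_potential_newton
    by (intro continuous_intros continuous_on_compose2[OF newton_continuous]) auto
  have \<Phi>_eq: "coulomb_potential u x = \<Phi> (norm x)" for x
    unfolding \<Phi>_def by (rule coulomb_potential_radial[OF u_meas uv v0]) (simp add: e)
  obtain w w1 where "\<forall>r>0. (w has_real_derivative w1 r) (at r)"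
    "\<forall>r>0. (w1 has_real_derivative (\<Phi> r - \<mu> * \<bar>w r / r\<bar> powr (p - 1)) * w r) (at r)"
    and wv: "AE r in lborel. 0 < r \<longrightarrow> v0 r = w r / r"
    using radial_classical_solution[OF assms(1,2) u_meas u6 assms(6) v0 uv \<Phi>_cont \<Phi>_eq]
    by (elim exE conjE)
  note w = this(1)[rule_format] and w1 = this(2)[rule_format]
  have w_cont: "continuous_on {0<..} w"
    by (intro continuous_at_imp_continuous_on ballI DERIV_isCont[OF w]) auto
  obtain c R where c: "0 < c" and R: "0 < R" and low: "\<And>x. R \<le> norm x \<Longrightarrow> c / norm x \<le> newton x"
    using newton_lower_bound[OF False] by metis
  have \<Phi>_low: "c / (4 * pi) / r \<le> \<Phi> r" if "R \<le> r" for r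
  proof -
    have "c / r \<le> newton (r *\<^sub>R e)" using low[of "r *\<^sub>R e"] that R e by simp
    then have "c / r / (4 * pi) \<le> newton (r *\<^sub>R e) / (4 * pi)" by (intro divide_right_mono) auto
    then show ?thesis by (simp add: \<Phi>_def coulomb_potential_newton mult.commute)
  qed
  obtain K where K: "0 \<le> K" "\<And>b. 0 \<le> b \<Longrightarrow>
      (\<integral>\<^sup>+x. ennreal (indicator (cball 0 b) x * (u x)\<^sup>2) \<partial>lborel) \<le> ennreal (K * sqrt b)"
    using mass_bound[OF u_meas fin] by metis
  interpret radial_ode p \<mu> "c / (4 * pi)" R K w w1 \<Phi>
  proof
    show "integral {a..b} (\<lambda>r. (w r)\<^sup>2) \<le> K * sqrt b" if "0 < a" "a \<le> b" for a b
      by (rule radial_mass_bound[OF u_meas K v0 uv w_cont wv that])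
  qed (use assms c R w w1 \<Phi>_low in auto)
  have "continuous_radial_profile u (\<lambda>r. w r / r)"
    unfolding continuous_radial_profile_def
  proof
    show "continuous_on {0<..} (\<lambda>r. w r / r)" by (intro continuous_intros w_cont) auto
    define g where "g r = indicator {0<..} r *\<^sub>R (w r / r)" for r
    have [measurable]: "g \<in> borel_measurable borel" unfolding g_def
      by (rule borel_measurable_continuous_on_indicator) (auto intro!: continuous_intros w_cont)
    note v0 [measurable]
    have "AE r in lborel. 0 < r \<longrightarrow> v0 r = g r" using wv by eventually_elim (simp add: g_def)
    then have "AE x in lborel. v0 (norm (x::real^3)) = g (norm x)"
      by (subst AE_radial) measurable
    then show "AE x in lborel. u x = w (norm x) / norm x"
      using uv AE_lborel_singleton[of 0] by eventually_elim (simp add: g_def)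
  qed
  then show ?thesis using exponential_decay by blast
qed

end
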